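(* Let $A\subset B$ be a projective finite ring extension of integral domains, with fields of fractions $K$ and $L$, respectively. Then $$\mathrm{d}_K(L)\leq \mathrm{d}_A(B)\leq \mathrm{rank}_A(B)=[L:K].$$ If moreover the field extension $K\subset L$ is simple, then $$\mathrm{d}_K(L)=\mathrm{d}_A(B)=\mathrm{rank}_A(B)=[L:K].$$
   Context: All rings are commutative with unity. A projective finite ring extension $A\subset B$ is one where $B$ is a finitely generated projective $A$-module. For an integral ring extension $A\subset B$ of integral domains and $b\in B$, the integral degree of $b$ over $A$, denoted $\mathrm{id}_A(b)$, is the minimum integer $n\geq 1$ such that $b$ is a root of a monic polynomial of degree $n$ in $A[T]$. The integral degree of $B$ over $A$ is $\mathrm{d}_A(B)=\sup\{\mathrm{id}_A(b)\mid b\in B\}$ (possibly $\infty$); the same definition applies to the algebraic field extension $K\subset L$, giving $\mathrm{d}_K(L)$. For a finitely generated projective module $N$ over a domain $A$, $\mathrm{rank}_A(N)$ is the rank of the free $A_{\mathfrak{p}}$-module $N_{\mathfrak{p}}$, which is independent of the prime $\mathfrak{p}\in\mathrm{Spec}(A)$. A field extension $K\subset L$ is simple if $L=K(\alpha)$ for some $\alpha\in L$. *)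

theory Defs
  imports
    "HOL-Algebra.Embedded_Algebras"
    "HOL-Algebra.Generated_Fields"
    "HOL-Algebra.Module"
    "HOL-Algebra.Polynomials"
    "HOL-Library.Extended_Nat"
begin

text \<open>Subrings of a ring \<open>R\<close> are subsets \<open>A\<close> of its carrier (as in \<^theory>\<open>HOL-Algebra.Subrings\<close>);
  the ring \<open>A\<close> itself is \<open>R\<lparr>carrier := A\<rparr>\<close>.\<close>

section \<open>Modules\<close>

text \<open>A subset \<open>B\<close> of \<open>R\<close> as a module over any subring of \<open>R\<close> whose elements act on \<open>B\<close> by the
  multiplication of \<open>R\<close>; the scalars are chosen by the first argument of \<^const>\<open>module\<close>.\<close>

definition mult_module :: "('a, 'c) ring_scheme \<Rightarrow> 'a set \<Rightarrow> ('a, 'a) module" where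
  "mult_module R B =
     \<lparr>carrier = B, monoid.mult = monoid.mult R, monoid.one = monoid.one R,
      ring.zero = ring.zero R, ring.add = ring.add R, smult = monoid.mult R\<rparr>"

definition linear_maps ::
  "('r, 'c) ring_scheme \<Rightarrow> ('r, 'm, 'd) module_scheme \<Rightarrow> ('r, 'n, 'e) module_scheme \<Rightarrow> ('m \<Rightarrow> 'n) set"
where
  "linear_maps R M N =
     {f \<in> carrier M \<rightarrow> carrier N.
        (\<forall>x \<in> carrier M. \<forall>y \<in> carrier M. f (x \<oplus>\<^bsub>M\<^esub> y) = f x \<oplus>\<^bsub>N\<^esub> f y) \<and>
        (\<forall>r \<in> carrier R. \<forall>x \<in> carrier M. f (r \<odot>\<^bsub>M\<^esub> x) = r \<odot>\<^bsub>N\<^esub> f x)}"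

definition finitely_generated_module ::
  "('r, 'c) ring_scheme \<Rightarrow> ('r, 'm, 'd) module_scheme \<Rightarrow> bool" where
  "finitely_generated_module R M \<longleftrightarrow>
     module R M \<and>
     (\<exists>S. finite S \<and> S \<subseteq> carrier M \<and>
        (\<forall>x \<in> carrier M. \<exists>a \<in> S \<rightarrow> carrier R. x = (\<Oplus>\<^bsub>M\<^esub>s\<in>S. a s \<odot>\<^bsub>M\<^esub> s)))"

text \<open>The lifting property. HOL cannot quantify over the types of the modules \<open>P\<close> and \<open>Q\<close>, so
  the types are fixed as follows: \<open>P\<close> has elements of type \<^typ>\<open>nat \<Rightarrow> 'r\<close>, which accommodates all
  free modules \<open>R\<^sup>n\<close>, and \<open>Q\<close> has the element type of \<open>M\<close>, which accommodates \<open>M\<close> itself.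
  For finitely generated \<open>M\<close> this is no restriction: lifting the identity of \<open>M\<close> along a
  surjection \<open>R\<^sup>n \<rightarrow> M\<close> exhibits \<open>M\<close> as a direct summand of \<open>R\<^sup>n\<close>, and direct summands of free
  modules have the lifting property with respect to all modules of all types.\<close>

definition projective_module ::
  "('r, 'c) ring_scheme \<Rightarrow> ('r, 'm, 'd) module_scheme \<Rightarrow> bool" where
  "projective_module R M \<longleftrightarrow>
     module R M \<and>
     (\<forall>(P :: ('r, nat \<Rightarrow> 'r) module) (Q :: ('r, 'm) module).
        module R P \<longrightarrow> module R Q \<longrightarrow>
        (\<forall>g \<in> linear_maps R P Q. \<forall>f \<in> linear_maps R M Q.
           g ` carrier P = carrier Q \<longrightarrow>
           (\<exists>h \<in> linear_maps R M P. \<forall>x \<in> carrier M. g (h x) = f x)))"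

definition free_of_rank ::
  "('r, 'c) ring_scheme \<Rightarrow> ('r, 'm, 'd) module_scheme \<Rightarrow> nat \<Rightarrow> bool" where
  "free_of_rank R M n \<longleftrightarrow>
     module R M \<and>
     (\<exists>S. finite S \<and> card S = n \<and> S \<subseteq> carrier M \<and>
        (\<forall>x \<in> carrier M. \<exists>!a. a \<in> S \<rightarrow>\<^sub>E carrier R \<and> x = (\<Oplus>\<^bsub>M\<^esub>s\<in>S. a s \<odot>\<^bsub>M\<^esub> s)))"

section \<open>Localization\<close>

text \<open>Here \<open>S\<close> is a multiplicative subset of \<open>R\<close>, and the pair \<open>(m, s)\<close> stands for the
  fraction \<open>m / s\<close>.\<close>

definition frac_rel ::
  "('r, 'c) ring_scheme \<Rightarrow> 'r set \<Rightarrow> ('r, 'm, 'd) module_scheme \<Rightarrow> (('m \<times> 'r) \<times> ('m \<times> 'r)) set"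
where
  "frac_rel R S M =
     {((m, s), (m', s')) | m s m' s'.
        m \<in> carrier M \<and> s \<in> S \<and> m' \<in> carrier M \<and> s' \<in> S \<and>
        (\<exists>t \<in> S. t \<odot>\<^bsub>M\<^esub> (s' \<odot>\<^bsub>M\<^esub> m) = t \<odot>\<^bsub>M\<^esub> (s \<odot>\<^bsub>M\<^esub> m'))}"

definition fraction ::
  "('r, 'c) ring_scheme \<Rightarrow> 'r set \<Rightarrow> ('r, 'm, 'd) module_scheme \<Rightarrow> 'm \<Rightarrow> 'r \<Rightarrow> ('m \<times> 'r) set"
where
  "fraction R S M m s = frac_rel R S M `` {(m, s)}"

text \<open>In the operations below, the unions range over all representatives of the arguments; the
  results do not depend on the representatives.\<close>

definition frac_add ::
  "('r, 'c) ring_scheme \<Rightarrow> 'r set \<Rightarrow> ('r, 'm, 'd) module_scheme \<Rightarrow>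
   ('m \<times> 'r) set \<Rightarrow> ('m \<times> 'r) set \<Rightarrow> ('m \<times> 'r) set"
where
  "frac_add R S M x y =
     (\<Union>(m, s) \<in> x. \<Union>(m', s') \<in> y.
        fraction R S M ((s' \<odot>\<^bsub>M\<^esub> m) \<oplus>\<^bsub>M\<^esub> (s \<odot>\<^bsub>M\<^esub> m')) (s \<otimes>\<^bsub>R\<^esub> s'))"

definition frac_smult ::
  "('r, 'c) ring_scheme \<Rightarrow> 'r set \<Rightarrow> ('r, 'm, 'd) module_scheme \<Rightarrow>
   ('r \<times> 'r) set \<Rightarrow> ('m \<times> 'r) set \<Rightarrow> ('m \<times> 'r) set"
where
  "frac_smult R S M x y =
     (\<Union>(a, s) \<in> x. \<Union>(m, s') \<in> y. fraction R S M (a \<odot>\<^bsub>M\<^esub> m) (s \<otimes>\<^bsub>R\<^esub> s'))"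

definition localized_ring :: "('r, 'c) ring_scheme \<Rightarrow> 'r set \<Rightarrow> ('r \<times> 'r) set ring" where
  "localized_ring R S =
     (let M = mult_module R (carrier R) in
      \<lparr>carrier = (carrier R \<times> S) // frac_rel R S M,
       monoid.mult = frac_smult R S M,
       monoid.one = fraction R S M \<one>\<^bsub>R\<^esub> \<one>\<^bsub>R\<^esub>,
       ring.zero = fraction R S M \<zero>\<^bsub>R\<^esub> \<one>\<^bsub>R\<^esub>,
       ring.add = frac_add R S M\<rparr>)"

text \<open>The record type demands the fields \<^const>\<open>monoid.mult\<close> and \<^const>\<open>monoid.one\<close>, which play no role
  for modules.\<close>

definition localized_module ::
  "('r, 'c) ring_scheme \<Rightarrow> 'r set \<Rightarrow> ('r, 'm, 'd) module_scheme \<Rightarrow>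
   (('r \<times> 'r) set, ('m \<times> 'r) set) module"
where
  "localized_module R S M =
     \<lparr>carrier = (carrier M \<times> S) // frac_rel R S M,
      monoid.mult = undefined,
      monoid.one = undefined,
      ring.zero = fraction R S M \<zero>\<^bsub>M\<^esub> \<one>\<^bsub>R\<^esub>,
      ring.add = frac_add R S M,
      smult = frac_smult R S M\<rparr>"

text \<open>For a finitely generated projective module over a domain, all localizations at primes are
  free of one and the same rank, which is the number denoted here.\<close>

definition module_rank :: "('r, 'c) ring_scheme \<Rightarrow> ('r, 'm, 'd) module_scheme \<Rightarrow> nat" where
  "module_rank R M =
     (THE n. \<forall>p. primeideal p R \<longrightarrow>
        free_of_rank (localized_ring R (carrier R - p)) (localized_module R (carrier R - p) M) n)"

section \<open>Fields of fractions and degrees\<close>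

definition fraction_field :: "('a, 'c) ring_scheme \<Rightarrow> 'a set \<Rightarrow> 'a set" where
  "fraction_field F A = {a \<otimes>\<^bsub>F\<^esub> inv\<^bsub>F\<^esub> s | a s. a \<in> A \<and> s \<in> A - {\<zero>\<^bsub>F\<^esub>}}"

definition field_degree :: "('a, 'c) ring_scheme \<Rightarrow> 'a set \<Rightarrow> 'a set \<Rightarrow> enat" where
  "field_degree F K L =
     (if ring.finite_dimension F K L then enat (ring.dim F K L) else \<infinity>)"

definition simple_field_extension :: "('a, 'c) ring_scheme \<Rightarrow> 'a set \<Rightarrow> 'a set \<Rightarrow> bool" where
  "simple_field_extension F K L \<longleftrightarrow> (\<exists>\<alpha> \<in> L. L = generate_field F (insert \<alpha> K))"

text \<open>The infimum of a nonempty set of extended natural numbers is its minimum; the value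
  \<open>\<infinity>\<close> is attained exactly when \<open>b\<close> is not integral over \<open>A\<close>.\<close>

definition integral_degree_elem :: "('a, 'c) ring_scheme \<Rightarrow> 'a set \<Rightarrow> 'a \<Rightarrow> enat" where
  "integral_degree_elem F A b =
     Inf {enat n | n. n \<ge> 1 \<and>
            (\<exists>p \<in> carrier (univ_poly F A).
               lead_coeff p = \<one>\<^bsub>F\<^esub> \<and> degree p = n \<and> ring.eval F p b = \<zero>\<^bsub>F\<^esub>)}"

definition integral_degree :: "('a, 'c) ring_scheme \<Rightarrow> 'a set \<Rightarrow> 'a set \<Rightarrow> enat" where
  "integral_degree F A B = (SUP b \<in> B. integral_degree_elem F A b)"

end

theory Submission
  imports Defs "Jordan_Normal_Form.Char_Poly" "HOL-Algebra.Finite_Extensions"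
begin

text \<open>For a prime \<open>p\<close> of \<open>A\<close>, a dual basis of the projective module \<open>B\<close> localizes to a dual basis of
  \<open>B\<^sub>p\<close> over \<open>A\<^sub>p\<close>. Discarding redundant generators as long as the matrix of the coordinate
  functionals is not the identity modulo the maximal ideal, one arrives at a free basis, by
  Nakayama's lemma. It is also a basis over \<open>K\<close> of \<open>(A - {0})\<^sup>-\<^sup>1 B\<close>, which is all of \<open>L\<close>, being a
  domain of finite dimension over \<open>K\<close>. Hence the rank is \<open>n = [L : K]\<close>.

  Multiplication by \<open>b \<in> B\<close> on \<open>B\<^sub>p\<close> is given by an \<open>n \<times> n\<close> matrix over \<open>A\<^sub>p\<close>, whose characteristic
  polynomial shows that \<open>b\<^sup>n\<close> is an \<open>A\<^sub>p\<close>-combination of lower powers of \<open>b\<close>. As this holds for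
  all \<open>p\<close>, it is even an \<open>A\<close>-combination, so \<open>b\<close> has integral degree at most \<open>n\<close> over \<open>A\<close>.
  Every \<open>x \<in> L\<close> has a multiple \<open>a x \<in> B\<close> with \<open>0 \<noteq> a \<in> A\<close>, and an integral equation of \<open>a x\<close> over \<open>A\<close>
  yields one of \<open>x\<close> over \<open>K\<close> of the same degree. Finally, if \<open>L = K(\<alpha>)\<close>, then \<open>\<alpha>\<close> has degree \<open>n\<close>
  over \<open>K\<close>.\<close>

section \<open>Determinants over the rings of HOL-Algebra\<close>

text \<open>\<open>B\<close> is only locally free over \<open>A\<close>, so the characteristic
  polynomial of multiplication by \<open>b\<close> is at hand only over each \<open>A_p\<close>.
  What gets glued is not the polynomials but the bare existence of an integral equation of a
  prescribed degree. This needs the same degree at all primes, so the local ranks are compared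
  first: every local basis is a \<open>K\<close>-basis of one and the same space.

  That this space is all of \<open>L\<close> cannot be taken for granted, since \<open>L\<close>
  also allows denominators from \<open>B\<close>. Inverting these requires finite dimension over
  \<open>K\<close>, which the local basis at the zero prime supplies.

  All localizations are realised as subsets of the ambient field, where fractions are ordinary
  elements and common factors cancel. The equivalence classes of pairs that define the rank are
  reached from there by a single semilinear isomorphism.

  The determinants are those of rings at the level of types; a product ring that projects onto every
  commutative ring carried by a subset of the type brings them to rings given by carriers.\<close>

definition cring_or_trivial :: "'a ring \<Rightarrow> 'a ring" where
  "cring_or_trivial R =
     (if cring R then R
      else \<lparr>carrier = {undefined}, monoid.mult = (\<lambda>_ _. undefined), monoid.one = undefined,
            ring.zero = undefined, ring.add = (\<lambda>_ _. undefined)\<rparr>)"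

text \<open>The product below ranges over all records of type \<open>'a ring\<close>, most of which
  are not rings. Putting a one-point zero ring in their place makes every factor a commutative
  ring.\<close>

lemma cring_cring_or_trivial: "cring (cring_or_trivial R)"
proof (cases "cring R")
  case False
  show ?thesis
    unfolding cring_or_trivial_def using False
    by (auto intro!: cringI abelian_groupI comm_monoidI)
qed (simp add: cring_or_trivial_def)

interpretation cring_or_trivial: cring "cring_or_trivial R" for R
  by (rule cring_cring_or_trivial)

text \<open>The product of all commutative rings carried by subsets of \<^typ>\<open>'a\<close>. Being a commutative
  ring at the level of types which projects onto each of these rings, it gives access to the
  type-class based determinants. The factor \<^typ>\<open>int\<close> only serves to make \<open>0 \<noteq> 1\<close>.\<close>

typedef 'a universal_ring =
  "{x :: int \<times> ('a ring \<Rightarrow> 'a). \<forall>R. snd x R \<in> carrier (cring_or_trivial R)}"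
proof
  show "(0, \<lambda>R. \<zero>\<^bsub>cring_or_trivial R\<^esub>) \<in>
    {x :: int \<times> ('a ring \<Rightarrow> 'a). \<forall>R. snd x R \<in> carrier (cring_or_trivial R)}"
    by simp
qed

setup_lifting type_definition_universal_ring


instantiation universal_ring :: (type) comm_ring_1
begin

lift_definition zero_universal_ring :: "'a universal_ring" is
  "(0, \<lambda>R. \<zero>\<^bsub>cring_or_trivial R\<^esub>)" by simp

lift_definition one_universal_ring :: "'a universal_ring" is
  "(1, \<lambda>R. \<one>\<^bsub>cring_or_trivial R\<^esub>)" by simp

lift_definition plus_universal_ring :: "'a universal_ring \<Rightarrow> 'a universal_ring \<Rightarrow> 'a universal_ring"
  is "\<lambda>x y. (fst x + fst y, \<lambda>R. snd x R \<oplus>\<^bsub>cring_or_trivial R\<^esub> snd y R)" by simp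

lift_definition times_universal_ring :: "'a universal_ring \<Rightarrow> 'a universal_ring \<Rightarrow> 'a universal_ring"
  is "\<lambda>x y. (fst x * fst y, \<lambda>R. snd x R \<otimes>\<^bsub>cring_or_trivial R\<^esub> snd y R)" by simp

lift_definition uminus_universal_ring :: "'a universal_ring \<Rightarrow> 'a universal_ring"
  is "\<lambda>x. (- fst x, \<lambda>R. \<ominus>\<^bsub>cring_or_trivial R\<^esub> snd x R)" by simp

definition minus_universal_ring :: "'a universal_ring \<Rightarrow> 'a universal_ring \<Rightarrow> 'a universal_ring"
  where "minus_universal_ring x y = x + (- y)"

instance
proof
  fix a b c :: "'a universal_ring"
  show "a * b * c = a * (b * c)" by transfer (auto simp: cring_or_trivial.m_assoc)
  show "a * b = b * a" by transfer (auto simp: cring_or_trivial.m_comm)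
  show "1 * a = a" by transfer (auto simp: prod_eq_iff)
  show "a + b + c = a + (b + c)" by transfer (auto simp: cring_or_trivial.a_assoc)
  show "a + b = b + a" by transfer (auto simp: cring_or_trivial.a_comm)
  show "0 + a = a" by transfer (auto simp: prod_eq_iff)
  show "- a + a = 0" by transfer (auto simp: cring_or_trivial.l_neg)
  show "a - b = a + - b" by (rule minus_universal_ring_def)
  show "(a + b) * c = a * c + b * c" by transfer (auto simp: cring_or_trivial.l_distr algebra_simps)
  show "(0 :: 'a universal_ring) \<noteq> 1" by transfer simp
qed

end

lift_definition universal_proj :: "'a ring \<Rightarrow> 'a universal_ring \<Rightarrow> 'a" is "\<lambda>R x. snd x R" .

lemma universal_proj_hom:
  fixes R :: "'a ring"
  assumes "cring R"
  shows "universal_proj R 0 = \<zero>\<^bsub>R\<^esub>" "universal_proj R 1 = \<one>\<^bsub>R\<^esub>"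
    "universal_proj R (x + y) = universal_proj R x \<oplus>\<^bsub>R\<^esub> universal_proj R y"
    "universal_proj R (x * y) = universal_proj R x \<otimes>\<^bsub>R\<^esub> universal_proj R y"
    "range (universal_proj R) = carrier R"
proof -
  have R: "cring_or_trivial R = R" using assms by (simp add: cring_or_trivial_def)
  show "universal_proj R 0 = \<zero>\<^bsub>R\<^esub>" "universal_proj R 1 = \<one>\<^bsub>R\<^esub>"
    "universal_proj R (x + y) = universal_proj R x \<oplus>\<^bsub>R\<^esub> universal_proj R y"
    "universal_proj R (x * y) = universal_proj R x \<otimes>\<^bsub>R\<^esub> universal_proj R y"
    by (simp_all only: universal_proj.rep_eq zero_universal_ring.rep_eq one_universal_ring.rep_eq
        plus_universal_ring.rep_eq times_universal_ring.rep_eq snd_conv R)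
  have "universal_proj R z \<in> carrier R" for z
    using Rep_universal_ring[of z] R by (metis (mono_tags) mem_Collect_eq universal_proj.rep_eq)
  moreover have "a \<in> range (universal_proj R)" if "a \<in> carrier R" for a
  proof
    \<comment> \<open>A preimage of \<open>a\<close>: the family with \<open>a\<close> at the index
      \<open>R\<close> and zero at all other indices.\<close>
    let ?x = "(0::int, \<lambda>R'. if R' = R then a else \<zero>\<^bsub>cring_or_trivial R'\<^esub>)"
    have "?x \<in> {x. \<forall>R. snd x R \<in> carrier (cring_or_trivial R)}"
      using that R by simp
    then show "a = universal_proj R (Abs_universal_ring ?x)"
      by (simp add: universal_proj.rep_eq Abs_universal_ring_inverse)
  qed simp
  ultimately show "range (universal_proj R) = carrier R" by blast
qed

lemma (in cring) universal_cover:
  obtains h :: "'a universal_ring \<Rightarrow> 'a"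
  where "range h = carrier R" "h 0 = \<zero>" "h 1 = \<one>"
    "\<And>x y. h (x + y) = h x \<oplus> h y" "\<And>x y. h (x * y) = h x \<otimes> h y"
proof -
  \<comment> \<open>The factors are indexed by plain ring records, while \<open>R\<close> may carry
    further fields. \<open>R'\<close> is \<open>R\<close> without them, with the same carrier and
    operations.\<close>
  define R' :: "'a ring" where "R' = \<lparr>carrier = carrier R, monoid.mult = monoid.mult R,
    monoid.one = one R, ring.zero = zero R, ring.add = add R\<rparr>"
  have R'_simps: "carrier R' = carrier R" "monoid.mult R' = monoid.mult R"
    "one R' = one R" "zero R' = zero R" "add R' = add R"
    by (simp_all add: R'_def)
  have "abelian_group R'"
    by (rule abelian_groupI) (simp_all add: R'_simps a_assoc add.l_inv_ex, rule a_comm)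
  moreover have "comm_monoid R'"
    by (rule comm_monoidI) (simp_all add: R'_simps m_assoc, rule m_comm)
  ultimately have "cring R'"
    by (rule cringI) (simp add: R'_simps l_distr)
  from universal_proj_hom[OF this] show thesis
    by (intro that[of "universal_proj R'"]) (simp_all only: R'_simps)
qed

text \<open>An integral equation solved for its leading power. In this form it is linear in the
  coefficients, so denominators are easily cleared and local equations can be added. For
  \<open>n = 0\<close> the sum is empty and the equation reads
  \<open>\<one> = \<zero>\<close>.\<close>

definition (in ring) integral_of_degree :: "'a set \<Rightarrow> nat \<Rightarrow> 'a \<Rightarrow> bool" where
  "integral_of_degree A n b \<longleftrightarrow>
     (\<exists>c \<in> {..<n} \<rightarrow> A. b [^] n = (\<Oplus>i\<in>{..<n}. c i \<otimes> b [^] i))"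

text \<open>By the Leibniz formula the determinant arises from the entries by sums, products and
  signs, and the polynomials with all coefficients in \<open>S\<close> are closed under these. With
  \<open>S\<close> the preimage of \<open>A\<close> in the universal ring, this keeps the
  coefficients of a characteristic polynomial inside \<open>A\<close>.\<close>

lemma coeff_det_mem:
  fixes M :: "'b::comm_ring_1 poly mat"
  assumes M: "M \<in> carrier_mat n n"
    and zero: "0 \<in> S" and one: "1 \<in> S"
    and add: "\<And>x y. x \<in> S \<Longrightarrow> y \<in> S \<Longrightarrow> x + y \<in> S"
    and mult: "\<And>x y. x \<in> S \<Longrightarrow> y \<in> S \<Longrightarrow> x * y \<in> S"
    and uminus: "\<And>x. x \<in> S \<Longrightarrow> - x \<in> S"
    and entries: "\<And>i j k. i < n \<Longrightarrow> j < n \<Longrightarrow> poly.coeff (M $$ (i, j)) k \<in> S"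
  shows "poly.coeff (det M) k \<in> S"
proof -
  define P :: "'b poly set" where "P = {p. \<forall>k. poly.coeff p k \<in> S}"
  have sum_S: "(\<Sum>x\<in>I. f x) \<in> S" if "\<And>x. x \<in> I \<Longrightarrow> f x \<in> S" for I and f :: "'c \<Rightarrow> 'b"
    using that by (induction I rule: infinite_finite_induct) (auto intro: zero add)
  have P_sum: "(\<Sum>x\<in>I. f x) \<in> P" if "\<And>x. x \<in> I \<Longrightarrow> f x \<in> P" for I and f :: "'c \<Rightarrow> 'b poly"
    using that unfolding P_def by (auto simp: coeff_sum intro: sum_S)
  have P_mult: "p * q \<in> P" if "p \<in> P" "q \<in> P" for p q
    using that unfolding P_def by (auto simp: coeff_mult intro!: sum_S mult)
  have P_one: "1 \<in> P"
    using zero one by (auto simp: P_def)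
  have P_prod: "(\<Prod>x\<in>I. f x) \<in> P" if "\<And>x. x \<in> I \<Longrightarrow> f x \<in> P" for I and f :: "'c \<Rightarrow> 'b poly"
    using that by (induction I rule: infinite_finite_induct) (auto intro: P_one P_mult)
  have P_sign: "signof p \<in> P" for p :: "nat \<Rightarrow> nat"
    using P_one uminus by (auto simp: P_def sign_def)
  have "det M \<in> P"
    unfolding det_def'[OF M]
  proof (intro P_sum P_mult P_sign P_prod)
    fix p i assume "p \<in> {p. p permutes {0..<n}}" "i \<in> {0..<n}"
    then show "M $$ (i, p i) \<in> P"
      using entries by (auto simp: P_def permutes_in_image)
  qed
  then show ?thesis by (simp add: P_def)
qed

text \<open>The Cayley--Hamilton argument: \<open>b\<close> is a root of the characteristic polynomial of \<open>M\<close>.\<close>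

lemma (in domain) integral_of_degree_if_eigenvalue:
  assumes A: "subring A R"
    and M: "\<And>i j. i < n \<Longrightarrow> j < n \<Longrightarrow> M i j \<in> A"
    and x: "\<And>i. i < n \<Longrightarrow> x i \<in> carrier R"
    and nonzero: "\<exists>i<n. x i \<noteq> \<zero>"
    and b: "b \<in> carrier R"
    and eigen: "\<And>i. i < n \<Longrightarrow> b \<otimes> x i = (\<Oplus>j\<in>{..<n}. M i j \<otimes> x j)"
  shows "integral_of_degree A n b"
proof -
  obtain h :: "'a universal_ring \<Rightarrow> 'a" where h_range: "range h = carrier R"
    and h_zero: "h 0 = \<zero>" and h_one: "h 1 = \<one>"
    and h_add: "\<And>x y. h (x + y) = h x \<oplus> h y" and h_mult: "\<And>x y. h (x * y) = h x \<otimes> h y"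
    using universal_cover by metis
  have h_closed [simp]: "h z \<in> carrier R" for z
    using h_range by auto
  have h_uminus: "h (- z) = \<ominus> h z" for z
    using h_add[of z "- z"] h_zero by (simp add: sum_zero_eq_neg a_comm)
  have h_sum: "h (\<Sum>i\<in>I. f i) = (\<Oplus>i\<in>I. h (f i))" if "finite I" for I and f :: "nat \<Rightarrow> _"
    using that by induction (simp_all add: h_zero h_add)
  have h_pow: "h (z ^ k) = h z [^] k" for z k
    by (induction k) (simp_all add: h_one h_mult m_comm)
  \<comment> \<open>\<open>lift\<close> is merely a section of \<open>h\<close>, not a homomorphism:
    the lifted data satisfy no relation in the universal ring, and every identity below is checked
    only after applying \<open>h\<close>.\<close>
  define lift where "lift a = (SOME z. h z = a)" for a
  have h_lift: "h (lift a) = a" if "a \<in> carrier R" for a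
    using that h_range unfolding lift_def by (metis (mono_tags) imageE someI)
  have A_carrier: "A \<subseteq> carrier R" using subringE(1)[OF A] .
  define C where "C = mat n n (\<lambda>(i, j). lift (M i j))"
  define \<beta> where "\<beta> = lift b"
  define D where "D = mat n n (\<lambda>(i, j). (if i = j then \<beta> else 0) - lift (M i j))"
  define xv where "xv = vec n (\<lambda>i. lift (x i))"
  have [simp]: "C \<in> carrier_mat n n" "D \<in> carrier_mat n n" "xv \<in> carrier_vec n"
    by (simp_all add: C_def D_def xv_def)
  have [simp]: "dim_row D = n" "dim_col D = n"
    by (simp_all add: D_def)
  have DX: "h ((D *\<^sub>v xv) $ i) = \<zero>" if "i < n" for i
  proof -
    have "(D *\<^sub>v xv) $ i = (\<Sum>j<n. ((if i = j then \<beta> else 0) - lift (M i j)) * lift (x j))"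
      using that by (simp add: D_def xv_def scalar_prod_def lessThan_atLeast0)
    also have "\<dots> = (\<Sum>j<n. (if i = j then \<beta> * lift (x i) else 0) - lift (M i j) * lift (x j))"
      by (intro sum.cong) (auto simp: algebra_simps)
    also have "\<dots> = \<beta> * lift (x i) + - (\<Sum>j<n. lift (M i j) * lift (x j))"
      using that by (simp add: sum_subtractf)
    also have "h \<dots> = b \<otimes> x i \<oplus> \<ominus> (\<Oplus>j\<in>{..<n}. h (lift (M i j) * lift (x j)))"
      using that b x by (simp add: h_add h_uminus h_mult h_sum \<beta>_def h_lift del: add_uminus_conv_diff)
    also have "(\<Oplus>j\<in>{..<n}. h (lift (M i j) * lift (x j))) = (\<Oplus>j\<in>{..<n}. M i j \<otimes> x j)"
      using that x M A_carrier by (intro finsum_cong') (auto simp: h_mult h_lift subset_iff)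
    finally show ?thesis
      using b x[OF that] by (simp add: r_neg flip: eigen[OF that])
  qed
  \<comment> \<open>The determinant trick: multiplying \<open>D x = 0\<close> by the adjugate gives
    \<open>det D * x_i = 0\<close> for all \<open>i\<close>, again after applying \<open>h\<close>.
    As some \<open>x_i\<close> is nonzero and \<open>R\<close> is a domain, \<open>h (det D)\<close>
    vanishes.\<close>
  have adj: "adj_mat D \<in> carrier_mat n n" "adj_mat D * D = det D \<cdot>\<^sub>m 1\<^sub>m n"
    using adj_mat[of D n] by auto
  have "h (det D) \<otimes> x i = \<zero>" if "i < n" for i
  proof -
    have "adj_mat D *\<^sub>v (D *\<^sub>v xv) = det D \<cdot>\<^sub>v xv"
      using adj by (simp flip: assoc_mult_mat_vec[of _ n n _ n])
        (rule eq_vecI; simp add: xv_def scalar_prod_def if_distrib if_distribR sum.delta' cong: if_cong)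
    then have "det D * lift (x i) = (adj_mat D *\<^sub>v (D *\<^sub>v xv)) $ i"
      using that by (simp add: xv_def)
    also have "\<dots> = (\<Sum>j<n. adj_mat D $$ (i, j) * (D *\<^sub>v xv) $ j)"
      using adj(1) that by (subst index_mult_mat_vec)
        (auto simp: scalar_prod_def lessThan_atLeast0 simp del: index_mult_mat_vec)
    also have "h \<dots> = (\<Oplus>j\<in>{..<n}. h (adj_mat D $$ (i, j) * (D *\<^sub>v xv) $ j))"
      by (rule h_sum) simp
    also have "\<dots> = (\<Oplus>j\<in>{..<n}. \<zero>)"
      by (intro finsum_cong') (simp_all add: h_mult DX del: index_mult_mat_vec)
    also have "\<dots> = \<zero>"
      by (simp add: finsum_zero)
    finally show ?thesis using x[OF that] by (simp add: h_mult h_lift)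
  qed
  then have "h (det D) = \<zero>"
    using nonzero x by (metis h_closed integral)
  \<comment> \<open>\<open>D\<close> is the characteristic matrix of \<open>C\<close> evaluated at
    \<beta>, and evaluation commutes with the determinant.\<close>
  moreover have "det D = poly (char_poly C) \<beta>"
    unfolding char_poly_def
    by (rule sym, rule poly_det_cong[of _ n]) (auto simp: char_poly_matrix_def D_def C_def)
  moreover have "poly (char_poly C) \<beta> = (\<Sum>i<n. poly.coeff (char_poly C) i * \<beta> ^ i) + \<beta> ^ n"
    using degree_monic_char_poly[of C n] by (simp add: poly_altdef flip: lessThan_Suc_atMost)
  ultimately have "(\<Oplus>i\<in>{..<n}. h (poly.coeff (char_poly C) i) \<otimes> b [^] i) \<oplus> b [^] n = \<zero>"
    using b by (simp add: h_add h_sum h_mult h_pow \<beta>_def h_lift)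
  then have "b [^] n = \<ominus> (\<Oplus>i\<in>{..<n}. h (poly.coeff (char_poly C) i) \<otimes> b [^] i)"
    using b by (simp add: sum_zero_eq_neg a_comm)
  also have "\<dots> = (\<ominus> \<one>) \<otimes> (\<Oplus>i\<in>{..<n}. h (poly.coeff (char_poly C) i) \<otimes> b [^] i)"
    using b by (simp add: l_minus)
  also have "\<dots> = (\<Oplus>i\<in>{..<n}. (\<ominus> \<one>) \<otimes> (h (poly.coeff (char_poly C) i) \<otimes> b [^] i))"
    using b by (intro finsum_rdistr) auto
  also have "\<dots> = (\<Oplus>i\<in>{..<n}. (\<ominus> h (poly.coeff (char_poly C) i)) \<otimes> b [^] i)"
    using b by (intro finsum_cong') (auto simp: l_minus)
  finally have "b [^] n = (\<Oplus>i\<in>{..<n}. (\<ominus> h (poly.coeff (char_poly C) i)) \<otimes> b [^] i)" .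
  moreover have "h (poly.coeff (char_poly C) i) \<in> A" for i
  proof -
    \<comment> \<open>The preimage of \<open>A\<close> under \<open>h\<close> is closed under the
      ring operations and contains the coefficients of all entries of the characteristic
      matrix.\<close>
    have "poly.coeff (det (char_poly_matrix C)) i \<in> {z. h z \<in> A}"
    proof (rule coeff_det_mem)
      show "char_poly_matrix C \<in> carrier_mat n n" by simp
      fix i j k assume ij: "i < n" "j < n"
      have "h (lift (M i j)) \<in> A"
        using M[OF ij] A_carrier by (metis h_lift subsetD)
      then have "h z \<in> A" if "z \<in> {0, 1, - lift (M i j)}" for z
        using that subringE[OF A] by (auto simp: h_zero h_one h_uminus)
      moreover have "poly.coeff (char_poly_matrix C $$ (i, j)) k \<in> {0, 1, - lift (M i j)}"
        using ij by (auto simp: char_poly_matrix_def C_def coeff_pCons split: nat.splits)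
      ultimately show "poly.coeff (char_poly_matrix C $$ (i, j)) k \<in> {z. h z \<in> A}" by blast
    qed (use subringE[OF A] in \<open>auto simp: h_zero h_one h_add h_mult h_uminus\<close>)
    then show ?thesis by (simp add: char_poly_def)
  qed
  ultimately show ?thesis
    unfolding integral_of_degree_def using subringE(5)[OF A]
    by (intro bexI[of _ "\<lambda>i. \<ominus> h (poly.coeff (char_poly C) i)"]) auto
qed

section \<open>Projective modules over local rings\<close>

definition (in ring) basis_over :: "'a set \<Rightarrow> 'a set \<Rightarrow> 'a set \<Rightarrow> bool" where
  "basis_over A M S \<longleftrightarrow>
     finite S \<and> S \<subseteq> M \<and> (\<forall>x\<in>M. \<exists>!a. a \<in> S \<rightarrow>\<^sub>E A \<and> x = (\<Oplus>s\<in>S. a s \<otimes> s))"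

text \<open>By the dual basis lemma, such coordinates amount to being finitely generated projective.
  \<open>T\<close> generates \<open>M\<close> but need not be independent. Unlike the lifting
  property, this data passes directly to localizations and to smaller generating sets.\<close>

definition (in ring) dual_basis :: "'a set \<Rightarrow> 'a set \<Rightarrow> 'a set \<Rightarrow> ('a \<Rightarrow> 'a \<Rightarrow> 'a) \<Rightarrow> bool" where
  "dual_basis A M T g \<longleftrightarrow>
     finite T \<and> T \<subseteq> M \<and>
     (\<forall>t\<in>T. g t \<in> M \<rightarrow> A \<and>
        (\<forall>x\<in>M. \<forall>y\<in>M. g t (x \<oplus> y) = g t x \<oplus> g t y) \<and>
        (\<forall>a\<in>A. \<forall>x\<in>M. g t (a \<otimes> x) = a \<otimes> g t x)) \<and>
     (\<forall>x\<in>M. x = (\<Oplus>t\<in>T. g t x \<otimes> t))"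

lemma (in ring) subalgebraD:
  assumes "subalgebra A M R"
  shows "M \<subseteq> carrier R" "\<zero> \<in> M" "\<And>x y. x \<in> M \<Longrightarrow> y \<in> M \<Longrightarrow> x \<oplus> y \<in> M"
    "\<And>a x. a \<in> A \<Longrightarrow> x \<in> M \<Longrightarrow> a \<otimes> x \<in> M"
  using subalgebra.smult_closed[OF assms] subalgebra.axioms(1)[OF assms]
  by (auto simp: subgroup_def)

lemma (in ring) finsum_subalgebra_closed:
  assumes "subalgebra A M R" "finite S" "S \<subseteq> M" "c \<in> S \<rightarrow> A"
  shows "(\<Oplus>s\<in>S. c s \<otimes> s) \<in> M"
  using assms(2-4) subalgebraD[OF assms(1)]
proof (induction S)
  case (insert s S)
  have "(\<Oplus>s\<in>insert s S. c s \<otimes> s) = c s \<otimes> s \<oplus> (\<Oplus>s\<in>S. c s \<otimes> s)"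
    using insert by (intro finsum_insert) (auto simp: Pi_iff subset_iff)
  then show ?case using insert by auto
qed simp

text \<open>Subtracting two expansions of \<open>x\<close> reduces uniqueness to relations with sum
  zero; \<open>restrict a S\<close> accounts for the extensional functions in
  \<open>basis_over\<close>.\<close>

lemma (in cring) basis_overI:
  assumes A: "subring A R" and M: "M \<subseteq> carrier R" and S: "finite S" "S \<subseteq> M"
    and span: "\<And>x. x \<in> M \<Longrightarrow> \<exists>a \<in> S \<rightarrow> A. x = (\<Oplus>s\<in>S. a s \<otimes> s)"
    and indep: "\<And>a. a \<in> S \<rightarrow> A \<Longrightarrow> (\<Oplus>s\<in>S. a s \<otimes> s) = \<zero> \<Longrightarrow> \<forall>s\<in>S. a s = \<zero>"
  shows "basis_over A M S"
  unfolding basis_over_def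
proof (intro conjI S ballI)
  note A_props = subringE[OF A]
  have S_carrier: "S \<subseteq> carrier R" using S M by blast
  fix x assume x: "x \<in> M"
  then obtain a where a: "a \<in> S \<rightarrow> A" "x = (\<Oplus>s\<in>S. a s \<otimes> s)" using span by blast
  show "\<exists>!a. a \<in> S \<rightarrow>\<^sub>E A \<and> x = (\<Oplus>s\<in>S. a s \<otimes> s)"
  proof (rule ex_ex1I)
    have "x = (\<Oplus>s\<in>S. restrict a S s \<otimes> s)"
      unfolding a(2) using a(1) S_carrier A_props(1)
      by (intro finsum_cong') (auto simp: Pi_iff subset_iff)
    then show "\<exists>a. a \<in> S \<rightarrow>\<^sub>E A \<and> x = (\<Oplus>s\<in>S. a s \<otimes> s)"
      using a(1) by (intro exI[of _ "restrict a S"]) auto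
  next
    fix a b assume a: "a \<in> S \<rightarrow>\<^sub>E A \<and> x = (\<Oplus>s\<in>S. a s \<otimes> s)"
      and b: "b \<in> S \<rightarrow>\<^sub>E A \<and> x = (\<Oplus>s\<in>S. b s \<otimes> s)"
    have ab: "a s \<in> A" "b s \<in> A" "s \<in> carrier R" "a s \<in> carrier R" "b s \<in> carrier R" if "s \<in> S" for s
      using a b that A_props(1) S_carrier by blast+
    have "(\<Oplus>s\<in>S. a s \<otimes> s) = (\<Oplus>s\<in>S. (a s \<ominus> b s) \<otimes> s \<oplus> b s \<otimes> s)"
      using ab by (intro finsum_cong') (auto simp: minus_eq l_distr l_minus a_assoc l_neg)
    then have "x = (\<Oplus>s\<in>S. (a s \<ominus> b s) \<otimes> s \<oplus> b s \<otimes> s)"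
      using a by simp
    also have "\<dots> = (\<Oplus>s\<in>S. (a s \<ominus> b s) \<otimes> s) \<oplus> x"
      using b ab by (subst finsum_addf) auto
    finally have "(\<Oplus>s\<in>S. (a s \<ominus> b s) \<otimes> s) = \<zero>"
      using x M ab by (subst (asm) add.r_cancel_one') (auto intro!: finsum_closed)
    moreover have "(\<lambda>s. a s \<ominus> b s) \<in> S \<rightarrow> A"
      using ab A_props(5,7) by (auto simp: minus_eq)
    ultimately have "a s \<ominus> b s = \<zero>" if "s \<in> S" for s
      using indep that by fast
    then have "a s = b s" if "s \<in> S" for s
      using that ab by (metis r_right_minus_eq)
    then show "a = b" using a b by (intro PiE_ext[of a S "\<lambda>_. A" b]) auto
  qed
qed

lemma (in cring) basis_over_indep:
  assumes "subring A R" "M \<subseteq> carrier R" "\<zero> \<in> M" "basis_over A M S"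
    and "a \<in> S \<rightarrow> A" "(\<Oplus>s\<in>S. a s \<otimes> s) = \<zero>" "s \<in> S"
  shows "a s = \<zero>"
proof -
  have S: "finite S" "S \<subseteq> carrier R" using assms by (auto simp: basis_over_def)
  have A: "A \<subseteq> carrier R" "\<zero> \<in> A" using subringE[OF assms(1)] by auto
  have ex1: "\<exists>!a. a \<in> S \<rightarrow>\<^sub>E A \<and> \<zero> = (\<Oplus>s\<in>S. a s \<otimes> s)"
    using assms by (auto simp: basis_over_def)
  have r1: "(\<Oplus>s\<in>S. restrict a S s \<otimes> s) = (\<Oplus>s\<in>S. a s \<otimes> s)"
    using assms(5) S A by (intro finsum_cong') (auto simp: Pi_iff subset_iff)
  have r2: "(\<Oplus>s\<in>S. restrict (\<lambda>_. \<zero>) S s \<otimes> s) = (\<Oplus>s\<in>S. \<zero>)"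
    using S A by (intro finsum_cong') auto
  have "restrict a S = restrict (\<lambda>_. \<zero>) S"
  proof (rule ex1E[OF ex1])
    fix b assume b: "\<forall>c. c \<in> S \<rightarrow>\<^sub>E A \<and> \<zero> = (\<Oplus>s\<in>S. c s \<otimes> s) \<longrightarrow> c = b"
    have "restrict a S = b" using b r1 assms(5,6) by auto
    moreover have "restrict (\<lambda>_. \<zero>) S = b" using b r2 A by (auto simp: finsum_zero)
    ultimately show ?thesis by simp
  qed
  then show ?thesis using assms(7) by (metis restrict_apply')
qed

section \<open>Local rings: Nakayama's lemma and shrinking of dual bases\<close>

locale local_subring = cring +
  fixes A \<mm> :: "'a set"
  assumes subring: "subring A R"
    and m_subset: "\<mm> \<subseteq> A"
    and m_add: "x \<in> \<mm> \<Longrightarrow> y \<in> \<mm> \<Longrightarrow> x \<oplus> y \<in> \<mm>"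
    and m_mult: "a \<in> A \<Longrightarrow> x \<in> \<mm> \<Longrightarrow> a \<otimes> x \<in> \<mm>"
    and one_notin_m: "\<one> \<notin> \<mm>"
    and unit: "a \<in> A \<Longrightarrow> a \<notin> \<mm> \<Longrightarrow> \<exists>u\<in>A. u \<otimes> a = \<one>"
begin

lemmas A_props = subringE[OF subring]

lemma A_closed: "a \<in> A \<Longrightarrow> a \<in> carrier R"
  using A_props(1) by blast

lemma m_closed_carrier: "a \<in> \<mm> \<Longrightarrow> a \<in> carrier R"
  using m_subset A_closed by blast

lemma m_uminus: "x \<in> \<mm> \<Longrightarrow> \<ominus> x \<in> \<mm>"
  using m_mult[of "\<ominus> \<one>" x] A_props(3,5) m_closed_carrier[of x] by (simp add: l_minus)

text \<open>Were \<open>\<one> \<ominus> x\<close> in \<mm>, its sum with \<open>x\<close>, which is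
  \<open>\<one>\<close>, would be there too.\<close>

lemma one_minus_unit:
  assumes "x \<in> \<mm>"
  shows "\<exists>u\<in>A. u \<otimes> (\<one> \<ominus> x) = \<one>"
proof (rule unit)
  show "\<one> \<ominus> x \<in> A" using assms m_subset A_props(3,5,7) by (auto simp: minus_eq)
  have "\<one> = (\<one> \<ominus> x) \<oplus> x"
    using m_closed_carrier[OF assms] by (simp add: minus_eq a_assoc l_neg)
  then show "\<one> \<ominus> x \<notin> \<mm>" using m_add[of "\<one> \<ominus> x" x] assms one_notin_m by auto
qed

lemma mult_minus_add_mult:
  assumes "a \<in> carrier R" "b \<in> carrier R" "e \<in> carrier R"
  shows "a \<otimes> (\<ominus> (b \<ominus> e)) \<oplus> a \<otimes> b = a \<otimes> e"
  using assms by algebra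

text \<open>Elimination instead of determinants: the equation with index \<open>r\<close> reads
  \<open>(\<one> \<ominus> N r r) \<otimes> c r = s r\<close>, and its left factor is a unit.
  Solving for \<open>c r\<close> and substituting leaves a system of the same kind with one unknown
  less. The unknowns may lie anywhere in \<open>R\<close>; only the matrix has to have its entries
  in \<mm>.\<close>

lemma nakayama:
  assumes "finite I" "\<And>i. i \<in> I \<Longrightarrow> c i \<in> carrier R"
    and "\<And>i j. i \<in> I \<Longrightarrow> j \<in> I \<Longrightarrow> N i j \<in> \<mm>"
    and "\<And>j. j \<in> I \<Longrightarrow> c j = (\<Oplus>i\<in>I. c i \<otimes> N i j)"
  shows "\<forall>i\<in>I. c i = \<zero>"
  using assms
proof (induction I arbitrary: N)
  case (insert r I)
  have c: "c r \<in> carrier R" "\<And>i. i \<in> I \<Longrightarrow> c i \<in> carrier R"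
    using insert.prems(1) by auto
  have Nm: "N i j \<in> \<mm>" if "i \<in> insert r I" "j \<in> insert r I" for i j
    using insert.prems(2) that by blast
  have N: "N i j \<in> carrier R" if "i \<in> insert r I" "j \<in> insert r I" for i j
    using Nm[OF that] m_closed_carrier by blast
  have Nrr: "N r r \<in> carrier R" using N by simp
  define s where "s j = (\<Oplus>i\<in>I. c i \<otimes> N i j)" for j
  have s: "s j \<in> carrier R" if "j \<in> insert r I" for j
    unfolding s_def using c N that by (auto intro!: finsum_closed)
  have c_eq: "c j = c r \<otimes> N r j \<oplus> s j" if "j \<in> insert r I" for j
    using insert.prems(3)[OF that] insert.hyps c N that
    unfolding s_def by (subst (asm) finsum_insert) auto
  obtain u where u: "u \<in> A" "u \<otimes> (\<one> \<ominus> N r r) = \<one>"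
    using one_minus_unit[of "N r r"] Nm by auto
  have uc: "u \<in> carrier R" using u(1) A_closed by blast
  have "(\<one> \<ominus> N r r) \<otimes> c r = s r"
  proof -
    have "(\<one> \<ominus> N r r) \<otimes> c r = c r \<ominus> c r \<otimes> N r r"
      using c Nrr by algebra
    also have "\<dots> = (c r \<otimes> N r r \<oplus> s r) \<ominus> c r \<otimes> N r r"
      using c_eq[of r] by simp
    also have "\<dots> = s r"
      using c(1) Nrr s[of r] by (simp add: minus_eq a_ac r_neg)
    finally show ?thesis .
  qed
  from this[symmetric] have "c r = u \<otimes> s r"
    using u(2) uc c(1) Nrr by (simp flip: m_assoc)
  \<comment> \<open>After substituting \<open>c r = u \<otimes> s r\<close>, the entry
    \<open>N i j\<close> is corrected by \<open>u \<otimes> N i r \<otimes> N r j\<close>, which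
    again lies in \<mm>.\<close>
  have c_eq': "c j = (\<Oplus>i\<in>I. c i \<otimes> (N i j \<oplus> u \<otimes> N i r \<otimes> N r j))" if "j \<in> insert r I" for j
  proof -
    have "c j = s j \<oplus> u \<otimes> s r \<otimes> N r j"
      using c_eq[OF that] \<open>c r = u \<otimes> s r\<close> s that uc N[of r j] by (simp add: a_comm)
    also have "u \<otimes> s r \<otimes> N r j = s r \<otimes> (u \<otimes> N r j)"
      using s[of r] uc N[of r j] that by (simp add: m_ac)
    also have "\<dots> = (\<Oplus>i\<in>I. (c i \<otimes> N i r) \<otimes> (u \<otimes> N r j))"
      unfolding s_def using insert.hyps(1) c N uc that by (intro finsum_ldistr) auto
    also have "s j \<oplus> \<dots> = (\<Oplus>i\<in>I. c i \<otimes> N i j \<oplus> (c i \<otimes> N i r) \<otimes> (u \<otimes> N r j))"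
      unfolding s_def using c N uc that by (intro finsum_addf[symmetric]) auto
    also have "\<dots> = (\<Oplus>i\<in>I. c i \<otimes> (N i j \<oplus> u \<otimes> N i r \<otimes> N r j))"
      using c N uc that by (intro finsum_cong') (auto simp: r_distr m_ac)
    finally show ?thesis .
  qed
  have "\<forall>i\<in>I. c i = \<zero>"
  proof (rule insert.IH[where N = "\<lambda>i j. N i j \<oplus> u \<otimes> N i r \<otimes> N r j"])
    fix i j assume "i \<in> I" "j \<in> I"
    then show "N i j \<oplus> u \<otimes> N i r \<otimes> N r j \<in> \<mm>"
      using Nm m_subset A_props(6)[OF u(1)] by (intro m_add m_mult) (auto simp: subset_iff)
  qed (use c c_eq' in auto)
  moreover have "c r = \<zero>"
  proof -
    have "c r = (\<Oplus>i\<in>I. \<zero>)"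
      unfolding c_eq'[OF insertI1] using calculation N uc by (intro finsum_cong') auto
    then show ?thesis by (simp add: finsum_zero)
  qed
  ultimately show ?case by blast
qed blast

text \<open>If \<open>g s t\<close> is not congruent to \<open>\<delta>\<^sub>s\<^sub>t\<close> modulo \<open>\<mm>\<close>, then the relation
  \<open>\<Sum>\<^sub>j (g j t - \<delta>\<^sub>j\<^sub>t) j = 0\<close> expresses \<open>s\<close> by the other generators.\<close>

lemma dual_basis_reduce:
  assumes M: "subalgebra A M R" and g: "dual_basis A M T g"
    and st: "s \<in> T" "t \<in> T" and e: "g s t \<ominus> (if s = t then \<one> else \<zero>) \<notin> \<mm>"
  shows "\<exists>g'. dual_basis A M (T - {s}) g'"
proof -
  have T: "finite T" "T \<subseteq> M" and gA: "\<And>j x. j \<in> T \<Longrightarrow> x \<in> M \<Longrightarrow> g j x \<in> A"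
    and g_add: "\<And>j x y. j \<in> T \<Longrightarrow> x \<in> M \<Longrightarrow> y \<in> M \<Longrightarrow> g j (x \<oplus> y) = g j x \<oplus> g j y"
    and g_mult: "\<And>j a x. j \<in> T \<Longrightarrow> a \<in> A \<Longrightarrow> x \<in> M \<Longrightarrow> g j (a \<otimes> x) = a \<otimes> g j x"
    and g_eq: "\<And>x. x \<in> M \<Longrightarrow> (\<Oplus>j\<in>T. g j x \<otimes> j) = x"
    using g unfolding dual_basis_def by (auto simp: Pi_iff)
  have Mc: "x \<in> carrier R" if "x \<in> M" for x using subalgebraD(1)[OF M] that by blast
  have Tc: "j \<in> carrier R" if "j \<in> T" for j using T(2) Mc that by blast
  have gc: "g j x \<in> carrier R" if "j \<in> T" "x \<in> M" for j x using gA[OF that] A_closed by blast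
  have tM: "t \<in> M" "s \<in> M" using st T by auto
  \<comment> \<open>The coefficients of the expansion of \<open>t\<close> by the functionals minus
    those of the trivial expansion of \<open>t\<close> by itself.\<close>
  define n where "n j = g j t \<ominus> (if j = t then \<one> else \<zero>)" for j
  have nA: "n j \<in> A" if "j \<in> T" for j
    using gA[OF that tM(1)] A_props(2,3,5,7) by (auto simp: n_def minus_eq)
  have nc: "n j \<in> carrier R" if "j \<in> T" for j using nA[OF that] A_closed by blast
  have n_sum: "(\<Oplus>j\<in>T. n j \<otimes> j) = \<zero>"
  proof -
    have "t = (\<Oplus>j\<in>T. n j \<otimes> j \<oplus> (if t = j then j else \<zero>))"
    proof -
      have "(\<Oplus>j\<in>T. n j \<otimes> j \<oplus> (if t = j then j else \<zero>)) = (\<Oplus>j\<in>T. g j t \<otimes> j)"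
        using Tc gc[OF _ tM(1)]
        by (intro finsum_cong') (auto simp: n_def minus_eq l_distr l_minus a_assoc l_neg)
      then show ?thesis using g_eq[OF tM(1)] by simp
    qed
    also have "\<dots> = (\<Oplus>j\<in>T. n j \<otimes> j) \<oplus> (\<Oplus>j\<in>T. if t = j then j else \<zero>)"
      using Tc nc by (intro finsum_addf) auto
    also have "(\<Oplus>j\<in>T. if t = j then j else \<zero>) = t"
      using Tc st T by (intro finsum_singleton) auto
    finally show ?thesis
      using Tc nc st by (subst (asm) add.r_cancel_one') (auto intro!: finsum_closed)
  qed
  \<comment> \<open>\<open>n s\<close> is the entry outside \<mm>, hence a unit of \<open>A\<close>,
    so the relation can be solved for \<open>s\<close>.\<close>
  obtain u where u: "u \<in> A" "u \<otimes> n s = \<one>"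
    using unit[OF nA[OF st(1)]] e by (auto simp: n_def)
  have uc: "u \<in> carrier R" using u(1) A_closed by blast
  define T' where "T' = T - {s}"
  have T': "finite T'" "T = insert s T'" "s \<notin> T'" using T st by (auto simp: T'_def)
  have s_eq: "s = (\<Oplus>j\<in>T'. (\<ominus> (u \<otimes> n j)) \<otimes> j)"
  proof -
    have "n s \<otimes> s \<oplus> (\<Oplus>j\<in>T'. n j \<otimes> j) = \<zero>"
      using n_sum Tc nc T' unfolding T'(2) by (subst (asm) finsum_insert) auto
    then have ns: "n s \<otimes> s = \<ominus> (\<Oplus>j\<in>T'. n j \<otimes> j)"
      using Tc nc T' by (intro sum_zero_eq_neg) (auto intro!: finsum_closed)
    have "s = u \<otimes> (n s \<otimes> s)"
      using u uc nc Tc st by (simp flip: m_assoc)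
    also have "\<dots> = (\<ominus> u) \<otimes> (\<Oplus>j\<in>T'. n j \<otimes> j)"
      unfolding ns using uc Tc nc T' by (subst r_minus) (auto simp: l_minus intro!: finsum_closed)
    also have "\<dots> = (\<Oplus>j\<in>T'. (\<ominus> u) \<otimes> (n j \<otimes> j))"
      using uc Tc nc T' by (intro finsum_rdistr) auto
    also have "\<dots> = (\<Oplus>j\<in>T'. (\<ominus> (u \<otimes> n j)) \<otimes> j)"
      using uc Tc nc T' by (intro finsum_cong') (auto simp: l_minus m_assoc)
    finally show ?thesis .
  qed
  define d where "d j = \<ominus> (u \<otimes> n j)" for j
  have dA: "d j \<in> A" if "j \<in> T'" for j
    using nA u(1) A_props(5,6) that T' by (auto simp: d_def)
  have dc: "d j \<in> carrier R" if "j \<in> T'" for j using dA[OF that] A_closed by blast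
  \<comment> \<open>Replacing \<open>s\<close> by its expression in the other generators adds
    \<open>g s x \<otimes> d j\<close> to the coordinate of \<open>x\<close> at
    \<open>j\<close>.\<close>
  have "dual_basis A M T' (\<lambda>j x. g j x \<oplus> g s x \<otimes> d j)"
    unfolding dual_basis_def
  proof (intro conjI ballI)
    show "finite T'" "T' \<subseteq> M" using T T' by auto
    fix j assume j: "j \<in> T'"
    then have jT: "j \<in> T" using T' by simp
    show "(\<lambda>x. g j x \<oplus> g s x \<otimes> d j) \<in> M \<rightarrow> A"
      using gA jT st dA[OF j] A_props(6,7) by auto
    show "g j (x \<oplus> y) \<oplus> g s (x \<oplus> y) \<otimes> d j
      = g j x \<oplus> g s x \<otimes> d j \<oplus> (g j y \<oplus> g s y \<otimes> d j)" if "x \<in> M" "y \<in> M" for x y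
      using that jT st dc[OF j] gc
      by (simp add: g_add l_distr a_ac)
    show "g j (a \<otimes> x) \<oplus> g s (a \<otimes> x) \<otimes> d j = a \<otimes> (g j x \<oplus> g s x \<otimes> d j)"
      if "a \<in> A" "x \<in> M" for a x
      using that jT st dc[OF j] gc A_closed[OF that(1)]
      by (simp add: g_mult r_distr m_assoc)
  next
    fix x assume x: "x \<in> M"
    have "x = g s x \<otimes> s \<oplus> (\<Oplus>j\<in>T'. g j x \<otimes> j)"
      using g_eq[OF x] gc[OF _ x] Tc T' unfolding T'(2) by (subst (asm) finsum_insert) auto
    also have "g s x \<otimes> s = g s x \<otimes> (\<Oplus>j\<in>T'. d j \<otimes> j)"
      using s_eq by (simp add: d_def)
    also have "\<dots> = (\<Oplus>j\<in>T'. g s x \<otimes> (d j \<otimes> j))"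
      using gc[OF _ x] dc Tc T' by (intro finsum_rdistr) auto
    also have "\<dots> \<oplus> (\<Oplus>j\<in>T'. g j x \<otimes> j) = (\<Oplus>j\<in>T'. g s x \<otimes> (d j \<otimes> j) \<oplus> g j x \<otimes> j)"
      using gc[OF _ x] dc Tc T' by (intro finsum_addf[symmetric]) auto
    also have "\<dots> = (\<Oplus>j\<in>T'. (g j x \<oplus> g s x \<otimes> d j) \<otimes> j)"
      using gc[OF _ x] dc Tc T' by (intro finsum_cong') (auto simp: l_distr m_assoc a_comm)
    finally show "x = (\<Oplus>j\<in>T'. (g j x \<oplus> g s x \<otimes> d j) \<otimes> j)" .
  qed
  then show ?thesis unfolding T'_def by blast
qed

text \<open>Generators are discarded until the matrix of all \<open>g s t\<close> is the identity
  modulo \<mm>. Then \<open>T\<close> is independent: the functionals \<open>g j\<close>, applied to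
  a relation among the generators, produce a linear system for its coefficients, and Nakayama's
  lemma makes these vanish. So Nakayama is applied to the coefficients, not to the
  generators.\<close>

lemma dual_basis_imp_basis:
  assumes M: "subalgebra A M R" and "dual_basis A M T g"
  shows "\<exists>S. basis_over A M S"
  using assms(2)
proof (induction "card T" arbitrary: T g rule: less_induct)
  case less
  show ?case
  proof (cases "\<exists>s\<in>T. \<exists>t\<in>T. g s t \<ominus> (if s = t then \<one> else \<zero>) \<notin> \<mm>")
    case True
    then obtain s g' where s: "s \<in> T" "dual_basis A M (T - {s}) g'"
      using dual_basis_reduce[OF M less.prems] by blast
    have "finite T" using less.prems by (simp add: dual_basis_def)
    then show ?thesis by (intro less.hyps[OF _ s(2)] card_Diff1_less s(1))
  next
    case False
    have T: "finite T" "T \<subseteq> M" and gA: "\<And>j x. j \<in> T \<Longrightarrow> x \<in> M \<Longrightarrow> g j x \<in> A"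
      and g_add: "\<And>j x y. j \<in> T \<Longrightarrow> x \<in> M \<Longrightarrow> y \<in> M \<Longrightarrow> g j (x \<oplus> y) = g j x \<oplus> g j y"
      and g_mult: "\<And>j a x. j \<in> T \<Longrightarrow> a \<in> A \<Longrightarrow> x \<in> M \<Longrightarrow> g j (a \<otimes> x) = a \<otimes> g j x"
      and g_eq: "\<And>x. x \<in> M \<Longrightarrow> (\<Oplus>j\<in>T. g j x \<otimes> j) = x"
      using less.prems unfolding dual_basis_def by (auto simp: Pi_iff)
    have Mc: "x \<in> carrier R" if "x \<in> M" for x using subalgebraD(1)[OF M] that by blast
    have gc: "g j x \<in> carrier R" if "j \<in> T" "x \<in> M" for j x using gA[OF that] A_closed by blast
    have "basis_over A M T"
    proof (rule basis_overI[OF subring subalgebraD(1)[OF M] T])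
      show "\<exists>a\<in>T \<rightarrow> A. x = (\<Oplus>s\<in>T. a s \<otimes> s)" if "x \<in> M" for x
        using gA g_eq that by (intro bexI[of _ "\<lambda>t. g t x"]) auto
    next
      fix c assume c: "c \<in> T \<rightarrow> A" and c0: "(\<Oplus>s\<in>T. c s \<otimes> s) = \<zero>"
      have cc: "c t \<in> carrier R" if "t \<in> T" for t using c that A_closed by blast
      have g_sum: "g j (\<Oplus>t\<in>T'. c t \<otimes> t) = (\<Oplus>t\<in>T'. c t \<otimes> g j t)" if "T' \<subseteq> T" "j \<in> T" for T' j
      proof -
        have "finite T'" using that T finite_subset by blast
        then show ?thesis using that(1)
        proof (induction T')
          case empty
          have "g j \<zero> \<oplus> g j \<zero> = g j \<zero>"
            using g_add[OF that(2), of \<zero> \<zero>] subalgebraD(2)[OF M] by simp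
          then show ?case
            using gc[OF that(2) subalgebraD(2)[OF M]] by (metis add.r_cancel_one' finsum_empty)
        next
          case (insert t T')
          have tT: "t \<in> T" "T' \<subseteq> T" "t \<in> M" "T' \<subseteq> M" using insert.prems T by auto
          have "(\<Oplus>t\<in>T'. c t \<otimes> t) \<in> M"
            using finsum_subalgebra_closed[OF M insert.hyps(1) tT(4)] c tT by blast
          moreover have "c t \<otimes> t \<in> M" using subalgebraD(4)[OF M] c tT by blast
          moreover have "(\<Oplus>t\<in>insert t T'. c t \<otimes> t) = c t \<otimes> t \<oplus> (\<Oplus>t\<in>T'. c t \<otimes> t)"
            using insert.hyps cc Mc tT by (intro finsum_insert) (auto simp: subset_iff)
          moreover have "(\<Oplus>t\<in>insert t T'. c t \<otimes> g j t) = c t \<otimes> g j t \<oplus> (\<Oplus>t\<in>T'. c t \<otimes> g j t)"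
            using insert.hyps cc gc tT that(2) by (intro finsum_insert) (auto simp: subset_iff)
          moreover have "c t \<in> A" using c tT by blast
          ultimately show ?case
            using insert.IH tT g_add g_mult that(2) by auto
        qed
      qed
      show "\<forall>s\<in>T. c s = \<zero>"
      proof -
        \<comment> \<open>The identity matrix minus the matrix of the functionals. Applying
          \<open>g j\<close> to the relation turns it into the fixed-point equation
          \<open>c = c N\<close>.\<close>
        define N where "N t j = \<ominus> (g j t \<ominus> (if j = t then \<one> else \<zero>))" for t j
        have N: "N t j \<in> \<mm>" if "t \<in> T" "j \<in> T" for t j
          unfolding N_def using False that m_uminus by blast
        have "c j = (\<Oplus>t\<in>T. c t \<otimes> N t j)" if j: "j \<in> T" for j
        proof -
        have gjt: "g j t \<in> carrier R" if "t \<in> T" for t using gc j that T by blast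
        \<comment> \<open>The instance of \<open>g_sum\<close> for the empty set says that
          \<open>g j \<zero> = \<zero>\<close>.\<close>
        have z: "(\<Oplus>t\<in>T. c t \<otimes> g j t) = \<zero>"
          using g_sum[of T j] g_sum[of "{}" j] j c0 by simp
        have "c j = (\<Oplus>t\<in>T. if j = t then c t else \<zero>)"
          using j T cc by (intro finsum_singleton[symmetric]) auto
        also have "\<dots> = (\<Oplus>t\<in>T. c t \<otimes> (\<ominus> (g j t \<ominus> (if j = t then \<one> else \<zero>))) \<oplus> c t \<otimes> g j t)"
          using cc gjt by (intro finsum_cong') (auto simp: mult_minus_add_mult)
        also have "\<dots> = (\<Oplus>t\<in>T. c t \<otimes> (\<ominus> (g j t \<ominus> (if j = t then \<one> else \<zero>)))) \<oplus> (\<Oplus>t\<in>T. c t \<otimes> g j t)"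
          using cc gjt by (intro finsum_addf) auto
        finally have "c j = (\<Oplus>t\<in>T. c t \<otimes> (\<ominus> (g j t \<ominus> (if j = t then \<one> else \<zero>)))) \<oplus> \<zero>"
          unfolding z .
        moreover have "(\<Oplus>t\<in>T. c t \<otimes> (\<ominus> (g j t \<ominus> (if j = t then \<one> else \<zero>)))) \<in> carrier R"
          using cc gjt by (intro finsum_closed) auto
        ultimately show "c j = (\<Oplus>t\<in>T. c t \<otimes> N t j)"
          by (simp add: N_def)
        qed
        with N cc show ?thesis by (intro nakayama[OF T(1), of c N])
      qed
    qed
    then show ?thesis by (intro exI[of _ T])
  qed
qed

end

section \<open>Bases and integral elements\<close>

lemma (in ring) basis_over_span:
  assumes "basis_over A M S" "x \<in> M"
  obtains a where "a \<in> S \<rightarrow> A" "x = (\<Oplus>s\<in>S. a s \<otimes> s)"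
proof -
  have "\<exists>!a. a \<in> S \<rightarrow>\<^sub>E A \<and> x = (\<Oplus>s\<in>S. a s \<otimes> s)"
    using assms by (auto simp: basis_over_def)
  then obtain a where "a \<in> S \<rightarrow>\<^sub>E A \<and> x = (\<Oplus>s\<in>S. a s \<otimes> s)" by (rule ex1E)
  then show thesis by (intro that[of a]) (auto simp: PiE_def)
qed

text \<open>The basis elements themselves form the eigenvector: expanding each
  \<open>b \<otimes> s\<close> in the basis gives a matrix over \<open>A\<close> that acts on the
  vector of all \<open>s\<close> as multiplication by \<open>b\<close>.\<close>

lemma (in domain) integral_of_degree_if_basis_over:
  assumes A: "subring A R" and M: "subalgebra A M R" and S: "basis_over A M S"
    and b: "b \<in> carrier R" "\<And>x. x \<in> M \<Longrightarrow> b \<otimes> x \<in> M" and nz: "x \<in> M" "x \<noteq> \<zero>"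
  shows "integral_of_degree A (card S) b"
proof -
  have S_fin: "finite S" "S \<subseteq> M" using S by (auto simp: basis_over_def)
  have Mc: "M \<subseteq> carrier R" using subalgebraD(1)[OF M] .
  have span: "\<exists>a. a \<in> S \<rightarrow> A \<and> y = (\<Oplus>s\<in>S. a s \<otimes> s)" if "y \<in> M" for y
    using basis_over_span[OF S that] by metis
  have "\<exists>a. a \<in> S \<rightarrow> A \<and> b \<otimes> s = (\<Oplus>t\<in>S. a t \<otimes> t)" if "s \<in> S" for s
    using span b(2) S_fin that by blast
  then obtain m where m: "\<And>s. s \<in> S \<Longrightarrow> m s \<in> S \<rightarrow> A"
    "\<And>s. s \<in> S \<Longrightarrow> b \<otimes> s = (\<Oplus>t\<in>S. m s t \<otimes> t)"
    by metis
  obtain e where e: "bij_betw e {..<card S} S"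
    using ex_bij_betw_nat_finite[OF S_fin(1)] by (auto simp: lessThan_atLeast0)
  have eS: "e i \<in> S" if "i < card S" for i
    using e that by (auto simp: bij_betw_def)
  show ?thesis
  proof (rule integral_of_degree_if_eigenvalue[OF A, where M = "\<lambda>i j. m (e i) (e j)" and x = e])
    show "m (e i) (e j) \<in> A" if "i < card S" "j < card S" for i j
      using m(1) eS that by blast
    show "e i \<in> carrier R" if "i < card S" for i
      using eS[OF that] S_fin Mc by blast
    \<comment> \<open>If all basis elements were zero, so would be everything they span, in contrast
      to \<open>x\<close>.\<close>
    show "\<exists>i<card S. e i \<noteq> \<zero>"
    proof (rule ccontr)
      assume "\<not> (\<exists>i<card S. e i \<noteq> \<zero>)"
      then have S0: "s = \<zero>" if "s \<in> S" for s
        using e that by (auto simp: bij_betw_def)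
      obtain a where a: "a \<in> S \<rightarrow> A" "x = (\<Oplus>s\<in>S. a s \<otimes> s)" using span nz(1) by blast
      have "a s \<otimes> s = \<zero>" if "s \<in> S" for s
      proof -
        have "a s \<in> carrier R" using a(1) subringE(1)[OF A] that by blast
        then show ?thesis using S0[OF that] r_null[of "a s"] by simp
      qed
      then have "x = (\<Oplus>s\<in>S. \<zero>)"
        unfolding a(2) by (intro finsum_cong') auto
      then show False using nz(2) by (simp add: finsum_zero)
    qed
    fix i assume i: "i < card S"
    have mi: "m (e i) s \<in> carrier R" if "s \<in> S" for s
      using m(1)[OF eS[OF i]] that subringE(1)[OF A] by blast
    have "b \<otimes> e i = (\<Oplus>t\<in>e ` {..<card S}. m (e i) t \<otimes> t)"
      using m(2)[OF eS[OF i]] e by (simp add: bij_betw_def)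
    also have "\<dots> = (\<Oplus>j\<in>{..<card S}. m (e i) (e j) \<otimes> e j)"
      using e mi S_fin Mc by (intro finsum_reindex) (auto simp: bij_betw_def)
    finally show "b \<otimes> e i = (\<Oplus>j\<in>{..<card S}. m (e i) (e j) \<otimes> e j)" .
  qed (rule b(1))
qed

text \<open>Linear independence and dimension are formulated with lists of coefficients, bases here
  with functions on a set; distinctness of the list makes the two interchangeable.\<close>

lemma (in ring) combine_map_eq_finsum:
  assumes "distinct Us" "set Us \<subseteq> carrier R" "k \<in> set Us \<rightarrow> carrier R"
  shows "combine (map k Us) Us = (\<Oplus>u\<in>set Us. k u \<otimes> u)"
  using assms
proof (induction Us)
  case (Cons u Us)
  have "(\<Oplus>u\<in>insert u (set Us). k u \<otimes> u) = k u \<otimes> u \<oplus> (\<Oplus>u\<in>set Us. k u \<otimes> u)"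
    using Cons.prems by (intro finsum_insert) (auto simp: subset_iff)
  then show ?case using Cons by auto
qed simp

lemma ex_map_eq_if_distinct:
  assumes "distinct xs" "length xs = length ys"
  shows "\<exists>f. ys = map f xs"
  using assms(2,1)
proof (induction xs ys rule: list_induct2)
  case (Cons x xs y ys)
  then obtain f where "ys = map f xs" by auto
  with Cons.prems have "y # ys = map (f(x := y)) (x # xs)" by auto
  then show ?case by (rule exI[of _ "f(x := y)"])
qed simp

text \<open>The product of the individual denominators works. \<open>Q\<close> is kept general
  because the denominators are nonzero elements in the comparison with \<open>K\<close>, and a given
  multiplicative set in clearing a local integral equation.\<close>

lemma (in cring) common_denominator:
  assumes A: "subring A R" and K: "K \<subseteq> carrier R"
    and Q: "Q \<subseteq> A" "\<one> \<in> Q" "\<And>s t. s \<in> Q \<Longrightarrow> t \<in> Q \<Longrightarrow> s \<otimes> t \<in> Q"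
    and denom: "\<And>k. k \<in> K \<Longrightarrow> \<exists>s\<in>Q. s \<otimes> k \<in> A"
    and S: "finite S" "k \<in> S \<rightarrow> K"
  shows "\<exists>d\<in>Q. \<forall>s\<in>S. d \<otimes> k s \<in> A"
  using S
proof (induction S)
  case empty
  then show ?case using Q(2) by auto
next
  case (insert s S)
  note A_props = subringE[OF A]
  obtain d where d: "d \<in> Q" "\<forall>s\<in>S. d \<otimes> k s \<in> A" using insert by auto
  obtain e where e: "e \<in> Q" "e \<otimes> k s \<in> A" using denom[of "k s"] insert.prems by auto
  have de: "d \<in> A" "e \<in> A" using d(1) e(1) Q(1) by auto
  have c: "d \<in> carrier R" "e \<in> carrier R" "k s \<in> carrier R" using de A_props(1) insert.prems K by auto
  have "(d \<otimes> e) \<otimes> k t \<in> A" if "t \<in> insert s S" for t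
  proof (cases "t = s")
    case True
    then show ?thesis using A_props(6)[of d "e \<otimes> k s"] de e(2) c by (simp add: m_assoc)
  next
    case False
    then have "k t \<in> carrier R" "d \<otimes> k t \<in> A" using that d(2) insert.prems K by auto
    then show ?thesis using A_props(6)[of e "d \<otimes> k t"] de c by (simp add: m_ac)
  qed
  then show ?case using Q(3) d(1) e(1) by blast
qed

text \<open>Extension of scalars to \<open>K\<close> preserves bases: a common denominator turns a
  relation over \<open>K\<close> into one over \<open>A\<close>, and every element of
  \<open>L\<close> has a nonzero multiple in \<open>M\<close>, whose expansion can be divided by the
  factor. It serves for \<open>A_p\<close> and \<open>B_p\<close>.\<close>

lemma (in field) dimension_if_basis_over:
  assumes K: "subfield K R" and L: "subalgebra K L R"
    and A: "subring A R" "A \<subseteq> K" and M: "subalgebra A M R" "M \<subseteq> L"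
    and denom_K: "\<And>k. k \<in> K \<Longrightarrow> \<exists>s \<in> A - {\<zero>}. s \<otimes> k \<in> A"
    and denom_L: "\<And>x. x \<in> L \<Longrightarrow> \<exists>s \<in> A - {\<zero>}. s \<otimes> x \<in> M"
    and S: "basis_over A M S"
  shows "dimension (card S) K L"
proof -
  have S_fin: "finite S" "S \<subseteq> M" using S by (auto simp: basis_over_def)
  obtain Us where Us: "set Us = S" "distinct Us" using finite_distinct_list[OF S_fin(1)] by blast
  have Mc: "M \<subseteq> carrier R" using subalgebraD(1)[OF M(1)] .
  have Sc: "S \<subseteq> carrier R" using S_fin Mc by blast
  have Kc: "K \<subseteq> carrier R" using subfieldE(3)[OF K] .
  have zeroM: "\<zero> \<in> M" using subalgebraD(2)[OF M(1)] .
  have "independent K Us"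
  proof (rule ccontr)
    assume "dependent K Us"
    then obtain Ks where Ks: "length Ks = length Us" "combine Ks Us = \<zero>" "set Ks \<subseteq> K" "set Ks \<noteq> {\<zero>}"
      using dependent_imp_non_trivial_combine[OF K, of Us] Us(1) Sc by metis
    obtain k where k: "Ks = map k Us" using ex_map_eq_if_distinct[OF Us(2), of Ks] Ks(1) by auto
    have kK: "k \<in> S \<rightarrow> K" using Ks(3) k Us(1) by auto
    have kc: "k s \<in> carrier R" if "s \<in> S" for s using kK Kc that by blast
    have nz: "s \<otimes> t \<in> A - {\<zero>}" if "s \<in> A - {\<zero>}" "t \<in> A - {\<zero>}" for s t
      using that subringE(1,6)[OF A(1)] integral[of s t] by auto
    have "\<one> \<in> A - {\<zero>}" using subringE(3)[OF A(1)] by simp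
    then obtain d where d: "d \<in> A - {\<zero>}" "\<forall>s\<in>S. d \<otimes> k s \<in> A"
      using common_denominator[OF A(1) Kc _ _ nz denom_K S_fin(1) kK] by blast
    have dc: "d \<in> carrier R" using d(1) subringE(1)[OF A(1)] by auto
    have "(\<Oplus>s\<in>S. (d \<otimes> k s) \<otimes> s) = (\<Oplus>s\<in>S. d \<otimes> (k s \<otimes> s))"
      using dc kc Sc by (intro finsum_cong') (auto simp: m_assoc subset_iff)
    also have "\<dots> = d \<otimes> (\<Oplus>s\<in>S. k s \<otimes> s)"
      using dc kc Sc S_fin by (intro finsum_rdistr[symmetric]) (auto simp: subset_iff)
    also have "(\<Oplus>s\<in>S. k s \<otimes> s) = \<zero>"
      using combine_map_eq_finsum[OF Us(2), of k] Us(1) Sc kc Ks(2) k by auto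
    finally have "(\<Oplus>s\<in>S. (d \<otimes> k s) \<otimes> s) = \<zero>" using dc by simp
    then have "d \<otimes> k s = \<zero>" if "s \<in> S" for s
      using basis_over_indep[OF A(1) Mc zeroM S, of "\<lambda>s. d \<otimes> k s" s] d(2) that by auto
    then have "k s = \<zero>" if "s \<in> S" for s
      using that kc[OF that] dc d(1) integral[of d "k s"] by auto
    then have "set Ks \<subseteq> {\<zero>}" using k Us(1) by auto
    \<comment> \<open>The condition \<open>set Ks \<noteq> {\<zero>}\<close> also holds for the
      empty list, which has to be excluded separately.\<close>
    moreover have "Ks \<noteq> []" using Ks(1) \<open>dependent K Us\<close> by auto
    ultimately show False using Ks(4) by (cases Ks) auto
  qed
  moreover have "Span K Us = L"
  proof
    show "Span K Us \<subseteq> L"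
      using subalgebra_Span_incl[OF K L] Us(1) S_fin(2) M(2) by blast
    show "L \<subseteq> Span K Us"
    proof
      fix x assume x: "x \<in> L"
      obtain d where d: "d \<in> A - {\<zero>}" "d \<otimes> x \<in> M" using denom_L[OF x] by blast
      then obtain a where a: "a \<in> S \<rightarrow> A" "d \<otimes> x = (\<Oplus>s\<in>S. a s \<otimes> s)"
        using basis_over_span[OF S] by metis
      have "a \<in> set Us \<rightarrow> carrier R" using a(1) Us(1) subringE(1)[OF A(1)] by blast
      then have "combine (map a Us) Us = d \<otimes> x"
        using combine_map_eq_finsum[OF Us(2), of a] a(2) Us(1) Sc by simp
      moreover have "set (map a Us) \<subseteq> K" using a(1) A(2) Us(1) by auto
      ultimately have "d \<otimes> x \<in> Span K Us"
        using Span_eq_combine_set[OF K, of Us] Us(1) Sc by (metis (mono_tags, lifting) mem_Collect_eq)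
      then show "x \<in> Span K Us"
        using Span_m_inv_simprule[OF K, of Us d x] d(1) A(2) Us(1) Sc x subalgebraD(1)[OF L] by blast
    qed
  qed
  ultimately show ?thesis
    using dimensionI[OF K, of Us L] distinct_card[OF Us(2)] Us(1) by simp
qed

section \<open>Monic polynomials and integral equations\<close>

lemma (in ring) eval_rev_map_upt:
  assumes "c \<in> {..<n} \<rightarrow> carrier R" "b \<in> carrier R"
  shows "eval (rev (map c [0..<n])) b = (\<Oplus>i\<in>{..<n}. c i \<otimes> b [^] i)"
  using assms
proof (induction n)
  case (Suc n)
  have "(\<Oplus>i\<in>insert n {..<n}. c i \<otimes> b [^] i) = c n \<otimes> b [^] n \<oplus> (\<Oplus>i\<in>{..<n}. c i \<otimes> b [^] i)"
    using Suc.prems by (intro finsum_insert) (auto simp: Pi_iff)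
  moreover have "{..<Suc n} = insert n {..<n}" by auto
  moreover have "eval (rev (map c [0..<n])) b = (\<Oplus>i\<in>{..<n}. c i \<otimes> b [^] i)"
    using Suc by (auto simp: Pi_iff less_SucI)
  ultimately show ?case by simp
qed simp

text \<open>Polynomials are coefficient lists with the leading coefficient first, so the monic ones
  of degree \<open>n\<close> are \<open>\<one>\<close> followed by \<open>n\<close> coefficients in
  descending order. Moving these to the other side of the equation reverses and negates
  them.\<close>

lemma (in domain) ex_monic_root_iff_integral_of_degree:
  assumes A: "subring A R" and b: "b \<in> carrier R" and n: "n \<ge> 1"
  shows "(\<exists>p \<in> carrier (univ_poly R A). hd p = \<one> \<and> length p - 1 = n \<and> eval p b = \<zero>)
    \<longleftrightarrow> integral_of_degree A n b"
proof -
  note A_props = subringE[OF A]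
  have ev: "eval (\<one> # rev (map c [0..<n])) b = b [^] n \<oplus> (\<Oplus>i\<in>{..<n}. c i \<otimes> b [^] i)"
    if "c \<in> {..<n} \<rightarrow> A" for c
    using eval_rev_map_upt[of c n b] that A_props(1) b by (simp add: Pi_iff subset_iff)
  have neg: "\<ominus> (\<Oplus>i\<in>{..<n}. c i \<otimes> b [^] i) = (\<Oplus>i\<in>{..<n}. (\<ominus> c i) \<otimes> b [^] i)"
    if "c \<in> {..<n} \<rightarrow> A" for c
  proof -
    have c: "c i \<in> carrier R" if "i < n" for i using that \<open>c \<in> _\<close> A_props(1) by auto
    then have s: "(\<Oplus>i\<in>{..<n}. c i \<otimes> b [^] i) \<in> carrier R" using b by (auto intro!: finsum_closed)
    have "(\<Oplus>i\<in>{..<n}. (\<ominus> c i) \<otimes> b [^] i) = (\<Oplus>i\<in>{..<n}. (\<ominus> \<one>) \<otimes> (c i \<otimes> b [^] i))"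
      using c b by (intro finsum_cong') (auto simp: l_minus)
    also have "\<dots> = (\<ominus> \<one>) \<otimes> (\<Oplus>i\<in>{..<n}. c i \<otimes> b [^] i)"
      using c b by (intro finsum_rdistr[symmetric]) auto
    finally show ?thesis using s by (simp add: l_minus)
  qed
  show ?thesis
  proof
    assume "\<exists>p \<in> carrier (univ_poly R A). hd p = \<one> \<and> length p - 1 = n \<and> eval p b = \<zero>"
    then obtain p where p: "polynomial\<^bsub>R\<^esub> A p" "hd p = \<one>" "length p - 1 = n" "eval p b = \<zero>"
      by (auto simp: univ_poly_def)
    \<comment> \<open>The empty list has \<open>length p - 1 = 0\<close>, so
      \<open>n \<ge> 1\<close> excludes it.\<close>
    then obtain q where q: "p = \<one> # q" "length q = n" "set q \<subseteq> A"
      using n by (cases p) (auto simp: polynomial_def)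
    define c where "c i = rev q ! i" for i
    have "rev q = map c [0..<n]"
      using q(2) by (intro nth_equalityI) (auto simp: c_def)
    then have qc: "q = rev (map c [0..<n])" by (metis rev_rev_ident)
    have c: "c \<in> {..<n} \<rightarrow> A"
      using q(2,3) by (auto simp: c_def rev_nth)
    have cc: "c i \<in> carrier R" if "i < n" for i using c A_props(1) that by auto
    have "b [^] n \<oplus> (\<Oplus>i\<in>{..<n}. c i \<otimes> b [^] i) = \<zero>"
      using ev[OF c] p(4) q(1) qc by simp
    then have "b [^] n = \<ominus> (\<Oplus>i\<in>{..<n}. c i \<otimes> b [^] i)"
      using b cc by (intro sum_zero_eq_neg) (auto intro!: finsum_closed)
    then show "integral_of_degree A n b"
      unfolding neg[OF c] integral_of_degree_def using c A_props(5)
      by (intro bexI[of _ "\<lambda>i. \<ominus> c i"]) auto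
  next
    assume "integral_of_degree A n b"
    then obtain c where c: "c \<in> {..<n} \<rightarrow> A" "b [^] n = (\<Oplus>i\<in>{..<n}. c i \<otimes> b [^] i)"
      by (auto simp: integral_of_degree_def)
    have c': "(\<lambda>i. \<ominus> c i) \<in> {..<n} \<rightarrow> A" using c(1) A_props(5) by auto
    define p where "p = \<one> # rev (map (\<lambda>i. \<ominus> c i) [0..<n])"
    have "eval p b = b [^] n \<oplus> \<ominus> (b [^] n)"
      unfolding p_def ev[OF c'] neg[OF c(1), symmetric] c(2)[symmetric] ..
    then have "eval p b = \<zero>" using b by (simp add: r_neg)
    moreover have "p \<in> carrier (univ_poly R A)"
      using c' A_props(3) one_not_zero by (auto simp: p_def univ_poly_def polynomial_def)
    ultimately show "\<exists>p \<in> carrier (univ_poly R A). hd p = \<one> \<and> length p - 1 = n \<and> eval p b = \<zero>"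
      by (intro bexI[of _ p]) (auto simp: p_def)
  qed
qed

lemma (in domain) integral_degree_elem_eq:
  assumes "subring A R" "b \<in> carrier R"
  shows "integral_degree_elem R A b = Inf {enat n | n. n \<ge> 1 \<and> integral_of_degree A n b}"
  unfolding integral_degree_elem_def
  using ex_monic_root_iff_integral_of_degree[OF assms] by (metis (no_types, lifting))

section \<open>Modules of fractions\<close>

text \<open>The localization of \<open>M\<close> at \<open>P\<close>, realised inside the field. For
  a prime \<open>p\<close>, taking \<open>A\<close> or \<open>p\<close> for \<open>M\<close> and
  \<open>A - p\<close> for \<open>P\<close> gives the local ring and its maximal ideal.\<close>

definition (in ring) fractions :: "'a set \<Rightarrow> 'a set \<Rightarrow> 'a set" where
  "fractions M P = {x \<otimes> inv s | x s. x \<in> M \<and> s \<in> P}"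

locale denominators = field +
  fixes A P :: "'a set"
  assumes subring: "subring A R"
    and P_subset: "P \<subseteq> A"
    and P_one: "\<one> \<in> P"
    and P_mult: "s \<in> P \<Longrightarrow> t \<in> P \<Longrightarrow> s \<otimes> t \<in> P"
    and P_nonzero: "\<zero> \<notin> P"
begin

lemmas A_props = subringE[OF subring]

lemma P_closed: "s \<in> P \<Longrightarrow> s \<in> carrier R" "s \<in> P \<Longrightarrow> s \<in> A"
  using P_subset A_props(1) by auto

lemma P_inv:
  assumes "s \<in> P"
  shows "inv s \<in> carrier R" "s \<otimes> inv s = \<one>" "inv s \<otimes> s = \<one>"
proof -
  have "s \<in> Units R" using assms P_closed P_nonzero by (auto simp: field_Units)
  then show "inv s \<in> carrier R" "s \<otimes> inv s = \<one>" "inv s \<otimes> s = \<one>" by simp_all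
qed

lemma P_cancel:
  assumes "s \<in> P" "x \<in> carrier R" "y \<in> carrier R" "s \<otimes> x = s \<otimes> y"
  shows "x = y"
  using assms P_closed P_nonzero m_lcancel[of s x y] by auto

text \<open>The working form of membership: clearing a denominator replaces computing with
  inverses.\<close>

lemma fractions_iff:
  assumes "M \<subseteq> carrier R"
  shows "x \<in> fractions M P \<longleftrightarrow> x \<in> carrier R \<and> (\<exists>s\<in>P. s \<otimes> x \<in> M)"
proof
  assume "x \<in> fractions M P"
  then obtain y s where ys: "x = y \<otimes> inv s" "y \<in> M" "s \<in> P" by (auto simp: fractions_def)
  have c: "y \<in> carrier R" using ys assms by auto
  have "s \<otimes> x = y"
    using ys(1) c P_inv[OF ys(3)] P_closed(1)[OF ys(3)] by (simp add: m_lcomm[of s y])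
  then show "x \<in> carrier R \<and> (\<exists>s\<in>P. s \<otimes> x \<in> M)"
    using ys c P_inv[OF ys(3)] by (intro conjI bexI[of _ s]) auto
next
  assume "x \<in> carrier R \<and> (\<exists>s\<in>P. s \<otimes> x \<in> M)"
  then obtain s where s: "x \<in> carrier R" "s \<in> P" "s \<otimes> x \<in> M" by auto
  have "x = (s \<otimes> x) \<otimes> inv s"
    using s P_inv[OF s(2)] P_closed(1)[OF s(2)]
    by (simp add: m_assoc m_lcomm[of s x "inv s"])
  then show "x \<in> fractions M P" using s unfolding fractions_def by blast
qed

lemma fractionsI:
  assumes "M \<subseteq> carrier R" "x \<in> carrier R" "s \<in> P" "s \<otimes> x \<in> M"
  shows "x \<in> fractions M P"
  using assms by (auto simp: fractions_iff)

lemma subset_fractions: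
  assumes "M \<subseteq> carrier R"
  shows "M \<subseteq> fractions M P"
  using assms P_one by (auto intro!: fractionsI[of _ _ \<one>] simp: subset_iff)

lemma fractions_mult_mem:
  assumes M: "subalgebra A M R" and x: "x \<in> fractions A P" and y: "y \<in> fractions M P"
  shows "x \<otimes> y \<in> fractions M P"
proof -
  have Mc: "M \<subseteq> carrier R" using subalgebraD(1)[OF M] .
  obtain s where s: "x \<in> carrier R" "s \<in> P" "s \<otimes> x \<in> A" using x A_props(1) by (auto simp: fractions_iff)
  obtain t where t: "y \<in> carrier R" "t \<in> P" "t \<otimes> y \<in> M" using y Mc by (auto simp: fractions_iff)
  have "(s \<otimes> t) \<otimes> (x \<otimes> y) = (s \<otimes> x) \<otimes> (t \<otimes> y)"
    using s t P_closed by (simp add: m_ac)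
  then have "(s \<otimes> t) \<otimes> (x \<otimes> y) \<in> M" using subalgebraD(4)[OF M s(3) t(3)] by simp
  then show ?thesis using s t P_mult Mc by (auto simp: fractions_iff)
qed

lemma fractions_add_mem:
  assumes M: "subalgebra A M R" and x: "x \<in> fractions M P" and y: "y \<in> fractions M P"
  shows "x \<oplus> y \<in> fractions M P"
proof -
  have Mc: "M \<subseteq> carrier R" using subalgebraD(1)[OF M] .
  obtain s where s: "x \<in> carrier R" "s \<in> P" "s \<otimes> x \<in> M" using x Mc by (auto simp: fractions_iff)
  obtain t where t: "y \<in> carrier R" "t \<in> P" "t \<otimes> y \<in> M" using y Mc by (auto simp: fractions_iff)
  have "(s \<otimes> t) \<otimes> (x \<oplus> y) = t \<otimes> (s \<otimes> x) \<oplus> s \<otimes> (t \<otimes> y)"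
    using s t P_closed by (simp add: r_distr m_ac)
  then have "(s \<otimes> t) \<otimes> (x \<oplus> y) \<in> M"
    using subalgebraD(3,4)[OF M] s t P_closed(2) by simp
  then show ?thesis using s t P_mult Mc by (auto simp: fractions_iff)
qed

text \<open>Viewing \<open>A\<close> as a module over itself lets the ring structure of
  \<open>fractions A P\<close> be read off from the statements about modules.\<close>

lemma subalgebra_A: "subalgebra A A R"
  using subring A_props by (intro subalgebra.intro subalgebra_axioms.intro) (auto simp: subring_def)

lemma subring_fractions: "subring (fractions A P) R"
proof (rule subringI)
  show "fractions A P \<subseteq> carrier R" using A_props(1) by (auto simp: fractions_iff)
  show "\<one> \<in> fractions A P" using subset_fractions[OF A_props(1)] A_props(3) by blast
  have m1: "\<ominus> \<one> \<in> fractions A P" using subset_fractions[OF A_props(1)] A_props(3,5) by blast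
  show "x \<otimes> y \<in> fractions A P" if "x \<in> fractions A P" "y \<in> fractions A P" for x y
    using fractions_mult_mem[OF subalgebra_A that] .
  show "x \<oplus> y \<in> fractions A P" if "x \<in> fractions A P" "y \<in> fractions A P" for x y
    using fractions_add_mem[OF subalgebra_A that] .
  show "\<ominus> x \<in> fractions A P" if "x \<in> fractions A P" for x
    using fractions_mult_mem[OF subalgebra_A m1 that] that A_props(1) by (simp add: fractions_iff l_minus)
qed

lemma subalgebra_fractions:
  assumes M: "subalgebra A M R"
  shows "subalgebra (fractions A P) (fractions M P) R"
proof (intro subalgebra.intro subalgebra_axioms.intro)
  have Mc: "M \<subseteq> carrier R" using subalgebraD(1)[OF M] .
  have m1: "\<ominus> \<one> \<in> fractions A P" using subset_fractions[OF A_props(1)] A_props(3,5) by blast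
  show "subgroup (fractions M P) (add_monoid R)"
  proof (rule add.subgroupI)
    show "fractions M P \<subseteq> carrier R" using Mc by (auto simp: fractions_iff)
    show "fractions M P \<noteq> {}" using subset_fractions[OF Mc] subalgebraD(2)[OF M] by blast
    show "\<ominus> x \<in> fractions M P" if "x \<in> fractions M P" for x
      using fractions_mult_mem[OF M m1 that] that Mc by (simp add: fractions_iff l_minus)
  qed (use fractions_add_mem[OF M] in auto)
qed (use fractions_mult_mem[OF M] in auto)

text \<open>A functional extends by \<open>g' (x) = g (s x) / s\<close>, where \<open>s\<close> is a
  denominator of \<open>x\<close>, and the generators remain the same. A fixed choice of
  denominators makes this a function; that any other denominator gives the same value is the fact
  \<open>key\<close>, from which linearity follows by cancelling.\<close>

lemma dual_basis_fractions:
  assumes M: "subalgebra A M R" and g: "dual_basis A M T g"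
  shows "\<exists>g'. dual_basis (fractions A P) (fractions M P) T g'"
proof -
  have T: "finite T" "T \<subseteq> M" and gA: "\<And>j x. j \<in> T \<Longrightarrow> x \<in> M \<Longrightarrow> g j x \<in> A"
    and g_add: "\<And>j x y. j \<in> T \<Longrightarrow> x \<in> M \<Longrightarrow> y \<in> M \<Longrightarrow> g j (x \<oplus> y) = g j x \<oplus> g j y"
    and g_mult: "\<And>j a x. j \<in> T \<Longrightarrow> a \<in> A \<Longrightarrow> x \<in> M \<Longrightarrow> g j (a \<otimes> x) = a \<otimes> g j x"
    and g_eq: "\<And>x. x \<in> M \<Longrightarrow> (\<Oplus>j\<in>T. g j x \<otimes> j) = x"
    using g unfolding dual_basis_def by (auto simp: Pi_iff)
  have Mc: "M \<subseteq> carrier R" using subalgebraD(1)[OF M] .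
  have Mm: "a \<otimes> x \<in> M" if "a \<in> A" "x \<in> M" for a x using subalgebraD(4)[OF M that] .
  have gc: "g j x \<in> carrier R" if "j \<in> T" "x \<in> M" for j x using gA[OF that] A_props(1) by blast
  define d where "d x = (SOME s. s \<in> P \<and> s \<otimes> x \<in> M)" for x
  have d: "d x \<in> P" "d x \<otimes> x \<in> M" if "x \<in> fractions M P" for x
  proof -
    have "\<exists>s. s \<in> P \<and> s \<otimes> x \<in> M" using that Mc by (auto simp: fractions_iff)
    then have "d x \<in> P \<and> d x \<otimes> x \<in> M" unfolding d_def by (rule someI_ex)
    then show "d x \<in> P" "d x \<otimes> x \<in> M" by auto
  qed
  have frc: "x \<in> carrier R" if "x \<in> fractions M P" for x using that Mc by (simp add: fractions_iff)
  define g' where "g' j x = inv (d x) \<otimes> g j (d x \<otimes> x)" for j x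
  have g'c: "g' j x \<in> carrier R" if "j \<in> T" "x \<in> fractions M P" for j x
    unfolding g'_def using P_inv(1) d[OF that(2)] gc[OF that(1)] by simp
  \<comment> \<open>Independence of the chosen denominator: both sides agree after multiplication by
    \<open>d x\<close>, since \<open>g j\<close> is linear and the factors \<open>s\<close> and
    \<open>d x\<close> may be exchanged.\<close>
  have key: "s \<otimes> g' j x = g j (s \<otimes> x)"
    if "j \<in> T" "x \<in> fractions M P" "s \<in> P" "s \<otimes> x \<in> M" for s j x
  proof (rule P_cancel[OF d(1)[OF that(2)]])
    note dx = d[OF that(2)]
    show "s \<otimes> g' j x \<in> carrier R" using g'c that P_closed by auto
    show "g j (s \<otimes> x) \<in> carrier R" using gc that by auto
    have "d x \<otimes> (s \<otimes> g' j x) = s \<otimes> ((d x \<otimes> inv (d x)) \<otimes> g j (d x \<otimes> x))"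
      unfolding g'_def using P_closed dx that P_inv[OF dx(1)] gc[OF that(1) dx(2)]
      by (simp add: m_lcomm flip: m_assoc)
    also have "\<dots> = s \<otimes> g j (d x \<otimes> x)"
      using P_inv[OF dx(1)] gc[OF that(1) dx(2)] by simp
    also have "\<dots> = g j (s \<otimes> (d x \<otimes> x))" using g_mult that dx P_closed by simp
    also have "s \<otimes> (d x \<otimes> x) = d x \<otimes> (s \<otimes> x)"
      using P_closed that dx frc by (simp add: m_lcomm)
    also have "g j \<dots> = d x \<otimes> g j (s \<otimes> x)" using g_mult that dx P_closed by simp
    finally show "d x \<otimes> (s \<otimes> g' j x) = d x \<otimes> g j (s \<otimes> x)" .
  qed
  have "dual_basis (fractions A P) (fractions M P) T g'"
    unfolding dual_basis_def
  proof (intro conjI ballI)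
    show "finite T" "T \<subseteq> fractions M P" using T subset_fractions[OF Mc] by auto
    fix j assume j: "j \<in> T"
    show "g' j \<in> fractions M P \<rightarrow> fractions A P"
    proof
      fix x assume x: "x \<in> fractions M P"
      then show "g' j x \<in> fractions A P"
        using key[OF j x d[OF x]] gA[OF j d(2)[OF x]] g'c[OF j x] d(1)[OF x] A_props(1)
        by (intro fractionsI[of A _ "d x"]) auto
    qed
    show "g' j (x \<oplus> y) = g' j x \<oplus> g' j y" if x: "x \<in> fractions M P" and y: "y \<in> fractions M P" for x y
    proof -
      \<comment> \<open>A common denominator of both summands, so that \<open>key\<close> applies to
        \<open>x\<close>, to \<open>y\<close> and to their sum.\<close>
      define s where "s = d x \<otimes> d y"
      have xy: "x \<oplus> y \<in> fractions M P" using fractions_add_mem[OF M x y] .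
      have s: "s \<in> P" using d(1) x y P_mult by (simp add: s_def)
      have "s \<otimes> x = d y \<otimes> (d x \<otimes> x)" "s \<otimes> y = d x \<otimes> (d y \<otimes> y)"
        using d(1)[OF x] d(1)[OF y] P_closed(1) frc x y by (simp_all add: s_def m_ac)
      then have sx: "s \<otimes> x \<in> M" and sy: "s \<otimes> y \<in> M"
        using Mm d[OF x] d[OF y] P_closed(2) by simp_all
      have sxy: "s \<otimes> (x \<oplus> y) = s \<otimes> x \<oplus> s \<otimes> y" using s P_closed frc x y by (simp add: r_distr)
      have "s \<otimes> g' j (x \<oplus> y) = g j (s \<otimes> (x \<oplus> y))"
        using key[OF j xy s] sxy subalgebraD(3)[OF M sx sy] by simp
      also have "\<dots> = g j (s \<otimes> x) \<oplus> g j (s \<otimes> y)" using g_add[OF j sx sy] sxy by simp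
      also have "\<dots> = s \<otimes> g' j x \<oplus> s \<otimes> g' j y" using key[OF j x s sx] key[OF j y s sy] by simp
      also have "\<dots> = s \<otimes> (g' j x \<oplus> g' j y)" using s P_closed g'c[OF j] x y by (simp add: r_distr)
      finally show ?thesis using P_cancel[OF s] g'c[OF j] x y xy by simp
    qed
    show "g' j (a \<otimes> x) = a \<otimes> g' j x" if a: "a \<in> fractions A P" and x: "x \<in> fractions M P" for a x
    proof -
      obtain r where r: "a \<in> carrier R" "r \<in> P" "r \<otimes> a \<in> A" using a A_props(1) by (auto simp: fractions_iff)
      define s where "s = r \<otimes> d x"
      have ax: "a \<otimes> x \<in> fractions M P" using fractions_mult_mem[OF M a x] .
      have s: "s \<in> P" using d(1) x P_mult r by (simp add: s_def)
      have e: "s \<otimes> (a \<otimes> x) = (r \<otimes> a) \<otimes> (d x \<otimes> x)"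
        using d(1)[OF x] P_closed(1) frc x r by (simp add: s_def m_ac)
      have "s \<otimes> g' j (a \<otimes> x) = g j (s \<otimes> (a \<otimes> x))"
        using key[OF j ax s] e Mm r(3) d(2)[OF x] by simp
      also have "\<dots> = (r \<otimes> a) \<otimes> g j (d x \<otimes> x)" using e g_mult[OF j r(3) d(2)[OF x]] by simp
      also have "\<dots> = (r \<otimes> a) \<otimes> (d x \<otimes> g' j x)" using key[OF j x d[OF x]] by simp
      also have "\<dots> = s \<otimes> (a \<otimes> g' j x)"
        using d(1)[OF x] P_closed(1) g'c[OF j x] r by (simp add: s_def m_ac)
      finally show ?thesis using P_cancel[OF s] g'c[OF j] x ax r(1) by simp
    qed
  next
    fix x assume x: "x \<in> fractions M P"
    note dx = d[OF x]
    have Tc: "j \<in> carrier R" if "j \<in> T" for j using that T Mc by blast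
    have fc: "(\<Oplus>j\<in>T. g' j x \<otimes> j) \<in> carrier R" using g'c x Tc by (auto intro!: finsum_closed)
    have "d x \<otimes> x = (\<Oplus>j\<in>T. g j (d x \<otimes> x) \<otimes> j)" using g_eq[OF dx(2)] by simp
    also have "\<dots> = (\<Oplus>j\<in>T. d x \<otimes> (g' j x \<otimes> j))"
      using key[OF _ x dx] g'c[OF _ x] P_closed(1)[OF dx(1)] Tc
      by (intro finsum_cong') (auto simp flip: m_assoc)
    also have "\<dots> = d x \<otimes> (\<Oplus>j\<in>T. g' j x \<otimes> j)"
      using g'c[OF _ x] P_closed(1)[OF dx(1)] Tc T by (intro finsum_rdistr[symmetric]) auto
    finally show "x = (\<Oplus>j\<in>T. g' j x \<otimes> j)"
      using P_cancel[OF dx(1) frc[OF x] fc] by simp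
  qed
  then show ?thesis by (rule exI[of _ g'])
qed

end

section \<open>From the lifting property to a dual basis\<close>

definition free_module :: "('r, 'c) ring_scheme \<Rightarrow> nat \<Rightarrow> ('r, nat \<Rightarrow> 'r) module" where
  "free_module R m =
     \<lparr>carrier = {..<m} \<rightarrow>\<^sub>E carrier R, monoid.mult = undefined, monoid.one = undefined,
      ring.zero = (\<lambda>i\<in>{..<m}. \<zero>\<^bsub>R\<^esub>), ring.add = (\<lambda>u v. \<lambda>i\<in>{..<m}. u i \<oplus>\<^bsub>R\<^esub> v i),
      module.smult = (\<lambda>a v. \<lambda>i\<in>{..<m}. a \<otimes>\<^bsub>R\<^esub> v i)\<rparr>"

text \<open>The elements of the free module have the type at which the lifting property is stated.
  They are extensional functions, so that equality of vectors is equality of coordinates.\<close>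

lemma (in cring) module_free_module: "module R (free_module R m)"
proof (rule moduleI)
  show "cring R" by (rule is_cring)
  show "abelian_group (free_module R m)"
  proof (rule abelian_groupI)
    fix v assume v: "v \<in> carrier (free_module R m)"
    show "\<exists>w\<in>carrier (free_module R m). w \<oplus>\<^bsub>free_module R m\<^esub> v = \<zero>\<^bsub>free_module R m\<^esub>"
      using v by (intro bexI[of _ "\<lambda>i\<in>{..<m}. \<ominus> v i"])
        (auto simp: free_module_def l_neg PiE_iff intro!: restrict_ext)
  qed (auto simp: free_module_def PiE_iff a_assoc extensional_def fun_eq_iff intro: a_comm)
qed (auto simp: free_module_def PiE_iff extensional_def fun_eq_iff l_distr r_distr m_assoc)

text \<open>The two sums refer to records with different carriers; as the addition is the same, they
  agree by induction.\<close>

lemma (in ring) finsum_mult_module: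
  assumes "abelian_group (mult_module R M)" "M \<subseteq> carrier R" "finite S" "f \<in> S \<rightarrow> M"
  shows "finsum (mult_module R M) f S = finsum R f S"
proof -
  interpret M: abelian_group "mult_module R M" by fact
  show ?thesis using assms(3,4)
  proof (induction S)
    case empty
    show ?case using M.finsum_empty[of f] by (simp add: mult_module_def)
  next
    case (insert s S)
    have "f \<in> S \<rightarrow> carrier R" "f s \<in> carrier R" using insert.prems assms(2) by auto
    moreover have "f \<in> S \<rightarrow> carrier (mult_module R M)" "f s \<in> carrier (mult_module R M)"
      using insert.prems by (auto simp: mult_module_def)
    ultimately show ?case
      using insert by (simp add: M.finsum_insert) (simp add: mult_module_def)
  qed
qed

text \<open>A finite generating set gives a surjection from a free module onto \<open>M\<close>.
  Projectivity splits it, and the coordinates of the splitting are the functionals dual to the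
  generators.\<close>

lemma (in cring) dual_basis_if_projective:
  assumes A: "subring A R" and M: "subalgebra A M R"
    and fg: "finitely_generated_module (R\<lparr>carrier := A\<rparr>) (mult_module R M)"
    and proj: "projective_module (R\<lparr>carrier := A\<rparr>) (mult_module R M)"
  shows "\<exists>T g. dual_basis A M T g"
proof -
  note A_props = subringE[OF A]
  have Mc: "M \<subseteq> carrier R" using subalgebraD(1)[OF M] .
  have mod: "module (R\<lparr>carrier := A\<rparr>) (mult_module R M)"
    using fg by (simp add: finitely_generated_module_def)
  have ab: "abelian_group (mult_module R M)" using mod by (simp add: module_def)
  interpret RA: cring "R\<lparr>carrier := A\<rparr>" using mod by (simp add: module_def)
  obtain S where S: "finite S" "S \<subseteq> M"
    and span0: "\<And>x. x \<in> M \<Longrightarrow> \<exists>a \<in> S \<rightarrow> A. x = (\<Oplus>\<^bsub>mult_module R M\<^esub>s\<in>S. a s \<otimes> s)"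
    using fg by (auto simp: finitely_generated_module_def mult_module_def)
  have span: "\<exists>a \<in> S \<rightarrow> A. x = (\<Oplus>s\<in>S. a s \<otimes> s)" if x: "x \<in> M" for x
  proof -
    obtain a where a: "a \<in> S \<rightarrow> A" "x = (\<Oplus>\<^bsub>mult_module R M\<^esub>s\<in>S. a s \<otimes> s)" using span0[OF x] by blast
    have "(\<lambda>s. a s \<otimes> s) \<in> S \<rightarrow> M" using a(1) S subalgebraD(4)[OF M] by blast
    then show ?thesis using a finsum_mult_module[OF ab Mc S(1)] by (intro bexI[of _ a]) auto
  qed
  have Sc: "s \<in> carrier R" if "s \<in> S" for s using that S Mc by blast
  define m where "m = card S"
  obtain e where e: "bij_betw e {..<m} S"
    using ex_bij_betw_nat_finite[OF S(1)] by (auto simp: lessThan_atLeast0 m_def)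
  have eS: "e i \<in> S" if "i < m" for i using e that by (auto simp: bij_betw_def)
  have ec: "e i \<in> carrier R" if "i < m" for i using eS[OF that] Sc by blast
  let ?P = "free_module (R\<lparr>carrier := A\<rparr>) m"
  define p where "p v = (\<Oplus>i\<in>{..<m}. v i \<otimes> e i)" for v
  have reindex: "(\<Oplus>s\<in>S. a s \<otimes> s) = (\<Oplus>i\<in>{..<m}. a (e i) \<otimes> e i)" if "a \<in> S \<rightarrow> A" for a
  proof -
    have "(\<Oplus>s\<in>e ` {..<m}. a s \<otimes> s) = (\<Oplus>i\<in>{..<m}. a (e i) \<otimes> e i)"
      using e that Sc A_props(1) by (intro finsum_reindex) (auto simp: bij_betw_def Pi_iff subset_iff)
    then show ?thesis using e by (simp add: bij_betw_def)
  qed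
  have P_carrier: "carrier ?P = {..<m} \<rightarrow>\<^sub>E A" by (simp add: free_module_def)
  have Pc: "v i \<in> carrier R" if "v \<in> {..<m} \<rightarrow>\<^sub>E A" "i < m" for v i
    using that A_props(1) by auto
  have p_range: "p v \<in> M" if v: "v \<in> {..<m} \<rightarrow>\<^sub>E A" for v
  proof -
    define a where "a s = v (inv_into {..<m} e s)" for s
    have ae: "a (e i) = v i" if "i < m" for i
      using e that by (simp add: a_def bij_betw_def)
    have "a s \<in> A" if "s \<in> S" for s
    proof -
      have "s \<in> e ` {..<m}" using e that by (simp add: bij_betw_def)
      then obtain i where "i < m" "s = e i" by auto
      then show ?thesis using ae v by auto
    qed
    then have aA: "a \<in> S \<rightarrow> A" by simp
    have "p v = (\<Oplus>i\<in>{..<m}. a (e i) \<otimes> e i)"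
      unfolding p_def using ae ec Pc[OF v] by (intro finsum_cong') auto
    then have "p v = (\<Oplus>s\<in>S. a s \<otimes> s)" using reindex[OF aA] by simp
    then show ?thesis using finsum_subalgebra_closed[OF M S aA] by simp
  qed
  have p_hom: "p \<in> linear_maps (R\<lparr>carrier := A\<rparr>) ?P (mult_module R M)"
  proof -
    have "p (u \<oplus>\<^bsub>?P\<^esub> v) = p u \<oplus> p v" if "u \<in> {..<m} \<rightarrow>\<^sub>E A" "v \<in> {..<m} \<rightarrow>\<^sub>E A" for u v
    proof -
      have "p (u \<oplus>\<^bsub>?P\<^esub> v) = (\<Oplus>i\<in>{..<m}. u i \<otimes> e i \<oplus> v i \<otimes> e i)"
        unfolding p_def using ec Pc that
        by (intro finsum_cong') (auto simp: free_module_def l_distr)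
      also have "\<dots> = p u \<oplus> p v"
        unfolding p_def using ec Pc that by (intro finsum_addf) auto
      finally show ?thesis .
    qed
    moreover have "p (a \<odot>\<^bsub>?P\<^esub> v) = a \<otimes> p v" if "a \<in> A" "v \<in> {..<m} \<rightarrow>\<^sub>E A" for a v
    proof -
      have ac: "a \<in> carrier R" using that A_props(1) by blast
      have "p (a \<odot>\<^bsub>?P\<^esub> v) = (\<Oplus>i\<in>{..<m}. a \<otimes> (v i \<otimes> e i))"
        unfolding p_def using ec Pc that ac
        by (intro finsum_cong') (auto simp: free_module_def m_assoc)
      also have "\<dots> = a \<otimes> p v"
        unfolding p_def using ec Pc that ac by (intro finsum_rdistr[symmetric]) auto
      finally show ?thesis .
    qed
    ultimately show ?thesis
      using p_range by (auto simp: linear_maps_def P_carrier mult_module_def)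
  qed
  have p_surj: "p ` carrier ?P = carrier (mult_module R M)"
  proof -
    have "x \<in> p ` ({..<m} \<rightarrow>\<^sub>E A)" if x: "x \<in> M" for x
    proof -
      obtain a where a: "a \<in> S \<rightarrow> A" "x = (\<Oplus>s\<in>S. a s \<otimes> s)" using span[OF x] by blast
      have v: "(\<lambda>i\<in>{..<m}. a (e i)) \<in> {..<m} \<rightarrow>\<^sub>E A" using a(1) eS by auto
      have "p (\<lambda>i\<in>{..<m}. a (e i)) = (\<Oplus>i\<in>{..<m}. a (e i) \<otimes> e i)"
        unfolding p_def using ec Pc[OF v] by (intro finsum_cong') auto
      then show ?thesis using a reindex[OF a(1)] v by (intro image_eqI[OF _ v]) simp
    qed
    then show ?thesis using p_range by (auto simp: P_carrier mult_module_def)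
  qed
  \<comment> \<open>The map to be lifted is the identity; its lift \<open>h\<close> is a linear
    section of \<open>p\<close>.\<close>
  have id_hom: "(\<lambda>x. x) \<in> linear_maps (R\<lparr>carrier := A\<rparr>) (mult_module R M) (mult_module R M)"
    by (auto simp: linear_maps_def)
  obtain h where h: "h \<in> linear_maps (R\<lparr>carrier := A\<rparr>) (mult_module R M) ?P"
    "\<And>x. x \<in> M \<Longrightarrow> p (h x) = x"
    using proj[unfolded projective_module_def, THEN conjunct2, rule_format,
      OF RA.module_free_module[of m] mod p_hom id_hom p_surj]
    by (auto simp: mult_module_def)
  have hA: "h x \<in> {..<m} \<rightarrow>\<^sub>E A" if "x \<in> M" for x
    using h(1) that by (auto simp: linear_maps_def P_carrier mult_module_def)
  have h_add: "h (x \<oplus> y) = h x \<oplus>\<^bsub>?P\<^esub> h y" if "x \<in> M" "y \<in> M" for x y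
    using h(1) that by (auto simp: linear_maps_def mult_module_def)
  have h_mult: "h (a \<otimes> x) = a \<odot>\<^bsub>?P\<^esub> h x" if "a \<in> A" "x \<in> M" for a x
    using h(1) that by (auto simp: linear_maps_def mult_module_def)
  \<comment> \<open>The free module is indexed by numbers, the dual basis by generators; the inverse
    of the enumeration \<open>e\<close> translates.\<close>
  define g where "g s x = h x (inv_into {..<m} e s)" for s x
  have idx: "inv_into {..<m} e s < m" if "s \<in> S" for s
    using e that by (metis bij_betw_def inv_into_into lessThan_iff)
  have "dual_basis A M S g"
    unfolding dual_basis_def
  proof (intro conjI ballI S)
    fix s assume s: "s \<in> S"
    show "g s \<in> M \<rightarrow> A" using hA idx[OF s] by (auto simp: g_def PiE_iff)
    show "g s (x \<oplus> y) = g s x \<oplus> g s y" if "x \<in> M" "y \<in> M" for x y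
      using idx[OF s] h_add[OF that] by (simp add: g_def free_module_def)
    show "g s (a \<otimes> x) = a \<otimes> g s x" if "a \<in> A" "x \<in> M" for a x
      using idx[OF s] h_mult[OF that] by (simp add: g_def free_module_def)
  next
    fix x assume x: "x \<in> M"
    have gA: "(\<lambda>s. g s x) \<in> S \<rightarrow> A" using hA[OF x] idx by (auto simp: g_def PiE_iff)
    have "x = p (h x)" using h(2)[OF x] by simp
    also have "\<dots> = (\<Oplus>i\<in>{..<m}. g (e i) x \<otimes> e i)"
      unfolding p_def using e ec Pc[OF hA[OF x]]
      by (intro finsum_cong') (auto simp: g_def bij_betw_def)
    also have "\<dots> = (\<Oplus>s\<in>S. g s x \<otimes> s)" using reindex[OF gA] by simp
    finally show "x = (\<Oplus>s\<in>S. g s x \<otimes> s)" .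
  qed
  then show ?thesis by (intro exI)
qed

section \<open>Free modules and semilinear isomorphisms\<close>

text \<open>Unique existence is split into spanning and independence, both for arbitrary coefficient
  functions. This removes the extensional functions, which would be a burden in transporting a basis
  along an isomorphism.\<close>

lemma (in module) free_of_rank_iff:
  "free_of_rank R M n \<longleftrightarrow>
     (\<exists>S. finite S \<and> card S = n \<and> S \<subseteq> carrier M \<and>
        (\<forall>x \<in> carrier M. \<exists>a \<in> S \<rightarrow> carrier R. x = (\<Oplus>\<^bsub>M\<^esub>s\<in>S. a s \<odot>\<^bsub>M\<^esub> s)) \<and>
        (\<forall>a \<in> S \<rightarrow> carrier R. \<forall>b \<in> S \<rightarrow> carrier R.
           (\<Oplus>\<^bsub>M\<^esub>s\<in>S. a s \<odot>\<^bsub>M\<^esub> s) = (\<Oplus>\<^bsub>M\<^esub>s\<in>S. b s \<odot>\<^bsub>M\<^esub> s) \<longrightarrow> (\<forall>s\<in>S. a s = b s)))"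
proof -
  have restrict_sum: "(\<Oplus>\<^bsub>M\<^esub>s\<in>S. restrict a S s \<odot>\<^bsub>M\<^esub> s) = (\<Oplus>\<^bsub>M\<^esub>s\<in>S. a s \<odot>\<^bsub>M\<^esub> s)"
    if "S \<subseteq> carrier M" "a \<in> S \<rightarrow> carrier R" for S a
    using that by (intro M.finsum_cong') (auto simp: Pi_iff subset_iff)
  have "(\<forall>x \<in> carrier M. \<exists>!a. a \<in> S \<rightarrow>\<^sub>E carrier R \<and> x = (\<Oplus>\<^bsub>M\<^esub>s\<in>S. a s \<odot>\<^bsub>M\<^esub> s)) \<longleftrightarrow>
      (\<forall>x \<in> carrier M. \<exists>a \<in> S \<rightarrow> carrier R. x = (\<Oplus>\<^bsub>M\<^esub>s\<in>S. a s \<odot>\<^bsub>M\<^esub> s)) \<and>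
      (\<forall>a \<in> S \<rightarrow> carrier R. \<forall>b \<in> S \<rightarrow> carrier R.
         (\<Oplus>\<^bsub>M\<^esub>s\<in>S. a s \<odot>\<^bsub>M\<^esub> s) = (\<Oplus>\<^bsub>M\<^esub>s\<in>S. b s \<odot>\<^bsub>M\<^esub> s) \<longrightarrow> (\<forall>s\<in>S. a s = b s))"
    (is "?L \<longleftrightarrow> ?span \<and> ?unique") if S: "S \<subseteq> carrier M" for S
  proof (intro iffI conjI ballI impI)
    fix x assume L: ?L and x: "x \<in> carrier M"
    obtain a where "a \<in> S \<rightarrow>\<^sub>E carrier R \<and> x = (\<Oplus>\<^bsub>M\<^esub>s\<in>S. a s \<odot>\<^bsub>M\<^esub> s)"
      using bspec[OF L x] by (rule ex1E)
    then show "\<exists>a \<in> S \<rightarrow> carrier R. x = (\<Oplus>\<^bsub>M\<^esub>s\<in>S. a s \<odot>\<^bsub>M\<^esub> s)"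
      by (intro bexI[of _ a]) (auto simp: PiE_def)
  next
    fix a b s
    assume L: ?L and a: "a \<in> S \<rightarrow> carrier R" and b: "b \<in> S \<rightarrow> carrier R" and s: "s \<in> S"
      and eq: "(\<Oplus>\<^bsub>M\<^esub>s\<in>S. a s \<odot>\<^bsub>M\<^esub> s) = (\<Oplus>\<^bsub>M\<^esub>s\<in>S. b s \<odot>\<^bsub>M\<^esub> s)"
    have "(\<Oplus>\<^bsub>M\<^esub>s\<in>S. a s \<odot>\<^bsub>M\<^esub> s) \<in> carrier M"
      using a S by (intro M.finsum_closed) auto
    from bspec[OF L this] have "restrict a S = restrict b S"
    proof (rule ex1E)
      fix c
      assume c: "\<forall>d. d \<in> S \<rightarrow>\<^sub>E carrier R \<and> (\<Oplus>\<^bsub>M\<^esub>s\<in>S. a s \<odot>\<^bsub>M\<^esub> s) = (\<Oplus>\<^bsub>M\<^esub>s\<in>S. d s \<odot>\<^bsub>M\<^esub> s) \<longrightarrow> d = c"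
      have "restrict a S = c"
        by (rule c[rule_format]) (use a S restrict_sum in auto)
      moreover have "restrict b S = c"
        by (rule c[rule_format]) (use b S eq restrict_sum in auto)
      ultimately show ?thesis by simp
    qed
    then show "a s = b s" using s by (metis restrict_apply')
  next
    fix x assume R: "?span \<and> ?unique" and x: "x \<in> carrier M"
    obtain a where a: "a \<in> S \<rightarrow> carrier R" "x = (\<Oplus>\<^bsub>M\<^esub>s\<in>S. a s \<odot>\<^bsub>M\<^esub> s)"
      using R x by auto
    show "\<exists>!a. a \<in> S \<rightarrow>\<^sub>E carrier R \<and> x = (\<Oplus>\<^bsub>M\<^esub>s\<in>S. a s \<odot>\<^bsub>M\<^esub> s)"
    proof (rule ex1I[of _ "restrict a S"])
      show "restrict a S \<in> S \<rightarrow>\<^sub>E carrier R \<and> x = (\<Oplus>\<^bsub>M\<^esub>s\<in>S. restrict a S s \<odot>\<^bsub>M\<^esub> s)"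
        using a S restrict_sum by auto
      fix b assume b: "b \<in> S \<rightarrow>\<^sub>E carrier R \<and> x = (\<Oplus>\<^bsub>M\<^esub>s\<in>S. b s \<odot>\<^bsub>M\<^esub> s)"
      then have bS: "b \<in> S \<rightarrow> carrier R" by (auto simp: PiE_def)
      have "\<forall>s\<in>S. b s = a s"
        by (rule mp[OF bspec[OF bspec[OF conjunct2[OF R] bS] a(1)]])
          (use a b in auto)
      then show "b = restrict a S"
        using b by (intro PiE_ext[of b S "\<lambda>_. carrier R"]) (use a in auto)
    qed
  qed
  then show ?thesis
    by (simp add: free_of_rank_def module_axioms cong: conj_cong)
qed

text \<open>Passing from fractions in the field to classes of pairs changes ring and module at the
  same time. Freeness sees the scalars only through their action, so \<rho> enters as a bijection
  compatible with that action.\<close>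

definition semilinear_iso ::
  "('r, 'c) ring_scheme \<Rightarrow> ('r, 'm, 'd) module_scheme \<Rightarrow> ('s, 'e) ring_scheme \<Rightarrow>
   ('s, 'n, 'f) module_scheme \<Rightarrow> ('r \<Rightarrow> 's) \<Rightarrow> ('m \<Rightarrow> 'n) \<Rightarrow> bool" where
  "semilinear_iso R M R' M' \<rho> \<mu> \<longleftrightarrow>
     module R M \<and> module R' M' \<and>
     bij_betw \<rho> (carrier R) (carrier R') \<and> bij_betw \<mu> (carrier M) (carrier M') \<and>
     (\<forall>x \<in> carrier M. \<forall>y \<in> carrier M. \<mu> (x \<oplus>\<^bsub>M\<^esub> y) = \<mu> x \<oplus>\<^bsub>M'\<^esub> \<mu> y) \<and>
     (\<forall>a \<in> carrier R. \<forall>x \<in> carrier M. \<mu> (a \<odot>\<^bsub>M\<^esub> x) = \<rho> a \<odot>\<^bsub>M'\<^esub> \<mu> x)"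

lemma semilinear_iso_inv:
  assumes "semilinear_iso R M R' M' \<rho> \<mu>"
  shows "semilinear_iso R' M' R M (inv_into (carrier R) \<rho>) (inv_into (carrier M) \<mu>)"
proof -
  have mods: "module R M" "module R' M'"
    and \<rho>: "bij_betw \<rho> (carrier R) (carrier R')" and \<mu>: "bij_betw \<mu> (carrier M) (carrier M')"
    and add: "\<And>x y. x \<in> carrier M \<Longrightarrow> y \<in> carrier M \<Longrightarrow> \<mu> (x \<oplus>\<^bsub>M\<^esub> y) = \<mu> x \<oplus>\<^bsub>M'\<^esub> \<mu> y"
    and mult: "\<And>a x. a \<in> carrier R \<Longrightarrow> x \<in> carrier M \<Longrightarrow> \<mu> (a \<odot>\<^bsub>M\<^esub> x) = \<rho> a \<odot>\<^bsub>M'\<^esub> \<mu> x"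
    using assms by (auto simp: semilinear_iso_def)
  interpret M: module R M by fact
  let ?\<rho> = "inv_into (carrier R) \<rho>" and ?\<mu> = "inv_into (carrier M) \<mu>"
  have i\<rho>: "?\<rho> a \<in> carrier R" "\<rho> (?\<rho> a) = a" if "a \<in> carrier R'" for a
    using \<rho> that by (auto simp: bij_betw_def inv_into_into f_inv_into_f)
  have i\<mu>: "?\<mu> x \<in> carrier M" "\<mu> (?\<mu> x) = x" if "x \<in> carrier M'" for x
    using \<mu> that by (auto simp: bij_betw_def inv_into_into f_inv_into_f)
  have \<mu>i: "?\<mu> (\<mu> x) = x" if "x \<in> carrier M" for x
    using \<mu> that by (simp add: bij_betw_def)
  have "?\<mu> (x \<oplus>\<^bsub>M'\<^esub> y) = ?\<mu> x \<oplus>\<^bsub>M\<^esub> ?\<mu> y" if "x \<in> carrier M'" "y \<in> carrier M'" for x y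
    using \<mu>i[of "?\<mu> x \<oplus>\<^bsub>M\<^esub> ?\<mu> y"] add[of "?\<mu> x" "?\<mu> y"] i\<mu> that by simp
  moreover have "?\<mu> (a \<odot>\<^bsub>M'\<^esub> x) = ?\<rho> a \<odot>\<^bsub>M\<^esub> ?\<mu> x" if "a \<in> carrier R'" "x \<in> carrier M'" for a x
    using \<mu>i[of "?\<rho> a \<odot>\<^bsub>M\<^esub> ?\<mu> x"] mult[of "?\<rho> a" "?\<mu> x"] i\<mu> i\<rho> that by simp
  ultimately show ?thesis
    using mods \<rho> \<mu> by (simp add: semilinear_iso_def bij_betw_inv_into)
qed

lemma free_of_rank_semilinear_iso_imp:
  assumes iso: "semilinear_iso R M R' M' \<rho> \<mu>" and free: "free_of_rank R M n"
  shows "free_of_rank R' M' n"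
proof -
  have mods: "module R M" "module R' M'"
    and \<rho>: "bij_betw \<rho> (carrier R) (carrier R')" and \<mu>: "bij_betw \<mu> (carrier M) (carrier M')"
    and add: "\<And>x y. x \<in> carrier M \<Longrightarrow> y \<in> carrier M \<Longrightarrow> \<mu> (x \<oplus>\<^bsub>M\<^esub> y) = \<mu> x \<oplus>\<^bsub>M'\<^esub> \<mu> y"
    and mult: "\<And>a x. a \<in> carrier R \<Longrightarrow> x \<in> carrier M \<Longrightarrow> \<mu> (a \<odot>\<^bsub>M\<^esub> x) = \<rho> a \<odot>\<^bsub>M'\<^esub> \<mu> x"
    using iso by (auto simp: semilinear_iso_def)
  interpret M: module R M by fact
  interpret M': module R' M' by fact
  have \<mu>c: "\<mu> x \<in> carrier M'" if "x \<in> carrier M" for x using \<mu> that by (auto simp: bij_betw_def)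
  have \<rho>c: "\<rho> a \<in> carrier R'" if "a \<in> carrier R" for a using \<rho> that by (auto simp: bij_betw_def)
  have \<mu>_inj: "inj_on \<mu> (carrier M)" using \<mu> by (simp add: bij_betw_def)
  have \<mu>_zero: "\<mu> \<zero>\<^bsub>M\<^esub> = \<zero>\<^bsub>M'\<^esub>"
    using add[of "\<zero>\<^bsub>M\<^esub>" "\<zero>\<^bsub>M\<^esub>"] \<mu>c[of "\<zero>\<^bsub>M\<^esub>"] by (simp add: M'.M.add.r_cancel_one')
  obtain S where S: "finite S" "card S = n" "S \<subseteq> carrier M"
    and span: "\<And>x. x \<in> carrier M \<Longrightarrow> \<exists>a \<in> S \<rightarrow> carrier R. x = (\<Oplus>\<^bsub>M\<^esub>s\<in>S. a s \<odot>\<^bsub>M\<^esub> s)"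
    and unique: "\<And>a b s. a \<in> S \<rightarrow> carrier R \<Longrightarrow> b \<in> S \<rightarrow> carrier R \<Longrightarrow>
      (\<Oplus>\<^bsub>M\<^esub>s\<in>S. a s \<odot>\<^bsub>M\<^esub> s) = (\<Oplus>\<^bsub>M\<^esub>s\<in>S. b s \<odot>\<^bsub>M\<^esub> s) \<Longrightarrow> s \<in> S \<Longrightarrow> a s = b s"
    using free unfolding M.free_of_rank_iff by auto
  have inj: "inj_on \<mu> S" using \<mu>_inj S(3) by (rule inj_on_subset)
  have sum: "\<mu> (\<Oplus>\<^bsub>M\<^esub>s\<in>T. a s \<odot>\<^bsub>M\<^esub> s) = (\<Oplus>\<^bsub>M'\<^esub>s\<in>T. \<rho> (a s) \<odot>\<^bsub>M'\<^esub> \<mu> s)"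
    if "T \<subseteq> S" "a \<in> S \<rightarrow> carrier R" for T a
  proof -
    have "finite T" using that(1) S(1) by (rule finite_subset)
    then show ?thesis using that(1)
    proof (induction T)
      case empty
      show ?case by (simp add: \<mu>_zero)
    next
      case (insert t T)
      have c: "t \<in> carrier M" "a t \<in> carrier R" "\<And>s. s \<in> T \<Longrightarrow> s \<in> carrier M"
        "\<And>s. s \<in> T \<Longrightarrow> a s \<in> carrier R"
        using insert.prems that(2) S(3) by auto
      have "(\<Oplus>\<^bsub>M\<^esub>s\<in>insert t T. a s \<odot>\<^bsub>M\<^esub> s) = a t \<odot>\<^bsub>M\<^esub> t \<oplus>\<^bsub>M\<^esub> (\<Oplus>\<^bsub>M\<^esub>s\<in>T. a s \<odot>\<^bsub>M\<^esub> s)"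
        using c insert.hyps by (intro M.M.finsum_insert) auto
      moreover have "(\<Oplus>\<^bsub>M'\<^esub>s\<in>insert t T. \<rho> (a s) \<odot>\<^bsub>M'\<^esub> \<mu> s)
        = \<rho> (a t) \<odot>\<^bsub>M'\<^esub> \<mu> t \<oplus>\<^bsub>M'\<^esub> (\<Oplus>\<^bsub>M'\<^esub>s\<in>T. \<rho> (a s) \<odot>\<^bsub>M'\<^esub> \<mu> s)"
        using c \<mu>c \<rho>c insert.hyps by (intro M'.M.finsum_insert) auto
      moreover have "(\<Oplus>\<^bsub>M\<^esub>s\<in>T. a s \<odot>\<^bsub>M\<^esub> s) \<in> carrier M" using c by (intro M.M.finsum_closed) auto
      ultimately show ?case using insert c add mult by simp
    qed
  qed
  have reindex: "(\<Oplus>\<^bsub>M'\<^esub>t\<in>\<mu> ` S. b t \<odot>\<^bsub>M'\<^esub> t) = (\<Oplus>\<^bsub>M'\<^esub>s\<in>S. b (\<mu> s) \<odot>\<^bsub>M'\<^esub> \<mu> s)"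
    if "b \<in> \<mu> ` S \<rightarrow> carrier R'" for b
    using that \<mu>c S(3) inj by (intro M'.M.finsum_reindex) (auto simp: Pi_iff subset_iff)
  show ?thesis
    unfolding M'.free_of_rank_iff
  proof (intro exI conjI ballI impI)
    show "finite (\<mu> ` S)" "card (\<mu> ` S) = n" "\<mu> ` S \<subseteq> carrier M'"
      using S \<mu>c card_image[OF inj] by auto
    fix y assume "y \<in> carrier M'"
    then obtain x where x: "x \<in> carrier M" "y = \<mu> x" using \<mu> by (auto simp: bij_betw_def)
    obtain a where a: "a \<in> S \<rightarrow> carrier R" "x = (\<Oplus>\<^bsub>M\<^esub>s\<in>S. a s \<odot>\<^bsub>M\<^esub> s)" using span[OF x(1)] by blast
    define b where "b t = \<rho> (a (inv_into S \<mu> t))" for t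
    have b\<mu>: "b (\<mu> s) = \<rho> (a s)" if "s \<in> S" for s using inj that by (simp add: b_def)
    then have b: "b \<in> \<mu> ` S \<rightarrow> carrier R'" using a(1) \<rho>c by (auto simp: Pi_iff)
    have "y = (\<Oplus>\<^bsub>M'\<^esub>s\<in>S. \<rho> (a s) \<odot>\<^bsub>M'\<^esub> \<mu> s)"
      using sum[of S a] a x(2) by simp
    also have "\<dots> = (\<Oplus>\<^bsub>M'\<^esub>s\<in>S. b (\<mu> s) \<odot>\<^bsub>M'\<^esub> \<mu> s)"
      using b\<mu> a(1) \<rho>c \<mu>c S(3) by (intro M'.M.finsum_cong') (auto simp: Pi_iff subset_iff)
    also have "\<dots> = (\<Oplus>\<^bsub>M'\<^esub>t\<in>\<mu> ` S. b t \<odot>\<^bsub>M'\<^esub> t)" using reindex[OF b] by simp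
    finally show "\<exists>b \<in> \<mu> ` S \<rightarrow> carrier R'. y = (\<Oplus>\<^bsub>M'\<^esub>t\<in>\<mu> ` S. b t \<odot>\<^bsub>M'\<^esub> t)" using b by blast
  next
    fix b c t
    assume b: "b \<in> \<mu> ` S \<rightarrow> carrier R'" and c: "c \<in> \<mu> ` S \<rightarrow> carrier R'" and t: "t \<in> \<mu> ` S"
      and eq: "(\<Oplus>\<^bsub>M'\<^esub>t\<in>\<mu> ` S. b t \<odot>\<^bsub>M'\<^esub> t) = (\<Oplus>\<^bsub>M'\<^esub>t\<in>\<mu> ` S. c t \<odot>\<^bsub>M'\<^esub> t)"
    \<comment> \<open>Coefficients over \<open>R'\<close> are pulled back along \<rho>; injectivity
      of \<mu> then turns equal sums in \<open>M'\<close> into equal sums in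
      \<open>M\<close>.\<close>
    let ?l = "\<lambda>b s. inv_into (carrier R) \<rho> (b (\<mu> s))"
    have l: "?l b \<in> S \<rightarrow> carrier R" "\<And>s. s \<in> S \<Longrightarrow> \<rho> (?l b s) = b (\<mu> s)"
      "\<mu> (\<Oplus>\<^bsub>M\<^esub>s\<in>S. ?l b s \<odot>\<^bsub>M\<^esub> s) = (\<Oplus>\<^bsub>M'\<^esub>t\<in>\<mu> ` S. b t \<odot>\<^bsub>M'\<^esub> t)"
      if b: "b \<in> \<mu> ` S \<rightarrow> carrier R'" for b
    proof -
      have bc: "b (\<mu> s) \<in> carrier R'" if "s \<in> S" for s using b that by auto
      show l1: "?l b \<in> S \<rightarrow> carrier R"
        using bc \<rho> by (auto simp: bij_betw_def inv_into_into)
      show l2: "\<rho> (?l b s) = b (\<mu> s)" if "s \<in> S" for s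
        using bc[OF that] \<rho> by (simp add: bij_betw_def f_inv_into_f)
      have "\<mu> (\<Oplus>\<^bsub>M\<^esub>s\<in>S. ?l b s \<odot>\<^bsub>M\<^esub> s) = (\<Oplus>\<^bsub>M'\<^esub>s\<in>S. \<rho> (?l b s) \<odot>\<^bsub>M'\<^esub> \<mu> s)"
        by (rule sum[OF order_refl l1])
      also have "\<dots> = (\<Oplus>\<^bsub>M'\<^esub>s\<in>S. b (\<mu> s) \<odot>\<^bsub>M'\<^esub> \<mu> s)"
        using l2 bc \<mu>c S(3) by (intro M'.M.finsum_cong') (auto simp: subset_iff)
      finally show "\<mu> (\<Oplus>\<^bsub>M\<^esub>s\<in>S. ?l b s \<odot>\<^bsub>M\<^esub> s) = (\<Oplus>\<^bsub>M'\<^esub>t\<in>\<mu> ` S. b t \<odot>\<^bsub>M'\<^esub> t)"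
        using reindex[OF b] by simp
    qed
    have cl: "(\<Oplus>\<^bsub>M\<^esub>s\<in>S. ?l b s \<odot>\<^bsub>M\<^esub> s) \<in> carrier M" if "b \<in> \<mu> ` S \<rightarrow> carrier R'" for b
      using l(1)[OF that] S(3) by (intro M.M.finsum_closed) auto
    have e: "(\<Oplus>\<^bsub>M\<^esub>s\<in>S. ?l b s \<odot>\<^bsub>M\<^esub> s) = (\<Oplus>\<^bsub>M\<^esub>s\<in>S. ?l c s \<odot>\<^bsub>M\<^esub> s)"
      by (intro inj_onD[OF \<mu>_inj _ cl[OF b] cl[OF c]]) (simp only: l(3)[OF b] l(3)[OF c] eq)
    obtain s where s: "s \<in> S" "t = \<mu> s" using t by auto
    have "?l b s = ?l c s"
      by (rule unique[of "?l b" "?l c" s, OF l(1)[OF b] l(1)[OF c] e s(1)])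
    then have "\<rho> (?l b s) = \<rho> (?l c s)" by (rule arg_cong)
    then show "b t = c t" unfolding l(2)[OF b s(1)] l(2)[OF c s(1)] s(2) .
  qed
qed

lemma free_of_rank_semilinear_iso:
  assumes "semilinear_iso R M R' M' \<rho> \<mu>"
  shows "free_of_rank R M n \<longleftrightarrow> free_of_rank R' M' n"
  using free_of_rank_semilinear_iso_imp[OF assms]
    free_of_rank_semilinear_iso_imp[OF semilinear_iso_inv[OF assms]] by blast

section \<open>Subsets of the ambient ring as modules\<close>

lemma (in cring) module_mult_module:
  assumes A: "subring A R" and M: "subalgebra A M R"
  shows "module (R\<lparr>carrier := A\<rparr>) (mult_module R M)"
proof (rule moduleI)
  note M_props = subalgebraD[OF M]
  have Mc: "x \<in> carrier R" if "x \<in> M" for x using that M_props(1) by blast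
  show "cring (R\<lparr>carrier := A\<rparr>)"
    using subcringI'[OF A] subcring_iff subringE(1)[OF A] by blast
  show "abelian_group (mult_module R M)"
  proof (rule abelian_groupI)
    fix x assume "x \<in> carrier (mult_module R M)"
    then have x: "x \<in> M" by (simp add: mult_module_def)
    have "\<ominus> x = (\<ominus> \<one>) \<otimes> x" using Mc[OF x] by (simp add: l_minus)
    then have "\<ominus> x \<in> M" using M_props(4) subringE(3,5)[OF A] x by simp
    then show "\<exists>y\<in>carrier (mult_module R M). y \<oplus>\<^bsub>mult_module R M\<^esub> x = \<zero>\<^bsub>mult_module R M\<^esub>"
      using Mc[OF x] by (intro bexI[of _ "\<ominus> x"]) (auto simp: mult_module_def l_neg)
  qed (use M_props Mc in \<open>auto simp: mult_module_def a_assoc intro: a_comm\<close>)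
qed (use subalgebraD[OF M] subringE(1)[OF A] in
    \<open>auto simp: mult_module_def l_distr r_distr m_assoc subset_iff\<close>)

lemma (in cring) free_of_rank_iff_basis_over:
  assumes A: "subring A R" and M: "subalgebra A M R"
  shows "free_of_rank (R\<lparr>carrier := A\<rparr>) (mult_module R M) n \<longleftrightarrow> (\<exists>S. card S = n \<and> basis_over A M S)"
proof -
  have mod: "module (R\<lparr>carrier := A\<rparr>) (mult_module R M)" by (rule module_mult_module[OF A M])
  then have ab: "abelian_group (mult_module R M)" by (simp add: module_def)
  have "finsum (mult_module R M) (\<lambda>s. a s \<otimes> s) S = (\<Oplus>s\<in>S. a s \<otimes> s)"
    if "finite S" "S \<subseteq> M" "a \<in> S \<rightarrow>\<^sub>E A" for a S
    using that subalgebraD(1,4)[OF M]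
    by (intro finsum_mult_module[OF ab]) (auto simp: PiE_iff subset_iff)
  then have sums: "(\<lambda>a. a \<in> S \<rightarrow>\<^sub>E A \<and> x = finsum (mult_module R M) (\<lambda>s. a s \<otimes> s) S)
      = (\<lambda>a. a \<in> S \<rightarrow>\<^sub>E A \<and> x = (\<Oplus>s\<in>S. a s \<otimes> s))"
    if "finite S" "S \<subseteq> M" for x S
    using that by (intro ext) (auto cong: conj_cong)
  have simps: "carrier (mult_module R M) = M" "module.smult (mult_module R M) = monoid.mult R"
    by (simp_all add: mult_module_def)
  show ?thesis
    unfolding free_of_rank_def basis_over_def simps
  proof (intro iffI)
    assume "module (R\<lparr>carrier := A\<rparr>) (mult_module R M) \<and>
      (\<exists>S. finite S \<and> card S = n \<and> S \<subseteq> M \<and>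
        (\<forall>x\<in>M. \<exists>!a. a \<in> S \<rightarrow>\<^sub>E carrier (R\<lparr>carrier := A\<rparr>) \<and>
          x = finsum (mult_module R M) (\<lambda>s. a s \<otimes> s) S))"
    then obtain S where S: "card S = n" "finite S" "S \<subseteq> M"
      "\<forall>x\<in>M. \<exists>!a. a \<in> S \<rightarrow>\<^sub>E A \<and> x = finsum (mult_module R M) (\<lambda>s. a s \<otimes> s) S"
      by auto
    then show "\<exists>S. card S = n \<and> finite S \<and> S \<subseteq> M \<and>
        (\<forall>x\<in>M. \<exists>!a. a \<in> S \<rightarrow>\<^sub>E A \<and> x = (\<Oplus>s\<in>S. a s \<otimes> s))"
      by (intro conjI exI[of _ S]) (simp_all add: sums)
  next
    assume "\<exists>S. card S = n \<and> finite S \<and> S \<subseteq> M \<and>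
        (\<forall>x\<in>M. \<exists>!a. a \<in> S \<rightarrow>\<^sub>E A \<and> x = (\<Oplus>s\<in>S. a s \<otimes> s))"
    then obtain S where S: "card S = n" "finite S" "S \<subseteq> M"
      "\<forall>x\<in>M. \<exists>!a. a \<in> S \<rightarrow>\<^sub>E A \<and> x = (\<Oplus>s\<in>S. a s \<otimes> s)"
      by blast
    then show "module (R\<lparr>carrier := A\<rparr>) (mult_module R M) \<and>
      (\<exists>S. finite S \<and> card S = n \<and> S \<subseteq> M \<and>
        (\<forall>x\<in>M. \<exists>!a. a \<in> S \<rightarrow>\<^sub>E carrier (R\<lparr>carrier := A\<rparr>) \<and>
          x = finsum (mult_module R M) (\<lambda>s. a s \<otimes> s) S))"
      by (intro conjI mod exI[of _ S]) (simp_all add: sums)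
  qed
qed

section \<open>Localization as a module of fractions\<close>

lemma mult_module_simps [simp]:
  "carrier (mult_module R M) = M" "add (mult_module R M) = add R"
  "zero (mult_module R M) = zero R" "module.smult (mult_module R M) = monoid.mult R"
  by (simp_all add: mult_module_def)

text \<open>The operations on fractions are unions over all representatives. If all representatives
  give the same class and there is at least one, the union is that class.\<close>

lemma UN_UN_const:
  assumes "\<exists>m s. (m, s) \<in> I" "\<exists>n t. (n, t) \<in> J"
    and "\<And>m s n t. (m, s) \<in> I \<Longrightarrow> (n, t) \<in> J \<Longrightarrow> f m s n t = C"
  shows "(\<Union>(m, s)\<in>I. \<Union>(n, t)\<in>J. f m s n t) = C"
proof -
  obtain m s n t where "(m, s) \<in> I" "(n, t) \<in> J" using assms(1,2) by blast
  then have "C \<subseteq> (\<Union>(m, s)\<in>I. \<Union>(n, t)\<in>J. f m s n t)"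
    using assms(3) by (auto intro!: bexI[of _ "(m, s)"] bexI[of _ "(n, t)"])
  moreover have "(\<Union>(m, s)\<in>I. \<Union>(n, t)\<in>J. f m s n t) \<subseteq> C"
    using assms(3) by (intro UN_least) auto
  ultimately show ?thesis by (intro equalityI)
qed

context denominators
begin

text \<open>The set of all pairs that represent the element \<open>x\<close> of the field. The
  condition is written with a product, so that no inverse occurs.\<close>

definition frac_class :: "'a set \<Rightarrow> 'a \<Rightarrow> ('a \<times> 'a) set" where
  "frac_class M x = {(m, s). m \<in> M \<and> s \<in> P \<and> m = s \<otimes> x}"

lemma frac_class_nonempty:
  assumes "M \<subseteq> carrier R" "x \<in> fractions M P"
  shows "\<exists>m s. (m, s) \<in> frac_class M x"
  using assms by (auto simp: fractions_iff frac_class_def)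

lemma frac_class_inj:
  assumes M: "M \<subseteq> carrier R" and x: "x \<in> fractions M P" and y: "y \<in> fractions M P"
    and eq: "frac_class M x = frac_class M y"
  shows "x = y"
proof -
  obtain m s where ms: "(m, s) \<in> frac_class M x" using frac_class_nonempty[OF M x] by blast
  then have "(m, s) \<in> frac_class M y" using eq by simp
  with ms have "s \<in> P" "m = s \<otimes> x" "m = s \<otimes> y" by (simp_all add: frac_class_def)
  then show ?thesis
    using P_cancel[of s x y] x y fractions_iff[OF M] by blast
qed

text \<open>Inside a field the auxiliary factor \<open>t\<close> of \<open>frac_rel\<close> can be
  cancelled, so two pairs are equivalent exactly when they have the same quotient.\<close>

lemma fraction_eq_frac_class:
  assumes M: "subalgebra A M R" and m: "m \<in> M" and s: "s \<in> P" and x: "x \<in> carrier R" "m = s \<otimes> x"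
  shows "fraction (R\<lparr>carrier := A\<rparr>) P (mult_module R M) m s = frac_class M x"
proof -
  have Mc: "y \<in> carrier R" if "y \<in> M" for y using subalgebraD(1)[OF M] that by blast
  have "(\<exists>t\<in>P. t \<otimes> (s' \<otimes> m) = t \<otimes> (s \<otimes> m')) \<longleftrightarrow> m' = s' \<otimes> x" if "m' \<in> M" "s' \<in> P" for m' s'
  proof
    assume "\<exists>t\<in>P. t \<otimes> (s' \<otimes> m) = t \<otimes> (s \<otimes> m')"
    then obtain t where t: "t \<in> P" "t \<otimes> (s' \<otimes> m) = t \<otimes> (s \<otimes> m')" by blast
    have "s' \<otimes> m = s \<otimes> m'"
      by (rule P_cancel[OF t(1) _ _ t(2)]) (use that s Mc m P_closed(1) in auto)
    also have "s' \<otimes> m = s \<otimes> (s' \<otimes> x)"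
      using x that s P_closed(1) by (simp add: m_lcomm)
    finally show "m' = s' \<otimes> x"
      using P_cancel[OF s, of "s' \<otimes> x" m'] that Mc x P_closed(1) by auto
  next
    assume "m' = s' \<otimes> x"
    then have "\<one> \<otimes> (s' \<otimes> m) = \<one> \<otimes> (s \<otimes> m')"
      using x that s P_closed(1) by (simp add: m_lcomm)
    then show "\<exists>t\<in>P. t \<otimes> (s' \<otimes> m) = t \<otimes> (s \<otimes> m')" using P_one by blast
  qed
  then show ?thesis
    using m s unfolding fraction_def frac_rel_def frac_class_def
    by (auto simp: Image_def)
qed

lemma carrier_localized_module:
  assumes M: "subalgebra A M R"
  shows "carrier (localized_module (R\<lparr>carrier := A\<rparr>) P (mult_module R M))
    = frac_class M ` fractions M P"
proof -
  have Mc: "M \<subseteq> carrier R" using subalgebraD(1)[OF M] .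
  have "carrier (localized_module (R\<lparr>carrier := A\<rparr>) P (mult_module R M))
    = {fraction (R\<lparr>carrier := A\<rparr>) P (mult_module R M) m s | m s. m \<in> M \<and> s \<in> P}"
    by (auto simp: localized_module_def quotient_def fraction_def)
  also have "\<dots> = frac_class M ` fractions M P"
  proof (intro equalityI subsetI)
    fix c assume "c \<in> {fraction (R\<lparr>carrier := A\<rparr>) P (mult_module R M) m s | m s. m \<in> M \<and> s \<in> P}"
    then obtain m s where ms: "m \<in> M" "s \<in> P" "c = fraction (R\<lparr>carrier := A\<rparr>) P (mult_module R M) m s"
      by blast
    have mc: "m \<in> carrier R" using ms Mc by blast
    have x: "m \<otimes> inv s \<in> carrier R" "m = s \<otimes> (m \<otimes> inv s)"
      using mc P_inv[OF ms(2)] P_closed(1)[OF ms(2)] by (simp_all add: m_lcomm[of s m])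
    have "m \<otimes> inv s \<in> fractions M P" using ms by (auto simp: fractions_def)
    then show "c \<in> frac_class M ` fractions M P"
      using fraction_eq_frac_class[OF M ms(1,2) x] ms(3) by blast
  next
    fix c assume "c \<in> frac_class M ` fractions M P"
    then obtain x where x: "x \<in> fractions M P" "c = frac_class M x" by blast
    then obtain s where "x \<in> carrier R" "s \<in> P" "s \<otimes> x \<in> M" using Mc by (auto simp: fractions_iff)
    then show "c \<in> {fraction (R\<lparr>carrier := A\<rparr>) P (mult_module R M) m s | m s. m \<in> M \<and> s \<in> P}"
      using fraction_eq_frac_class[OF M, of "s \<otimes> x" s x] x(2) by blast
  qed
  finally show ?thesis .
qed

lemma frac_add_frac_class:
  assumes M: "subalgebra A M R" and x: "x \<in> fractions M P" and y: "y \<in> fractions M P"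
  shows "frac_add (R\<lparr>carrier := A\<rparr>) P (mult_module R M) (frac_class M x) (frac_class M y)
    = frac_class M (x \<oplus> y)"
proof -
  have Mc: "M \<subseteq> carrier R" using subalgebraD(1)[OF M] .
  have xc: "x \<in> carrier R" "y \<in> carrier R" using x y Mc by (auto simp: fractions_iff)
  have "fraction (R\<lparr>carrier := A\<rparr>) P (mult_module R M) (t \<otimes> m \<oplus> s \<otimes> n) (s \<otimes> t) = frac_class M (x \<oplus> y)"
    if "(m, s) \<in> frac_class M x" "(n, t) \<in> frac_class M y" for m s n t
  proof (rule fraction_eq_frac_class[OF M])
    have mn: "m \<in> M" "n \<in> M" "s \<in> P" "t \<in> P" "m = s \<otimes> x" "n = t \<otimes> y"
      using that by (auto simp: frac_class_def)
    show "t \<otimes> m \<oplus> s \<otimes> n \<in> M" using mn subalgebraD(3,4)[OF M] P_closed(2) by auto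
    show "s \<otimes> t \<in> P" using mn P_mult by auto
    show "x \<oplus> y \<in> carrier R" using xc by simp
    show "t \<otimes> m \<oplus> s \<otimes> n = s \<otimes> t \<otimes> (x \<oplus> y)"
      using mn xc P_closed(1) by (simp add: r_distr m_ac)
  qed
  then show ?thesis
    unfolding frac_add_def mult_module_simps
    by (intro UN_UN_const frac_class_nonempty[OF Mc x] frac_class_nonempty[OF Mc y]) simp
qed

lemma frac_smult_frac_class:
  assumes M: "subalgebra A M R" and a: "a \<in> fractions A P" and x: "x \<in> fractions M P"
  shows "frac_smult (R\<lparr>carrier := A\<rparr>) P (mult_module R M) (frac_class A a) (frac_class M x)
    = frac_class M (a \<otimes> x)"
proof -
  have Mc: "M \<subseteq> carrier R" using subalgebraD(1)[OF M] .
  have xc: "a \<in> carrier R" "x \<in> carrier R" using a x Mc A_props(1) by (auto simp: fractions_iff)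
  have "fraction (R\<lparr>carrier := A\<rparr>) P (mult_module R M) (b \<otimes> m) (s \<otimes> t) = frac_class M (a \<otimes> x)"
    if "(b, s) \<in> frac_class A a" "(m, t) \<in> frac_class M x" for m s b t
  proof (rule fraction_eq_frac_class[OF M])
    have mn: "b \<in> A" "m \<in> M" "s \<in> P" "t \<in> P" "b = s \<otimes> a" "m = t \<otimes> x"
      using that by (auto simp: frac_class_def)
    show "b \<otimes> m \<in> M" using mn subalgebraD(4)[OF M] by auto
    show "s \<otimes> t \<in> P" using mn P_mult by auto
    show "a \<otimes> x \<in> carrier R" using xc by simp
    show "b \<otimes> m = s \<otimes> t \<otimes> (a \<otimes> x)"
      using mn xc P_closed(1) by (simp add: m_ac)
  qed
  then show ?thesis
    unfolding frac_smult_def mult_module_simps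
    by (intro UN_UN_const frac_class_nonempty[OF A_props(1) a] frac_class_nonempty[OF Mc x]) simp
qed

lemma fraction_one_eq_frac_class:
  assumes M: "subalgebra A M R" and x: "x \<in> M"
  shows "fraction (R\<lparr>carrier := A\<rparr>) P (mult_module R M) x \<one> = frac_class M x"
  using fraction_eq_frac_class[OF M x P_one, of x] x subalgebraD(1)[OF M] by auto

lemma bij_betw_frac_class:
  assumes M: "subalgebra A M R"
  shows "bij_betw (frac_class M) (fractions M P)
    (carrier (localized_module (R\<lparr>carrier := A\<rparr>) P (mult_module R M)))"
  unfolding carrier_localized_module[OF M]
  using frac_class_inj[OF subalgebraD(1)[OF M]] by (auto simp: bij_betw_def inj_on_def)

lemma localized_ring_simps:
  "carrier (localized_ring (R\<lparr>carrier := A\<rparr>) P)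
     = carrier (localized_module (R\<lparr>carrier := A\<rparr>) P (mult_module R A))"
  "monoid.mult (localized_ring (R\<lparr>carrier := A\<rparr>) P)
     = frac_smult (R\<lparr>carrier := A\<rparr>) P (mult_module R A)"
  "add (localized_ring (R\<lparr>carrier := A\<rparr>) P) = frac_add (R\<lparr>carrier := A\<rparr>) P (mult_module R A)"
  "one (localized_ring (R\<lparr>carrier := A\<rparr>) P) = frac_class A \<one>"
  "zero (localized_ring (R\<lparr>carrier := A\<rparr>) P) = frac_class A \<zero>"
  using fraction_one_eq_frac_class[OF subalgebra_A] A_props(2,3)
  by (simp_all add: localized_ring_def localized_module_def Let_def)
    (simp_all add: mult_module_def)

lemma frac_class_ring_iso:
  "frac_class A \<in> ring_iso (R\<lparr>carrier := fractions A P\<rparr>) (localized_ring (R\<lparr>carrier := A\<rparr>) P)"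
  using bij_betw_frac_class[OF subalgebra_A] frac_smult_frac_class[OF subalgebra_A]
    frac_add_frac_class[OF subalgebra_A]
  by (intro ring_iso_memI) (auto simp: localized_ring_simps bij_betw_def)

lemma cring_localized_ring: "cring (localized_ring (R\<lparr>carrier := A\<rparr>) P)"
proof -
  interpret AP: cring "R\<lparr>carrier := fractions A P\<rparr>"
    using subcringI'[OF subring_fractions] subcring_iff subringE(1)[OF subring_fractions] by blast
  have "cring (localized_ring (R\<lparr>carrier := A\<rparr>) P
      \<lparr>zero := frac_class A \<zero>\<^bsub>R\<lparr>carrier := fractions A P\<rparr>\<^esub>\<rparr>)"
    by (rule AP.ring_iso_imp_img_cring[OF frac_class_ring_iso])
  \<comment> \<open>Transport along the isomorphism yields a ring whose zero is the image of
    \<open>\<zero>\<close>. This is already the zero of the localized ring, so the update changes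
    nothing.\<close>
  moreover have "localized_ring (R\<lparr>carrier := A\<rparr>) P
      \<lparr>zero := frac_class A \<zero>\<^bsub>R\<lparr>carrier := fractions A P\<rparr>\<^esub>\<rparr> = localized_ring (R\<lparr>carrier := A\<rparr>) P"
    using localized_ring_simps(5) by (simp add: localized_ring_def Let_def)
  ultimately show ?thesis by simp
qed

text \<open>The link to the definition of the rank: from here on, a localization of \<open>M\<close>
  may be replaced by the set \<open>fractions M P\<close> in the field.\<close>

lemma semilinear_iso_localized:
  assumes M: "subalgebra A M R"
  shows "semilinear_iso (R\<lparr>carrier := fractions A P\<rparr>) (mult_module R (fractions M P))
    (localized_ring (R\<lparr>carrier := A\<rparr>) P) (localized_module (R\<lparr>carrier := A\<rparr>) P (mult_module R M))
    (frac_class A) (frac_class M)"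
proof -
  let ?R' = "localized_ring (R\<lparr>carrier := A\<rparr>) P"
  let ?M' = "localized_module (R\<lparr>carrier := A\<rparr>) P (mult_module R M)"
  have Mf: "subalgebra (fractions A P) (fractions M P) R" by (rule subalgebra_fractions[OF M])
  note Mf_props = subalgebraD[OF Mf]
  have R'_carrier: "carrier ?R' = frac_class A ` fractions A P"
    using carrier_localized_module[OF subalgebra_A] by (simp add: localized_ring_simps)
  have Af: "subalgebra (fractions A P) (fractions A P) R" by (rule subalgebra_fractions[OF subalgebra_A])
  have M'_carrier: "carrier ?M' = frac_class M ` fractions M P" by (rule carrier_localized_module[OF M])
  have M'_zero: "\<zero>\<^bsub>?M'\<^esub> = frac_class M \<zero>"
    using fraction_one_eq_frac_class[OF M subalgebraD(2)[OF M]]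
    by (simp add: localized_module_def)
  have M'_add: "frac_class M x \<oplus>\<^bsub>?M'\<^esub> frac_class M y = frac_class M (x \<oplus> y)"
    if "x \<in> fractions M P" "y \<in> fractions M P" for x y
    using frac_add_frac_class[OF M that] by (simp add: localized_module_def)
  have M'_smult: "frac_class A a \<odot>\<^bsub>?M'\<^esub> frac_class M x = frac_class M (a \<otimes> x)"
    if "a \<in> fractions A P" "x \<in> fractions M P" for a x
    using frac_smult_frac_class[OF M that] by (simp add: localized_module_def)
  have R'_add: "frac_class A a \<oplus>\<^bsub>?R'\<^esub> frac_class A b = frac_class A (a \<oplus> b)"
    and R'_mult: "frac_class A a \<otimes>\<^bsub>?R'\<^esub> frac_class A b = frac_class A (a \<otimes> b)"
    if "a \<in> fractions A P" "b \<in> fractions A P" for a b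
    using frac_add_frac_class[OF subalgebra_A that] frac_smult_frac_class[OF subalgebra_A that]
    by (simp_all add: localized_ring_simps)
  have xc: "x \<in> carrier R" if "x \<in> fractions M P" for x using Mf_props(1) that by blast
  have ac: "x \<in> carrier R" if "x \<in> fractions A P" for x using subalgebraD(1)[OF Af] that by blast
  have "module ?R' ?M'"
  proof (rule moduleI)
    show "cring ?R'" by (rule cring_localized_ring)
    show "abelian_group ?M'"
    proof (rule abelian_groupI)
      fix c assume "c \<in> carrier ?M'"
      then obtain x where x: "x \<in> fractions M P" "c = frac_class M x" using M'_carrier by auto
      have "\<ominus> x = (\<ominus> \<one>) \<otimes> x" using xc[OF x(1)] by (simp add: l_minus)
      then have mx: "\<ominus> x \<in> fractions M P"
        using Mf_props(4) x(1) subringE(3,5)[OF subring_fractions] by simp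
      show "\<exists>d\<in>carrier ?M'. d \<oplus>\<^bsub>?M'\<^esub> c = \<zero>\<^bsub>?M'\<^esub>"
        using mx x xc[OF x(1)] M'_carrier
        by (intro bexI[of _ "frac_class M (\<ominus> x)"]) (auto simp: M'_add M'_zero l_neg)
    next
      fix c d assume "c \<in> carrier ?M'" "d \<in> carrier ?M'"
      then obtain x y where "x \<in> fractions M P" "c = frac_class M x" "y \<in> fractions M P" "d = frac_class M y"
        using M'_carrier by auto
      then show "c \<oplus>\<^bsub>?M'\<^esub> d = d \<oplus>\<^bsub>?M'\<^esub> c"
        using a_comm[OF xc xc, of x y] by (simp add: M'_add)
    qed (use Mf_props(2,3) xc in \<open>auto simp: M'_carrier M'_add M'_zero a_assoc\<close>)
  next
    fix a c assume "a \<in> carrier ?R'" "c \<in> carrier ?M'"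
    then show "a \<odot>\<^bsub>?M'\<^esub> c \<in> carrier ?M'"
      using Mf_props(4) by (auto simp: R'_carrier M'_carrier M'_smult)
  next
    fix c assume "c \<in> carrier ?M'"
    then show "\<one>\<^bsub>?R'\<^esub> \<odot>\<^bsub>?M'\<^esub> c = c"
      using subringE(3)[OF subring_fractions] xc
      by (auto simp: M'_carrier localized_ring_simps M'_smult)
  qed (use Mf_props(3,4) subalgebraD(3,4)[OF Af] xc ac in
      \<open>auto simp: R'_carrier M'_carrier M'_smult M'_add R'_add R'_mult l_distr r_distr m_assoc\<close>)
  then show ?thesis
    unfolding semilinear_iso_def
    using module_mult_module[OF subring_fractions Mf] bij_betw_frac_class[OF M]
      bij_betw_frac_class[OF subalgebra_A]
    by (simp add: localized_ring_simps(1) M'_add M'_smult)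
qed

lemma free_of_rank_localized_iff:
  assumes M: "subalgebra A M R"
  shows "free_of_rank (localized_ring (R\<lparr>carrier := A\<rparr>) P)
      (localized_module (R\<lparr>carrier := A\<rparr>) P (mult_module R M)) n
    \<longleftrightarrow> (\<exists>S. card S = n \<and> basis_over (fractions A P) (fractions M P) S)"
  using free_of_rank_semilinear_iso[OF semilinear_iso_localized[OF M]]
    free_of_rank_iff_basis_over[OF subring_fractions subalgebra_fractions[OF M]] by blast

end

section \<open>Prime ideals\<close>

lemma (in ring) subalgebraI_subring:
  assumes A: "subring A R" and M: "M \<subseteq> carrier R" "\<zero> \<in> M"
    and add: "\<And>x y. x \<in> M \<Longrightarrow> y \<in> M \<Longrightarrow> x \<oplus> y \<in> M"
    and mult: "\<And>a x. a \<in> A \<Longrightarrow> x \<in> M \<Longrightarrow> a \<otimes> x \<in> M"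
  shows "subalgebra A M R"
proof (intro subalgebra.intro subalgebra_axioms.intro mult)
  show "subgroup M (add_monoid R)"
  proof (rule add.subgroupI)
    fix x assume x: "x \<in> M"
    have "(\<ominus> \<one>) \<otimes> x \<in> M" using mult subringE(3,5)[OF A] x by blast
    then show "\<ominus> x \<in> M" using x M(1) by (auto simp: l_minus subset_iff)
  qed (use M add in auto)
qed

text \<open>Zorn's lemma provides an ideal maximal among those that contain \<open>I\<close> and
  avoid \<open>\<one>\<close>. It is a maximal ideal, hence prime.\<close>

lemma (in cring) ex_prime_ideal:
  assumes I: "ideal I R" "\<one> \<notin> I"
  shows "\<exists>p. primeideal p R \<and> I \<subseteq> p"
proof -
  define \<A> where "\<A> = {J. ideal J R \<and> I \<subseteq> J \<and> \<one> \<notin> J}"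
  have "\<exists>J\<in>\<A>. \<forall>J'\<in>\<A>. J \<subseteq> J' \<longrightarrow> J' = J"
  proof (rule subset_Zorn_nonempty)
    show "\<A> \<noteq> {}" using I by (auto simp: \<A>_def)
    fix C assume C: "C \<noteq> {}" "subset.chain \<A> C"
    have "C \<subseteq> \<A>" using C(2) by (simp add: subset_chain_def)
    moreover have "ideal (\<Union>C) R"
    proof -
      have "subset.chain {J. ideal J R} C"
        using C(2) by (auto simp: subset_chain_def \<A>_def)
      from chain_Union_is_ideal[OF this] show ?thesis using C(1) by simp
    qed
    ultimately show "\<Union>C \<in> \<A>" using C(1) by (auto simp: \<A>_def)
  qed
  then obtain J where J: "ideal J R" "I \<subseteq> J" "\<one> \<notin> J"
    and max: "\<And>J'. ideal J' R \<Longrightarrow> I \<subseteq> J' \<Longrightarrow> \<one> \<notin> J' \<Longrightarrow> J \<subseteq> J' \<Longrightarrow> J' = J"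
    by (auto simp: \<A>_def)
  have "maximalideal J R"
  proof (rule maximalidealI[OF J(1)])
    show "carrier R \<noteq> J" using J(3) by auto
    fix J' assume J': "ideal J' R" "J \<subseteq> J'" "J' \<subseteq> carrier R"
    show "J' = J \<or> J' = carrier R"
      using max[OF J'(1) _ _ J'(2)] J(2) J'(2) ideal.one_imp_carrier[OF J'(1)] by blast
  qed
  then show ?thesis using maximalideal_prime J(2) by blast
qed

text \<open>With the ideal regarded as an \<open>A\<close>-module, the closure properties of
  \<open>p A_p\<close> become instances of those of \<open>fractions\<close>.\<close>

lemma (in cring) subalgebra_if_ideal:
  assumes A: "subring A R" and p: "ideal p (R\<lparr>carrier := A\<rparr>)"
  shows "subalgebra A p R"
proof (rule subalgebraI_subring[OF A])
  interpret p: ideal p "R\<lparr>carrier := A\<rparr>" by fact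
  show "p \<subseteq> carrier R" using p.a_subset subringE(1)[OF A] by auto
  show "\<zero> \<in> p" using additive_subgroup.zero_closed[OF p.is_additive_subgroup] by simp
  show "x \<oplus> y \<in> p" if "x \<in> p" "y \<in> p" for x y using additive_subgroup.a_closed[OF p.is_additive_subgroup that] by simp
  show "a \<otimes> x \<in> p" if "a \<in> A" "x \<in> p" for a x using p.I_l_closed[OF that(2), of a] that(1) by simp
qed

lemma (in field) denominators_prime:
  assumes A: "subring A R" and p: "primeideal p (R\<lparr>carrier := A\<rparr>)"
  shows "denominators R A (A - p)"
proof -
  interpret p: primeideal p "R\<lparr>carrier := A\<rparr>" by fact
  have "\<one> \<notin> p" using p.one_imp_carrier p.I_notcarr by auto
  moreover have "s \<otimes> t \<in> A - p" if "s \<in> A - p" "t \<in> A - p" for s t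
    using that p.I_prime[of s t] subringE(6)[OF A] by auto
  ultimately show ?thesis
    using subringE(3)[OF A] additive_subgroup.zero_closed[OF p.is_additive_subgroup]
    by (intro denominators.intro denominators_axioms.intro field_axioms A) auto
qed

lemma (in field) local_subring_prime:
  assumes A: "subring A R" and p: "primeideal p (R\<lparr>carrier := A\<rparr>)"
  shows "local_subring R (ring.fractions R A (A - p)) (ring.fractions R p (A - p))"
proof -
  interpret p: primeideal p "R\<lparr>carrier := A\<rparr>" by fact
  interpret D: denominators R A "A - p" by (rule denominators_prime[OF A p])
  have sub: "subalgebra A p R" by (rule subalgebra_if_ideal[OF A p.ideal_axioms])
  have pA: "p \<subseteq> A" using p.a_subset by simp
  have pc: "p \<subseteq> carrier R" using subalgebraD(1)[OF sub] .
  show ?thesis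
  proof (intro local_subring.intro local_subring_axioms.intro is_cring)
    show "subring (fractions A (A - p)) R" by (rule D.subring_fractions)
    show "fractions p (A - p) \<subseteq> fractions A (A - p)" using pA by (auto simp: fractions_def)
    show "x \<oplus> y \<in> fractions p (A - p)" if "x \<in> fractions p (A - p)" "y \<in> fractions p (A - p)" for x y
      using D.fractions_add_mem[OF sub that] .
    show "a \<otimes> x \<in> fractions p (A - p)" if "a \<in> fractions A (A - p)" "x \<in> fractions p (A - p)" for a x
      using D.fractions_mult_mem[OF sub that] .
    show "\<one> \<notin> fractions p (A - p)"
    proof
      assume "\<one> \<in> fractions p (A - p)"
      then obtain s where "s \<in> A - p" "s \<otimes> \<one> \<in> p" using D.fractions_iff[OF pc] by blast
      then show False using D.P_closed(1) by simp
    qed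
    fix a assume a: "a \<in> fractions A (A - p)" "a \<notin> fractions p (A - p)"
    then obtain s where s: "a \<in> carrier R" "s \<in> A - p" "s \<otimes> a \<in> A"
      using D.fractions_iff[OF D.A_props(1)] by blast
    then have sa: "s \<otimes> a \<in> A - p" using a(2) D.fractions_iff[OF pc] by blast
    have sc: "s \<in> carrier R" using s(2) D.P_closed(1) by blast
    \<comment> \<open>Since \<open>a = (s a) / s\<close> with both \<open>s a\<close> and
      \<open>s\<close> outside \<open>p\<close>, the inverse \<open>s / (s a)\<close> is again an
      element of the localization.\<close>
    define u where "u = s \<otimes> inv (s \<otimes> a)"
    have "u \<in> fractions A (A - p)" using sa s(2) by (auto simp: u_def fractions_def)
    moreover have "u \<otimes> a = \<one>"
      using D.P_inv[OF sa] s(1) sc by (simp add: u_def m_ac)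
    ultimately show "\<exists>u\<in>fractions A (A - p). u \<otimes> a = \<one>" by blast
  qed
qed

text \<open>The elements \<open>a \<in> A\<close> such that \<open>a b\<^sup>n\<close> is an \<open>A\<close>-combination of lower powers of \<open>b\<close> form an ideal.\<close>

lemma (in cring) integral_of_degree_local_global:
  assumes A: "subring A R" and b: "b \<in> carrier R"
    and local: "\<And>p. primeideal p (R\<lparr>carrier := A\<rparr>) \<Longrightarrow>
      \<exists>s c. s \<in> A - p \<and> c \<in> {..<n} \<rightarrow> A \<and> s \<otimes> b [^] n = (\<Oplus>i\<in>{..<n}. c i \<otimes> b [^] i)"
  shows "integral_of_degree A n b"
proof -
  note A_props = subringE[OF A]
  interpret RA: cring "R\<lparr>carrier := A\<rparr>"
    using subcringI'[OF A] subcring_iff A_props(1) by blast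
  define I where
    "I = {a \<in> A. \<exists>c. c \<in> {..<n} \<rightarrow> A \<and> a \<otimes> b [^] n = (\<Oplus>i\<in>{..<n}. c i \<otimes> b [^] i)}"
  have I_zero: "\<zero> \<in> I"
  proof -
    have "(\<Oplus>i\<in>{..<n}. \<zero> \<otimes> b [^] i) = (\<Oplus>i\<in>{..<n}. \<zero>)" using b by (intro finsum_cong') auto
    then show ?thesis
      using A_props(2) b by (auto simp: I_def finsum_zero intro!: exI[of _ "\<lambda>_. \<zero>"])
  qed
  have I_add: "x \<oplus> y \<in> I" if "x \<in> I" "y \<in> I" for x y
  proof -
    obtain c where c: "x \<in> A" "c \<in> {..<n} \<rightarrow> A" "x \<otimes> b [^] n = (\<Oplus>i\<in>{..<n}. c i \<otimes> b [^] i)"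
      using \<open>x \<in> I\<close> by (auto simp: I_def)
    obtain d where d: "y \<in> A" "d \<in> {..<n} \<rightarrow> A" "y \<otimes> b [^] n = (\<Oplus>i\<in>{..<n}. d i \<otimes> b [^] i)"
      using \<open>y \<in> I\<close> by (auto simp: I_def)
    have cc: "x \<in> carrier R" "y \<in> carrier R" "\<And>i. i < n \<Longrightarrow> c i \<in> carrier R" "\<And>i. i < n \<Longrightarrow> d i \<in> carrier R"
      using c d A_props(1) by auto
    have "(\<Oplus>i\<in>{..<n}. (c i \<oplus> d i) \<otimes> b [^] i) = (\<Oplus>i\<in>{..<n}. c i \<otimes> b [^] i \<oplus> d i \<otimes> b [^] i)"
      using b cc by (intro finsum_cong') (auto simp: l_distr)
    also have "\<dots> = (\<Oplus>i\<in>{..<n}. c i \<otimes> b [^] i) \<oplus> (\<Oplus>i\<in>{..<n}. d i \<otimes> b [^] i)"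
      using b cc by (intro finsum_addf) auto
    also have "\<dots> = (x \<oplus> y) \<otimes> b [^] n" using b cc c d by (simp add: l_distr)
    finally show ?thesis
      using c d A_props(7) by (auto simp: I_def intro!: exI[of _ "\<lambda>i. c i \<oplus> d i"])
  qed
  have I_mult: "a \<otimes> x \<in> I" if "a \<in> A" "x \<in> I" for a x
  proof -
    obtain c where c: "x \<in> A" "c \<in> {..<n} \<rightarrow> A" "x \<otimes> b [^] n = (\<Oplus>i\<in>{..<n}. c i \<otimes> b [^] i)"
      using \<open>x \<in> I\<close> by (auto simp: I_def)
    have cc: "x \<in> carrier R" "a \<in> carrier R" "\<And>i. i < n \<Longrightarrow> c i \<in> carrier R"
      using c that A_props(1) by auto
    have "(\<Oplus>i\<in>{..<n}. (a \<otimes> c i) \<otimes> b [^] i) = (\<Oplus>i\<in>{..<n}. a \<otimes> (c i \<otimes> b [^] i))"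
      using b cc by (intro finsum_cong') (auto simp: m_assoc)
    also have "\<dots> = a \<otimes> (\<Oplus>i\<in>{..<n}. c i \<otimes> b [^] i)"
      using b cc by (intro finsum_rdistr[symmetric]) auto
    also have "\<dots> = (a \<otimes> x) \<otimes> b [^] n" using b cc by (simp add: m_assoc flip: c(3))
    finally show ?thesis
      using c that(1) A_props(6) by (auto simp: I_def intro!: exI[of _ "\<lambda>i. a \<otimes> c i"])
  qed
  have IA: "I \<subseteq> A" by (auto simp: I_def)
  have "ideal I (R\<lparr>carrier := A\<rparr>)"
  proof (rule idealI[OF RA.ring_axioms])
    show "subgroup I (add_monoid (R\<lparr>carrier := A\<rparr>))"
    proof (rule RA.add.subgroupI)
      fix x assume x: "x \<in> I"
      have "\<ominus>\<^bsub>R\<lparr>carrier := A\<rparr>\<^esub> x = (\<ominus>\<^bsub>R\<lparr>carrier := A\<rparr>\<^esub> \<one>) \<otimes> x"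
      proof -
        have "x \<in> A" "x \<in> carrier R" using x IA A_props(1) by auto
        then show ?thesis using RA.l_minus[of \<one> x] A_props(3) by simp
      qed
      moreover have "\<ominus>\<^bsub>R\<lparr>carrier := A\<rparr>\<^esub> \<one> \<in> A" using RA.a_inv_closed[of \<one>] A_props(3) by simp
      ultimately show "\<ominus>\<^bsub>R\<lparr>carrier := A\<rparr>\<^esub> x \<in> I" using I_mult x by simp
    qed (use IA I_zero I_add in auto)
    show "a \<otimes>\<^bsub>R\<lparr>carrier := A\<rparr>\<^esub> x \<in> I" if "x \<in> I" "a \<in> carrier (R\<lparr>carrier := A\<rparr>)" for a x
      using I_mult that by simp
    show "x \<otimes>\<^bsub>R\<lparr>carrier := A\<rparr>\<^esub> a \<in> I" if "x \<in> I" "a \<in> carrier (R\<lparr>carrier := A\<rparr>)" for a x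
      using I_mult[of a x] that IA A_props(1) m_comm[of a x] by (auto simp: subset_iff)
  qed
  moreover have "\<not> I \<subseteq> p" if p: "primeideal p (R\<lparr>carrier := A\<rparr>)" for p
  proof -
    obtain s c where "s \<in> A - p" "c \<in> {..<n} \<rightarrow> A" "s \<otimes> b [^] n = (\<Oplus>i\<in>{..<n}. c i \<otimes> b [^] i)"
      using local[OF p] by blast
    then show ?thesis by (auto simp: I_def)
  qed
  \<comment> \<open>An ideal contained in no prime ideal contains \<open>\<one>\<close>, and for
    \<open>a = \<one>\<close> the defining relation of \<open>I\<close> is the integral equation
    sought.\<close>
  ultimately have "\<one> \<in> I" using RA.ex_prime_ideal[of I] by auto
  then show ?thesis
    using b by (auto simp: I_def integral_of_degree_def)
qed

text \<open>A common denominator of the coefficients moves to the leading power, which is how the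
  local hypothesis of \<open>integral_of_degree_local_global\<close> is met.\<close>

lemma (in denominators) clear_denominators_integral_of_degree:
  assumes b: "b \<in> carrier R" and int: "integral_of_degree (fractions A P) n b"
  shows "\<exists>s c. s \<in> P \<and> c \<in> {..<n} \<rightarrow> A \<and> s \<otimes> b [^] n = (\<Oplus>i\<in>{..<n}. c i \<otimes> b [^] i)"
proof -
  obtain c where c: "c \<in> {..<n} \<rightarrow> fractions A P" "b [^] n = (\<Oplus>i\<in>{..<n}. c i \<otimes> b [^] i)"
    using int by (auto simp: integral_of_degree_def)
  have fc: "fractions A P \<subseteq> carrier R" using subringE(1)[OF subring_fractions] .
  have cc: "c i \<in> carrier R" if "i < n" for i using c(1) fc that by auto
  obtain f where f: "\<And>k. k \<in> fractions A P \<Longrightarrow> f k \<in> P \<and> f k \<otimes> k \<in> A"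
    using fractions_iff[OF A_props(1)] by metis
  obtain s where s: "s \<in> P" "\<And>i. i < n \<Longrightarrow> s \<otimes> c i \<in> A"
    using common_denominator[OF subring fc P_subset P_one P_mult _ _ c(1)] f
    by blast
  have sc: "s \<in> carrier R" using s(1) P_closed by blast
  have "(\<Oplus>i\<in>{..<n}. (s \<otimes> c i) \<otimes> b [^] i) = (\<Oplus>i\<in>{..<n}. s \<otimes> (c i \<otimes> b [^] i))"
    using b cc sc by (intro finsum_cong') (auto simp: m_assoc)
  also have "\<dots> = s \<otimes> (\<Oplus>i\<in>{..<n}. c i \<otimes> b [^] i)"
    using b cc sc by (intro finsum_rdistr[symmetric]) auto
  finally have "s \<otimes> b [^] n = (\<Oplus>i\<in>{..<n}. (s \<otimes> c i) \<otimes> b [^] i)"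
    by (simp add: c(2))
  moreover have "(\<lambda>i. s \<otimes> c i) \<in> {..<n} \<rightarrow> A" using s(2) by auto
  ultimately show ?thesis using s(1) by (intro exI[of _ s] exI[of _ "\<lambda>i. s \<otimes> c i"]) simp
qed

section \<open>Projective finite extensions\<close>

lemma (in denominators) subring_fractions_overring:
  assumes B: "subring B R" "A \<subseteq> B"
  shows "subring (fractions B P) R"
proof -
  interpret B: denominators R B P
    using B P_subset P_one P_mult P_nonzero
    by (intro denominators.intro denominators_axioms.intro field_axioms) auto
  show ?thesis by (rule B.subring_fractions)
qed

text \<open>The minimal polynomial divides every polynomial over \<open>K\<close> that vanishes at
  \<open>x\<close>.\<close>

lemma (in domain) degree_le_if_integral_of_degree:
  assumes K: "subfield K R" and x: "x \<in> carrier R"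
    and m: "m \<ge> 1" "integral_of_degree K m x"
  shows "(algebraic over K) x" "length (Irr K x) - 1 \<le> m"
proof -
  have Kr: "subring K R" using subfieldE(1)[OF K] .
  obtain p where p: "p \<in> carrier (univ_poly R K)" "hd p = \<one>" "length p - 1 = m" "eval p x = \<zero>"
    using ex_monic_root_iff_integral_of_degree[OF Kr x m(1)] m(2) by blast
  have ne: "p \<noteq> []" using p(3) m(1) by auto
  show alg: "(algebraic over K) x" by (rule algebraicI[OF p(1) ne p(4)])
  show "length (Irr K x) - 1 \<le> m"
    using pdivides_imp_degree_le[OF Kr IrrE(1)[OF K x alg] p(1) ne Irr_minimal[OF K x alg p(1,4)]] p(3)
    by simp
qed

text \<open>Dividing the equation of \<open>a \<otimes> x\<close> by the \<open>m\<close>-th power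
  of \<open>a\<close> multiplies the coefficient of index \<open>i\<close> by the power of
  \<open>a\<close> with exponent \<open>i - m\<close>, which lies in \<open>K\<close>.\<close>

lemma (in field) integral_of_degree_divide:
  assumes K: "subfield K R" and a: "a \<in> K - {\<zero>}" and x: "x \<in> carrier R"
    and int: "integral_of_degree K m (a \<otimes> x)"
  shows "integral_of_degree K m x"
proof -
  have Kr: "subring K R" using subfieldE(1)[OF K] .
  note K_props = subringE[OF Kr]
  have ac: "a \<in> carrier R" using a K_props(1) by auto
  have pow_K: "a [^] i \<in> K" for i :: nat
    using a K_props(3,6) by (induction i) auto
  obtain c where c: "c \<in> {..<m} \<rightarrow> K" "(a \<otimes> x) [^] m = (\<Oplus>i\<in>{..<m}. c i \<otimes> (a \<otimes> x) [^] i)"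
    using int by (auto simp: integral_of_degree_def)
  have cc: "c i \<in> carrier R" if "i < m" for i using c(1) K_props(1) that by auto
  have "a [^] i \<noteq> \<zero>" for i :: nat
  proof (induction i)
    case (Suc i)
    then show ?case using integral[of "a [^] i" a] a ac by auto
  qed simp
  then have am: "a [^] m \<in> carrier R - {\<zero>}" using ac by simp
  define u where "u = inv (a [^] m)"
  have u: "u \<in> carrier R" "u \<otimes> a [^] m = \<one>"
    using am by (simp_all add: u_def field_Units)
  have uK: "u \<in> K"
    using subfield_m_inv(1)[OF K, of "a [^] m"] pow_K am by (simp add: u_def)
  have "x [^] m = u \<otimes> (a \<otimes> x) [^] m"
    using u ac x by (simp add: nat_pow_distrib flip: m_assoc)
  also have "\<dots> = (\<Oplus>i\<in>{..<m}. u \<otimes> (c i \<otimes> (a \<otimes> x) [^] i))"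
    unfolding c(2) using u cc ac x by (intro finsum_rdistr) auto
  also have "\<dots> = (\<Oplus>i\<in>{..<m}. (u \<otimes> c i \<otimes> a [^] i) \<otimes> x [^] i)"
    using u cc ac x by (intro finsum_cong') (auto simp: nat_pow_distrib m_assoc)
  finally show ?thesis
    unfolding integral_of_degree_def using uK c(1) pow_K K_props(6)
    by (intro bexI[of _ "\<lambda>i. u \<otimes> c i \<otimes> a [^] i"]) (auto simp: Pi_iff)
qed

section \<open>The extension and its rank\<close>

locale projective_finite_extension = field +
  fixes A B K L :: "'a set"
  assumes A: "subring A R" and B: "subring B R" and AB: "A \<subseteq> B"
    and fg: "finitely_generated_module (R\<lparr>carrier := A\<rparr>) (mult_module R B)"
    and proj: "projective_module (R\<lparr>carrier := A\<rparr>) (mult_module R B)"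
    and K_def: "K = fraction_field R A" and L_def: "L = fraction_field R B"
begin

lemmas A_props = subringE[OF A]
lemmas B_props = subringE[OF B]

lemma subalgebra_B: "subalgebra A B R"
  using AB B_props by (intro subalgebraI_subring[OF A]) auto

sublocale nonzero: denominators R A "A - {\<zero>}"
proof (intro denominators.intro denominators_axioms.intro field_axioms A)
  show "s \<otimes> t \<in> A - {\<zero>}" if "s \<in> A - {\<zero>}" "t \<in> A - {\<zero>}" for s t
    using that A_props(1,6) integral[of s t] by auto
qed (use A_props(3) in auto)

lemma K_eq: "K = fractions A (A - {\<zero>})"
  by (simp add: K_def fraction_field_def fractions_def)

lemma subfield_K: "subfield K R"
  unfolding K_eq
proof (rule subfieldI'[OF nonzero.subring_fractions])
  fix k assume k: "k \<in> fractions A (A - {\<zero>}) - {\<zero>}"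
  then obtain s where s: "k \<in> carrier R" "s \<in> A - {\<zero>}" "s \<otimes> k \<in> A"
    using nonzero.fractions_iff[OF A_props(1)] by blast
  have sc: "s \<in> carrier R" "s \<noteq> \<zero>" using s(2) A_props(1) by auto
  have ku: "inv k \<in> carrier R" "k \<otimes> inv k = \<one>" using k s(1) by (simp_all add: field_Units)
  \<comment> \<open>The numerator \<open>s \<otimes> k\<close> of \<open>k\<close> serves as a
    denominator of \<open>inv k\<close>, with product \<open>s\<close>.\<close>
  have "s \<otimes> k \<in> A - {\<zero>}" using s sc k integral[of s k] by auto
  moreover have "(s \<otimes> k) \<otimes> inv k = s" using s(1) sc(1) ku by (simp add: m_assoc)
  ultimately show "inv k \<in> fractions A (A - {\<zero>})"
    using ku(1) s(2) by (intro nonzero.fractionsI[OF A_props(1), of _ "s \<otimes> k"]) auto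
qed

text \<open>At the zero prime, \<open>A_p\<close> is \<open>K\<close> itself. This prime supplies
  the finite dimension over \<open>K\<close> and later determines the rank.\<close>

lemma primeideal_zero: "primeideal {\<zero>} (R\<lparr>carrier := A\<rparr>)"
proof -
  interpret RA: domain "R\<lparr>carrier := A\<rparr>"
    using subdomainI'[OF A] subdomain_is_domain by blast
  show ?thesis using RA.zeroprimeideal by simp
qed

lemma ex_local_basis:
  assumes p: "primeideal p (R\<lparr>carrier := A\<rparr>)"
  shows "\<exists>S. basis_over (fractions A (A - p)) (fractions B (A - p)) S"
proof -
  interpret D: denominators R A "A - p" by (rule denominators_prime[OF A p])
  interpret local_subring R "fractions A (A - p)" "fractions p (A - p)"
    by (rule local_subring_prime[OF A p])
  obtain T g where "dual_basis A B T g"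
    using dual_basis_if_projective[OF A subalgebra_B fg proj] by blast
  then obtain g' where "dual_basis (fractions A (A - p)) (fractions B (A - p)) T g'"
    using D.dual_basis_fractions[OF subalgebra_B] by blast
  then show ?thesis
    by (rule dual_basis_imp_basis[OF D.subalgebra_fractions[OF subalgebra_B]])
qed

definition fracs_B :: "'a set" where "fracs_B = fractions B (A - {\<zero>})"

lemma subring_fracs_B: "subring fracs_B R"
  unfolding fracs_B_def by (rule nonzero.subring_fractions_overring[OF B AB])

lemma subalgebra_fracs_B: "subalgebra K fracs_B R"
  unfolding fracs_B_def K_eq by (rule nonzero.subalgebra_fractions[OF subalgebra_B])

text \<open>The vector space does not depend on \<open>p\<close>, and so neither does the size of a
  local basis.\<close>

lemma dimension_if_local_basis:
  assumes p: "primeideal p (R\<lparr>carrier := A\<rparr>)"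
    and S: "basis_over (fractions A (A - p)) (fractions B (A - p)) S"
  shows "dimension (card S) K fracs_B"
proof (rule dimension_if_basis_over[OF subfield_K subalgebra_fracs_B _ _ _ _ _ _ S])
  interpret D: denominators R A "A - p" by (rule denominators_prime[OF A p])
  have P: "A - p \<subseteq> A - {\<zero>}" using D.P_nonzero by auto
  show "subring (fractions A (A - p)) R" by (rule D.subring_fractions)
  show "fractions A (A - p) \<subseteq> K" unfolding K_eq fractions_def using P by blast
  show "subalgebra (fractions A (A - p)) (fractions B (A - p)) R"
    by (rule D.subalgebra_fractions[OF subalgebra_B])
  show "fractions B (A - p) \<subseteq> fracs_B" unfolding fracs_B_def fractions_def using P by blast
  have A_sub: "A \<subseteq> fractions A (A - p)" by (rule D.subset_fractions[OF A_props(1)])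
  have B_sub: "B \<subseteq> fractions B (A - p)" by (rule D.subset_fractions[OF B_props(1)])
  show "\<exists>s\<in>fractions A (A - p) - {\<zero>}. s \<otimes> k \<in> fractions A (A - p)" if k: "k \<in> K" for k
  proof -
    obtain s where "s \<in> A - {\<zero>}" "s \<otimes> k \<in> A"
      using k nonzero.fractions_iff[OF A_props(1)] unfolding K_eq by blast
    then show ?thesis using A_sub by (intro bexI[of _ s]) auto
  qed
  show "\<exists>s\<in>fractions A (A - p) - {\<zero>}. s \<otimes> x \<in> fractions B (A - p)" if x: "x \<in> fracs_B" for x
  proof -
    obtain s where "s \<in> A - {\<zero>}" "s \<otimes> x \<in> B"
      using x nonzero.fractions_iff[OF B_props(1)] unfolding fracs_B_def by blast
    then show ?thesis using A_sub B_sub by (intro bexI[of _ s]) auto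
  qed
qed

lemma finite_dimension_fracs_B: "finite_dimension K fracs_B"
  using ex_local_basis[OF primeideal_zero] dimension_if_local_basis[OF primeideal_zero]
    finite_dimensionI by blast

text \<open>Only inverses of nonzero elements \<open>c\<close> of \<open>B\<close> have to be found.
  By finite dimension \<open>c\<close> is algebraic over \<open>K\<close>, so \<open>K[c]\<close> is
  a field; it contains the inverse and is contained in the ring \<open>fracs_B\<close>.\<close>

lemma L_eq: "L = fracs_B"
proof
  have Bc: "B \<subseteq> carrier R" using B_props(1) .
  have B_sub: "B \<subseteq> fracs_B" unfolding fracs_B_def by (rule nonzero.subset_fractions[OF Bc])
  have K_sub: "K \<subseteq> fracs_B" unfolding K_eq fracs_B_def fractions_def using AB by blast
  show "fracs_B \<subseteq> L" unfolding L_def fracs_B_def fraction_field_def fractions_def using AB by blast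
  show "L \<subseteq> fracs_B"
  proof
    fix x assume "x \<in> L"
    then obtain b c where bc: "x = b \<otimes> inv c" "b \<in> B" "c \<in> B - {\<zero>}"
      by (auto simp: L_def fraction_field_def)
    have c: "c \<in> carrier R" "c \<in> fracs_B" using bc(3) Bc B_sub by auto
    have "(algebraic over K) c"
      using finite_dimension_imp_algebraic[OF subfield_K subring_fracs_B finite_dimension_fracs_B c(2)] .
    then have sf: "subfield (simple_extension K c) R"
      using simple_extension_is_subfield[OF subfield_K c(1)] by simp
    have "c \<in> simple_extension K c"
      using simple_extension_mem[OF subfieldE(1)[OF subfield_K] c(1)] .
    then have "inv c \<in> simple_extension K c" using subfield_m_inv(1)[OF sf] bc(3) by simp
    also have "simple_extension K c \<subseteq> fracs_B"
      by (rule simple_extension_subring_incl[OF subring_fracs_B K_sub c(2)])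
    finally show "x \<in> fracs_B"
      using bc B_sub subringE(6)[OF subring_fracs_B] by blast
  qed
qed

lemma finite_dimension_L: "finite_dimension K L"
  using finite_dimension_fracs_B by (simp only: L_eq)

definition ext_degree :: nat where "ext_degree = (dim over K) L"

lemma dimension_L: "dimension ext_degree K L"
  unfolding ext_degree_def
  by (rule finite_dimensionE[OF subfield_K finite_dimension_L])

lemma card_local_basis:
  assumes "primeideal p (R\<lparr>carrier := A\<rparr>)"
    and "basis_over (fractions A (A - p)) (fractions B (A - p)) S"
  shows "card S = ext_degree"
  using dimension_if_local_basis[OF assms] dimension_L L_eq dimension_is_inj[OF subfield_K] by blast

lemma field_degree_eq: "field_degree R K L = enat ext_degree"
  using finite_dimension_L by (simp add: field_degree_def ext_degree_def over_def)

text \<open>For the definite description, \<open>ext_degree\<close> has to work at every prime,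
  whereas uniqueness needs a single prime only.\<close>

lemma module_rank_eq: "module_rank (R\<lparr>carrier := A\<rparr>) (mult_module R B) = ext_degree"
  unfolding module_rank_def
proof (rule the_equality)
  have free_iff: "free_of_rank (localized_ring (R\<lparr>carrier := A\<rparr>) (A - p))
      (localized_module (R\<lparr>carrier := A\<rparr>) (A - p) (mult_module R B)) m
    \<longleftrightarrow> (\<exists>S. card S = m \<and> basis_over (fractions A (A - p)) (fractions B (A - p)) S)"
    if p: "primeideal p (R\<lparr>carrier := A\<rparr>)" for p m
  proof -
    interpret D: denominators R A "A - p" by (rule denominators_prime[OF A p])
    show ?thesis by (rule D.free_of_rank_localized_iff[OF subalgebra_B])
  qed
  show "\<forall>p. primeideal p (R\<lparr>carrier := A\<rparr>) \<longrightarrow>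
      free_of_rank (localized_ring (R\<lparr>carrier := A\<rparr>) (carrier (R\<lparr>carrier := A\<rparr>) - p))
        (localized_module (R\<lparr>carrier := A\<rparr>) (carrier (R\<lparr>carrier := A\<rparr>) - p) (mult_module R B)) ext_degree"
  proof (intro allI impI)
    fix p assume p: "primeideal p (R\<lparr>carrier := A\<rparr>)"
    obtain S where S: "basis_over (fractions A (A - p)) (fractions B (A - p)) S"
      using ex_local_basis[OF p] by blast
    then have "card S = ext_degree" by (rule card_local_basis[OF p])
    then show "free_of_rank (localized_ring (R\<lparr>carrier := A\<rparr>) (carrier (R\<lparr>carrier := A\<rparr>) - p))
        (localized_module (R\<lparr>carrier := A\<rparr>) (carrier (R\<lparr>carrier := A\<rparr>) - p) (mult_module R B)) ext_degree"
      using free_iff[OF p, of ext_degree] S by auto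
  qed
  fix m
  assume m: "\<forall>p. primeideal p (R\<lparr>carrier := A\<rparr>) \<longrightarrow>
      free_of_rank (localized_ring (R\<lparr>carrier := A\<rparr>) (carrier (R\<lparr>carrier := A\<rparr>) - p))
        (localized_module (R\<lparr>carrier := A\<rparr>) (carrier (R\<lparr>carrier := A\<rparr>) - p) (mult_module R B)) m"
  \<comment> \<open>The zero prime is one that exists in every domain, so it pins down
    \<open>m\<close>.\<close>
  have "free_of_rank (localized_ring (R\<lparr>carrier := A\<rparr>) (A - {\<zero>}))
        (localized_module (R\<lparr>carrier := A\<rparr>) (A - {\<zero>}) (mult_module R B)) m"
    using m primeideal_zero by (auto dest: spec[of _ "{\<zero>}"])
  then obtain S where S: "card S = m" "basis_over (fractions A (A - {\<zero>})) (fractions B (A - {\<zero>})) S"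
    using free_iff[OF primeideal_zero] by blast
  then show "m = ext_degree" using card_local_basis[OF primeideal_zero S(2)] by simp
qed

section \<open>Bounds for the integral degrees\<close>

lemma B_closed: "b \<in> B \<Longrightarrow> b \<in> carrier R"
  using B_props(1) by blast

text \<open>Integral degrees are minima over \<open>n \<ge> 1\<close>; an equation of degree
  \<open>ext_degree\<close> counts only once this is known.\<close>

lemma ext_degree_pos: "ext_degree \<ge> 1"
proof (rule ccontr)
  assume "\<not> ext_degree \<ge> 1"
  then have "ext_degree = 0" by simp
  then have "dimension 0 K L" using dimension_L by metis
  then have "L = {\<zero>}" by (rule dimension_zero[OF subfield_K])
  moreover have "\<one> \<in> L" unfolding L_eq using subringE(3)[OF subring_fracs_B] .
  ultimately show False by simp
qed

text \<open>Each prime contributes an equation whose degree is the size of its own local basis. Only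
  because all these sizes equal \<open>ext_degree\<close> can the equations be combined.\<close>

lemma integral_of_degree_B:
  assumes b: "b \<in> B"
  shows "integral_of_degree A ext_degree b"
proof (rule integral_of_degree_local_global[OF A B_closed[OF b]])
  fix p assume p: "primeideal p (R\<lparr>carrier := A\<rparr>)"
  interpret D: denominators R A "A - p" by (rule denominators_prime[OF A p])
  obtain S where S: "basis_over (fractions A (A - p)) (fractions B (A - p)) S"
    using ex_local_basis[OF p] by blast
  have sub: "subring (fractions B (A - p)) R" by (rule D.subring_fractions_overring[OF B AB])
  have bB: "b \<in> fractions B (A - p)" using D.subset_fractions[OF B_props(1)] b by blast
  have "integral_of_degree (fractions A (A - p)) (card S) b"
    by (rule integral_of_degree_if_basis_over[OF D.subring_fractions
          D.subalgebra_fractions[OF subalgebra_B] S B_closed[OF b] _ subringE(3)[OF sub]])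
      (use subringE(6)[OF sub bB] in auto)
  then have "integral_of_degree (fractions A (A - p)) ext_degree b"
    using card_local_basis[OF p S] by simp
  then show "\<exists>s c. s \<in> A - p \<and> c \<in> {..<ext_degree} \<rightarrow> A \<and> s \<otimes> b [^] ext_degree = (\<Oplus>i\<in>{..<ext_degree}. c i \<otimes> b [^] i)"
    by (rule D.clear_denominators_integral_of_degree[OF B_closed[OF b]])
qed

lemma integral_degree_le: "integral_degree R A B \<le> enat ext_degree"
  unfolding integral_degree_def
proof (rule SUP_least)
  fix b assume b: "b \<in> B"
  show "integral_degree_elem R A b \<le> enat ext_degree"
    unfolding integral_degree_elem_eq[OF A B_closed[OF b]]
    using ext_degree_pos integral_of_degree_B[OF b] by (intro Inf_lower) auto
qed

lemma L_closed: "x \<in> L \<Longrightarrow> x \<in> carrier R"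
  unfolding L_eq using subringE(1)[OF subring_fracs_B] by blast

lemma integral_degree_field_le: "integral_degree R K L \<le> integral_degree R A B"
  unfolding integral_degree_def
proof (rule SUP_least)
  fix x assume x: "x \<in> L"
  then obtain a where a: "a \<in> A - {\<zero>}" "a \<otimes> x \<in> B"
    using nonzero.fractions_iff[OF B_props(1)] unfolding L_eq fracs_B_def by blast
  have AK: "A \<subseteq> K" unfolding K_eq by (rule nonzero.subset_fractions[OF A_props(1)])
  have "integral_of_degree K m x" if "integral_of_degree A m (a \<otimes> x)" for m
  proof (rule integral_of_degree_divide[OF subfield_K _ L_closed[OF x]])
    show "a \<in> K - {\<zero>}" using a(1) AK by blast
    show "integral_of_degree K m (a \<otimes> x)"
      using that AK unfolding integral_of_degree_def by blast
  qed
  \<comment> \<open>Every degree possible for \<open>a \<otimes> x\<close> over \<open>A\<close> is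
    possible for \<open>x\<close> over \<open>K\<close>, so the infimum on the left is taken over a
    larger set.\<close>
  then have "integral_degree_elem R K x \<le> integral_degree_elem R A (a \<otimes> x)"
    unfolding integral_degree_elem_eq[OF A B_closed[OF a(2)]]
      integral_degree_elem_eq[OF subfieldE(1)[OF subfield_K] L_closed[OF x]]
    by (intro Inf_superset_mono) auto
  also have "\<dots> \<le> (SUP b\<in>B. integral_degree_elem R A b)"
    using a(2) by (rule SUP_upper)
  finally show "integral_degree_elem R K x \<le> (SUP b\<in>B. integral_degree_elem R A b)" .
qed

lemma ext_degree_le_if_simple:
  assumes "simple_field_extension R K L"
  shows "enat ext_degree \<le> integral_degree R K L"
proof -
  obtain \<alpha> where \<alpha>: "\<alpha> \<in> L" "L = generate_field R (insert \<alpha> K)"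
    using assms by (auto simp: simple_field_extension_def)
  note Kr = subfieldE(1)[OF subfield_K]
  have \<alpha>c: "\<alpha> \<in> carrier R" using L_closed[OF \<alpha>(1)] .
  have KL: "K \<subseteq> L" unfolding L_eq K_eq fracs_B_def fractions_def using AB by blast
  have alg: "(algebraic over K) \<alpha>"
    using finite_dimension_imp_algebraic[OF subfield_K subring_fracs_B finite_dimension_fracs_B] \<alpha>(1) L_eq by simp
  \<comment> \<open>As \<alpha> is algebraic, the ring \<open>K[\<alpha>]\<close> is already a field
    and hence contains the field generated by \<alpha> over \<open>K\<close>.\<close>
  have "simple_extension K \<alpha> = L"
  proof
    show "simple_extension K \<alpha> \<subseteq> L"
      using simple_extension_subring_incl[OF subring_fracs_B, of K \<alpha>] KL \<alpha>(1) L_eq by simp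
    have "subfield (simple_extension K \<alpha>) R"
      using simple_extension_is_subfield[OF subfield_K \<alpha>c] alg by simp
    then show "L \<subseteq> simple_extension K \<alpha>"
      unfolding \<alpha>(2) using simple_extension_incl[OF subringE(1)[OF Kr] \<alpha>c]
        simple_extension_mem[OF Kr \<alpha>c] \<alpha>c subringE(1)[OF Kr]
      by (intro generate_field_min_subfield1) auto
  qed
  then have "ext_degree = length (Irr K \<alpha>) - 1"
    using dimension_is_inj[OF subfield_K dimension_L] dimension_simple_extension[OF subfield_K \<alpha>c alg]
    by simp
  then have "enat ext_degree \<le> integral_degree_elem R K \<alpha>"
    unfolding integral_degree_elem_eq[OF Kr \<alpha>c]
    using degree_le_if_integral_of_degree(2)[OF subfield_K \<alpha>c] by (intro Inf_greatest) auto
  also have "\<dots> \<le> integral_degree R K L"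
    unfolding integral_degree_def using \<alpha>(1) by (rule SUP_upper)
  finally show ?thesis .
qed

end

theorem theorem5p2:
  fixes F :: "('a, 'c) ring_scheme" and A B K L :: "'a set"
  assumes "field F"
    and "subdomain A F" and "subdomain B F" and "A \<subseteq> B"
    and "finitely_generated_module (F\<lparr>carrier := A\<rparr>) (mult_module F B)"
    and "projective_module (F\<lparr>carrier := A\<rparr>) (mult_module F B)"
    and "K = fraction_field F A" and "L = fraction_field F B"
  shows "(integral_degree F K L \<le> integral_degree F A B \<and>
          integral_degree F A B \<le> enat (module_rank (F\<lparr>carrier := A\<rparr>) (mult_module F B)) \<and>
          enat (module_rank (F\<lparr>carrier := A\<rparr>) (mult_module F B)) = field_degree F K L) \<and>
         (simple_field_extension F K L \<longrightarrow>
          integral_degree F K L = integral_degree F A B \<and>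
          integral_degree F A B = enat (module_rank (F\<lparr>carrier := A\<rparr>) (mult_module F B)) \<and>
          enat (module_rank (F\<lparr>carrier := A\<rparr>) (mult_module F B)) = field_degree F K L)"
proof -
  interpret field F by fact
  have "subring A F" "subring B F"
    using assms(2,3) by (simp_all add: subdomain_def subcring_def)
  then interpret projective_finite_extension F A B K L
    using assms
    by (intro projective_finite_extension.intro projective_finite_extension_axioms.intro) auto
  have "integral_degree F K L \<le> integral_degree F A B" "integral_degree F A B \<le> enat ext_degree"
    by (rule integral_degree_field_le, rule integral_degree_le)
  \<comment> \<open>In the simple case this bounds the largest term of the chain by the smallest, so
    all terms coincide.\<close>
  moreover have "enat ext_degree \<le> integral_degree F K L" if "simple_field_extension F K L"
    by (rule ext_degree_le_if_simple[OF that])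
  ultimately show ?thesis
    unfolding module_rank_eq field_degree_eq by (auto intro: order.antisym order.trans)
qed

end
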